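(* Let $L=\sum_{i=1}^n b_i(x)\frac{\partial}{\partial x_i}+\sum_{i,j=1}^n a_{ij}\frac{\partial^2}{\partial x_i\partial x_j}$ be a hypoelliptic diffusion operator on $\mathbb{R}^n$, where the $b_i$ are smooth functions, $b=(b_1,\dots,b_n)$ is Lipschitz, and $A=(a_{ij})$ is a constant nonnegative symmetric matrix (not necessarily positive definite). Let $(P_t)_{t\ge0}$ be the semigroup generated by $L$, and let $(\partial b)_y$ denote the Jacobian matrix of $b$ at $y\in\mathbb{R}^n$. Assume that there exist a constant (symmetric) positive definite matrix $\Sigma$ and a constant $a>0$ such that for every $x,y\in\mathbb{R}^n$, $$-\langle\Sigma(\partial b)_y x,x\rangle\ge a\|x\|^2.$$ Then there exists a unique $\mu\in\mathcal{P}(\mathbb{R}^n)$ such that $P_t^*\mu=\mu$ for every $t\ge0$. Moreover, there exist constants $C_1,C_2>0$ such that for every $\nu\in\mathcal{P}(\mathbb{R}^n)$ and every $t\ge0$, $$W_2(P_t^*\nu,\mu)\le C_1e^{-C_2t}W_2(\mu,\nu),$$ where $W_2$ is the $L^2$-Wasserstein distance associated with the Euclidean distance on $\mathbb{R}^n$. Moreover, $\mu$ satisfies a Poincaré inequality: for some constant $C_3>0$, $$\int f^2\,d\mu-\left(\int f\,d\mu\right)^2\le C_3\int\|\nabla f\|^2\,d\mu,\qquad f\in C_0^\infty(\mathbb{R}^n).$$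
   Context: $\langle\cdot,\cdot\rangle$ and $\|\cdot\|$ are the Euclidean inner product and norm on $\mathbb{R}^n$. $\mathcal{P}(\mathbb{R}^n)$ is the set of Borel probability measures on $\mathbb{R}^n$, and $C_0^\infty(\mathbb{R}^n)$ the set of smooth compactly supported functions. $(P_t)_{t\ge0}$ is the Markov semigroup (with $P_t1=1$) which uniquely solves in $L^\infty$ the Cauchy problem $\partial_t\phi=L\phi$, $\phi(0,\cdot)=f$; $P_t^*\mu$ is the probability measure with $\int f\,d(P_t^*\mu)=\int P_tf\,d\mu$ for all bounded Borel $f$. The Wasserstein distance is $W_2(\nu_1,\nu_2)=\inf_\pi\left(\int\|x-y\|^2\,d\pi(x,y)\right)^{1/2}\in[0,\infty]$, the infimum being over probability measures $\pi$ on $\mathbb{R}^n\times\mathbb{R}^n$ with marginals $\nu_1,\nu_2$. *)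

theory Defs
  imports "HOL-Probability.Probability"
begin

section \<open>Smooth functions and test functions\<close>

definition partial_deriv :: "'n \<Rightarrow> (real ^ 'n::finite \<Rightarrow> real) \<Rightarrow> real ^ 'n \<Rightarrow> real" where
  "partial_deriv i f x = frechet_derivative f (at x) (axis i 1)"

(* The multi-index is a list of coordinate directions, with repetitions. *)
definition iter_partial :: "'n list \<Rightarrow> (real ^ 'n::finite \<Rightarrow> real) \<Rightarrow> real ^ 'n \<Rightarrow> real" where
  "iter_partial is f = foldr partial_deriv is f"

(* Meant for open U.  All iterated partial derivatives exist and are (Frechet) differentiable
   on U, hence are also continuous there: this is C^infinity on U. *)
definition smooth_on :: "(real ^ 'n::finite) set \<Rightarrow> (real ^ 'n \<Rightarrow> real) \<Rightarrow> bool" where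
  "smooth_on U f \<longleftrightarrow> (\<forall>is. \<forall>x\<in>U. iter_partial is f differentiable (at x))"

definition tsupport :: "(real ^ 'n::finite \<Rightarrow> real) \<Rightarrow> (real ^ 'n) set" where
  "tsupport f = closure {x. f x \<noteq> 0}"

definition test_functions :: "(real ^ 'n::finite) set \<Rightarrow> (real ^ 'n \<Rightarrow> real) set" where
  "test_functions U = {\<phi>. smooth_on UNIV \<phi> \<and> compact (tsupport \<phi>) \<and> tsupport \<phi> \<subseteq> U}"

definition gradient :: "(real ^ 'n::finite \<Rightarrow> real) \<Rightarrow> real ^ 'n \<Rightarrow> real ^ 'n" where
  "gradient f x = (\<chi> i. partial_deriv i f x)"


section \<open>Distributions and hypoelliptic operators\<close>

(* A distribution on U is carried by a total functional, of which only the values on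
   test_functions U are relevant. *)
type_synonym 'n functional = "(real ^ 'n \<Rightarrow> real) \<Rightarrow> real"

(* The continuity condition is the usual seminorm estimate on each compact subset of U. *)
definition distribution_on :: "(real ^ 'n::finite) set \<Rightarrow> 'n functional \<Rightarrow> bool" where
  "distribution_on U T \<longleftrightarrow>
     (\<forall>\<phi>\<in>test_functions U. \<forall>\<psi>\<in>test_functions U. \<forall>c d.
        T (\<lambda>x. c * \<phi> x + d * \<psi> x) = c * T \<phi> + d * T \<psi>) \<and>
     (\<forall>K. compact K \<and> K \<subseteq> U \<longrightarrow>
        (\<exists>C N. \<forall>\<phi>\<in>test_functions U. tsupport \<phi> \<subseteq> K \<longrightarrow>
           \<bar>T \<phi>\<bar> \<le> C * (\<Sum>is\<in>{is. length is \<le> N}. SUP x. \<bar>iter_partial is \<phi> x\<bar>)))"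

definition dist_of_fun :: "(real ^ 'n::finite \<Rightarrow> real) \<Rightarrow> 'n functional" where
  "dist_of_fun u \<phi> = (\<integral>x. u x * \<phi> x \<partial>lborel)"

definition dist_partial :: "'n \<Rightarrow> 'n::finite functional \<Rightarrow> 'n functional" where
  "dist_partial i T \<phi> = - T (partial_deriv i \<phi>)"

definition dist_mult :: "(real ^ 'n::finite \<Rightarrow> real) \<Rightarrow> 'n functional \<Rightarrow> 'n functional" where
  "dist_mult g T \<phi> = T (\<lambda>x. g x * \<phi> x)"

(* L = sum_i b_i d_i + sum_ij a_ij d_i d_j, acting on distributions. *)
definition diffusion_op ::
    "(real ^ 'n \<Rightarrow> real ^ 'n) \<Rightarrow> real ^ 'n ^ 'n \<Rightarrow> 'n::finite functional \<Rightarrow> 'n functional" where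
  "diffusion_op b A T \<phi> =
     (\<Sum>i\<in>UNIV. dist_mult (\<lambda>x. b x $ i) (dist_partial i T) \<phi>) +
     (\<Sum>i\<in>UNIV. \<Sum>j\<in>UNIV. A $ i $ j * dist_partial i (dist_partial j T) \<phi>)"

definition smooth_distribution_on :: "(real ^ 'n::finite) set \<Rightarrow> 'n functional \<Rightarrow> bool" where
  "smooth_distribution_on U T \<longleftrightarrow>
     (\<exists>g. smooth_on U g \<and> (\<forall>\<phi>\<in>test_functions U. T \<phi> = dist_of_fun g \<phi>))"

definition hypoelliptic :: "('n::finite functional \<Rightarrow> 'n functional) \<Rightarrow> bool" where
  "hypoelliptic L \<longleftrightarrow>
     (\<forall>U T. open U \<and> distribution_on U T \<and> smooth_distribution_on U (L T)
        \<longrightarrow> smooth_distribution_on U T)"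


section \<open>The semigroup generated by an operator\<close>

definition bounded_borel :: "('a::topological_space \<Rightarrow> real) set" where
  "bounded_borel = {f \<in> borel_measurable borel. bounded (range f)}"

(* The set of Borel probability measures is space (prob_algebra borel). *)
definition markov_semigroup ::
    "(real \<Rightarrow> ('a::topological_space \<Rightarrow> real) \<Rightarrow> 'a \<Rightarrow> real) \<Rightarrow> bool" where
  "markov_semigroup P \<longleftrightarrow>
     (\<exists>p. (\<forall>t\<ge>0. p t \<in> borel \<rightarrow>\<^sub>M prob_algebra borel) \<and>
          (\<forall>t\<ge>0. \<forall>f\<in>bounded_borel. \<forall>x. P t f x = (\<integral>y. f y \<partial>p t x))) \<and>
     (\<forall>f\<in>bounded_borel. P 0 f = f) \<and>
     (\<forall>s\<ge>0. \<forall>t\<ge>0. \<forall>f\<in>bounded_borel. P (s + t) f = P s (P t f))"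

definition feller :: "(real \<Rightarrow> ('a::topological_space \<Rightarrow> real) \<Rightarrow> 'a \<Rightarrow> real) \<Rightarrow> bool" where
  "feller P \<longleftrightarrow>
     (\<forall>t\<ge>0. \<forall>f. continuous_on UNIV f \<and> bounded (range f) \<longrightarrow> continuous_on UNIV (P t f))"

(* u is a solution in L^infinity([0,oo) x R^n) of d/dt u = L u, u(0) = f, in the sense of
   distributions, integrated in time. *)
definition cauchy_solution ::
    "('n::finite functional \<Rightarrow> 'n functional) \<Rightarrow> (real ^ 'n \<Rightarrow> real) \<Rightarrow>
     (real \<Rightarrow> real ^ 'n \<Rightarrow> real) \<Rightarrow> bool" where
  "cauchy_solution L f u \<longleftrightarrow>
     (\<lambda>(t, x). u t x) \<in> borel_measurable (restrict_space borel ({0..} \<times> UNIV)) \<and>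
     bounded ((\<lambda>(t, x). u t x) ` ({0..} \<times> UNIV)) \<and>
     (\<forall>\<phi>\<in>test_functions UNIV. \<forall>t\<ge>0.
        dist_of_fun (u t) \<phi> =
          dist_of_fun f \<phi> + (\<integral>s\<in>{0..t}. L (dist_of_fun (u s)) \<phi> \<partial>lborel))"

(* The Cauchy problem in L^infinity determines P t f only up to Lebesgue null sets; the Feller
   property selects the version that has to be integrated against arbitrary (in particular
   singular) probability measures.  Without it, a semigroup redefined so as to be
   stationary at one point would still be admitted. *)
definition generates_semigroup ::
    "('n::finite functional \<Rightarrow> 'n functional) \<Rightarrow>
     (real \<Rightarrow> (real ^ 'n \<Rightarrow> real) \<Rightarrow> real ^ 'n \<Rightarrow> real) \<Rightarrow> bool" where
  "generates_semigroup L P \<longleftrightarrow>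
     markov_semigroup P \<and> feller P \<and>
     (\<forall>f\<in>bounded_borel.
        cauchy_solution L f (\<lambda>t. P t f) \<and>
        (\<forall>u. cauchy_solution L f u \<longrightarrow> (\<forall>t\<ge>0. AE x in lborel. u t x = P t f x)))"

definition dual_action ::
    "(('a::topological_space \<Rightarrow> real) \<Rightarrow> 'a \<Rightarrow> real) \<Rightarrow> 'a measure \<Rightarrow> 'a measure" where
  "dual_action Q \<mu> = (THE \<rho>. \<rho> \<in> space (prob_algebra borel) \<and>
     (\<forall>f\<in>bounded_borel. (\<integral>x. f x \<partial>\<rho>) = (\<integral>x. Q f x \<partial>\<mu>)))"

lemma prob_measure_eqI_bounded_borel:
  assumes "\<rho> \<in> space (prob_algebra borel)" "\<rho>' \<in> space (prob_algebra borel)"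
    and eq: "\<And>f. f \<in> bounded_borel \<Longrightarrow> (\<integral>x. f x \<partial>\<rho>) = (\<integral>x. f x \<partial>\<rho>')"
  shows "\<rho> = \<rho>'"
proof -
  interpret r: prob_space \<rho> using assms by (simp add: space_prob_algebra)
  interpret r': prob_space \<rho>' using assms by (simp add: space_prob_algebra)
  have s: "sets \<rho> = sets borel" "sets \<rho>' = sets borel"
    using assms by (auto simp: space_prob_algebra)
  show ?thesis
  proof (rule measure_eqI)
    fix A assume A: "A \<in> sets \<rho>"
    have "bounded (range (indicator A :: _ \<Rightarrow> real))"
      by (rule boundedI[of _ 1]) (auto simp: indicator_def)
    hence "indicator A \<in> bounded_borel" using A s by (auto simp: bounded_borel_def)
    from eq[OF this] A s have "measure \<rho> A = measure \<rho>' A"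
      by (simp add: sets_eq_imp_space_eq[OF s(1)] sets_eq_imp_space_eq[OF s(2)])
    thus "emeasure \<rho> A = emeasure \<rho>' A"
      by (simp add: r.emeasure_eq_measure r'.emeasure_eq_measure)
  qed (use s in simp)
qed

lemma dual_action_works:
  assumes "markov_semigroup P" "t \<ge> 0" "\<mu> \<in> space (prob_algebra borel)"
  shows "dual_action (P t) \<mu> \<in> space (prob_algebra borel)"
    and "f \<in> bounded_borel \<Longrightarrow> (\<integral>x. f x \<partial>dual_action (P t) \<mu>) = (\<integral>x. P t f x \<partial>\<mu>)"
proof -
  from assms(1) obtain p
    where p0: "\<forall>t\<ge>0. p t \<in> borel \<rightarrow>\<^sub>M prob_algebra borel"
      and P0: "\<forall>t\<ge>0. \<forall>f\<in>bounded_borel. \<forall>x. P t f x = (\<integral>y. f y \<partial>p t x)"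
    unfolding markov_semigroup_def by (elim conjE exE)
  have p: "p t \<in> borel \<rightarrow>\<^sub>M prob_algebra borel"
    using p0[rule_format, OF assms(2)] .
  have P: "P t f x = (\<integral>y. f y \<partial>p t x)" if "f \<in> bounded_borel" for f x
    using P0[rule_format, OF assms(2) that] .
  interpret m: prob_space \<mu> using assms by (simp add: space_prob_algebra)
  have s: "sets \<mu> = sets borel" using assms by (simp add: space_prob_algebra)
  have p': "p t \<in> \<mu> \<rightarrow>\<^sub>M prob_algebra borel" using p s by (simp cong: measurable_cong_sets)
  have sub: "p t \<in> \<mu> \<rightarrow>\<^sub>M subprob_algebra borel" using p' by (rule measurable_prob_algebraD)
  have bnd: "\<mu> \<bind> p t \<in> space (prob_algebra borel)"
    using prob_space_bind'[OF assms(3) p] sets_bind'[OF assms(3) p]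
    by (simp add: space_prob_algebra)
  have int: "(\<integral>x. f x \<partial>(\<mu> \<bind> p t)) = (\<integral>x. P t f x \<partial>\<mu>)" if f: "f \<in> bounded_borel" for f
  proof -
    obtain B where B: "\<And>x. \<bar>f x\<bar> \<le> B" and fm: "f \<in> borel_measurable borel"
      using f unfolding bounded_borel_def bounded_iff by auto
    have "(\<integral>x. f x \<partial>(\<mu> \<bind> p t)) = (\<integral>x. \<integral>y. f y \<partial>p t x \<partial>\<mu>)"
    proof (rule integral_bind[where K=borel and B=B and B'=1])
      show "AE x in \<mu>. emeasure (p t x) (space (p t x)) \<le> ennreal 1"
      proof (rule AE_I2)
        fix x assume "x \<in> space \<mu>"
        hence "subprob_space (p t x)"
          using measurable_space[OF sub] by (simp add: space_subprob_algebra)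
        thus "emeasure (p t x) (space (p t x)) \<le> ennreal 1"
          by (simp add: subprob_space.emeasure_space_le_1)
      qed
    qed (use sub fm B m.finite_measure_axioms in auto)
    thus ?thesis using P[OF f] by simp
  qed
  have "dual_action (P t) \<mu> = \<mu> \<bind> p t"
    unfolding dual_action_def
  proof (rule the_equality)
    fix \<rho> assume r: "\<rho> \<in> space (prob_algebra borel) \<and>
      (\<forall>f\<in>bounded_borel. (\<integral>x. f x \<partial>\<rho>) = (\<integral>x. P t f x \<partial>\<mu>))"
    show "\<rho> = \<mu> \<bind> p t"
      by (rule prob_measure_eqI_bounded_borel) (use r bnd int in simp_all)
  qed (use bnd int in simp)
  thus "dual_action (P t) \<mu> \<in> space (prob_algebra borel)"
    and "f \<in> bounded_borel \<Longrightarrow> (\<integral>x. f x \<partial>dual_action (P t) \<mu>) = (\<integral>x. P t f x \<partial>\<mu>)"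
    using bnd int by simp_all
qed


section \<open>Wasserstein distance\<close>

definition couplings :: "'a::euclidean_space measure \<Rightarrow> 'a measure \<Rightarrow> ('a \<times> 'a) measure set" where
  "couplings \<nu>\<^sub>1 \<nu>\<^sub>2 = {\<pi> \<in> space (prob_algebra borel).
     distr \<pi> borel fst = \<nu>\<^sub>1 \<and> distr \<pi> borel snd = \<nu>\<^sub>2}"

definition ennreal_sqrt :: "ennreal \<Rightarrow> ennreal" where
  "ennreal_sqrt x = (if x = \<top> then \<top> else ennreal (sqrt (enn2real x)))"

definition W2 :: "'a::euclidean_space measure \<Rightarrow> 'a measure \<Rightarrow> ennreal" where
  "W2 \<nu>\<^sub>1 \<nu>\<^sub>2 = (INF \<pi>\<in>couplings \<nu>\<^sub>1 \<nu>\<^sub>2.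
     ennreal_sqrt (\<integral>\<^sup>+(x, y). ennreal ((norm (x - y))\<^sup>2) \<partial>\<pi>))"

end

theory Submission
  imports Defs "HOL-Library.Diagonal_Subsequence"
begin

text \<open>
The diffusion is replaced by a random walk. Write A as a sum of rank one matrices v v^T and move from x
to x + h b(x) + w, where w is uniformly distributed on the finite set of the vectors
plus or minus sqrt(2 M h) v. Dissipativity makes the drift step a strict contraction for the
norm given by S, so running two walks with the same noise contracts the quadratic cost. By telescoping
the variance over the steps and letting each noise step be damped by the later drift steps, the law of
the walk also satisfies a Poincare inequality up to an error O(h).

The operator of the walk is consistent with L when tested against smooth functions, with an error that
depends only on the supremum and the Lipschitz constant of the function acted upon. Both are preserved
by the walk, so by the Arzela-Ascoli theorem the functions of the walk have locally uniform limits, each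
of which solves the Cauchy problem in L^infinity. Uniqueness for that problem and the Feller property
identify the limit with P_t f. Weak limits of the couplings of walks are then couplings for P_t, which
gives the contraction in W_2; the invariant measure is a weak limit of the laws started at the origin,
and the Poincare inequality at time t passes to it as t tends to infinity.
\<close>

section \<open>Weak sequential compactness of tight families\<close>

text \<open>\<open>P\<close> is known only through uniqueness for a distributional Cauchy problem,
  so there are no paths to couple: each estimate is made at a fixed step size, with constants that
  survive the limit. The obstacle is regularity. Only the first derivatives of \<open>b\<close> are
  bounded, so the walk propagates no uniform bound on second derivatives, and a pointwise Taylor
  comparison with the generator is not at hand. Hence both derivatives of the second order part are
  put on the test function. The constants: \<open>b\<close> contracts in the norm given by
  \<open>S\<close>, possibly not in the Euclidean one. Passing to that norm and back costs
  \<open>sqrt (l\<^sub>2 / l\<^sub>1)\<close>, which becomes \<open>C\<^sub>1\<close>; a step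
  multiplies squared distances by at most \<open>1 - \<kappa> * h\<close> with
  \<open>\<kappa> = a / l\<^sub>2\<close>, whence \<open>C\<^sub>2 = \<kappa> / 2\<close>. The noise
  \<open>c\<^sub>w * h\<close> of a step, summed with the weights
  \<open>(1 - \<kappa> * h) ^ k\<close>, amounts to at most \<open>c\<^sub>w / \<kappa>\<close>,
  which is the origin of \<open>C\<^sub>3\<close>. Initial laws may lack second moments, so tail
  estimates are truncated at 1.\<close>

text \<open>Schoenberg's space-filling curve: a continuous map from the line onto the cube that has a Borel
  section. It transfers Helly's selection theorem from the line to Euclidean space.\<close>

definition schoenberg :: "real \<Rightarrow> real" where
  "schoenberg r = max 0 (min 1 (1/2 - cos (pi * r)))"

lemma schoenberg_bounds: "0 \<le> schoenberg r" "schoenberg r \<le> 1"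
  by (auto simp: schoenberg_def)

lemma continuous_on_schoenberg [continuous_intros]:
  fixes f :: "'a::t2_space \<Rightarrow> real"
  shows "continuous_on A f \<Longrightarrow> continuous_on A (\<lambda>x. schoenberg (f x))"
  unfolding schoenberg_def by (intro continuous_intros)

lemma schoenberg_periodic: "schoenberg (2 * of_int n + y) = schoenberg y"
proof -
  have "cos (pi * (2 * of_int n + y)) = cos (pi * y)"
    by (simp add: distrib_left cos_add mult.commute mult.left_commute)
      (metis cos_int_2pin sin_int_2pin mult.commute mult.left_commute mult_zero_left diff_zero mult_1)
  thus ?thesis by (simp add: schoenberg_def)
qed

text \<open>The point of the Cantor set with ternary digits 0 and 2; digit 1 is avoided so that a
  gap separates the two values of the leading digit.\<close>

definition cantor_code :: "(nat \<Rightarrow> bool) \<Rightarrow> real" where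
  "cantor_code d = (\<Sum>m. 2 * of_bool (d m) / 3 ^ Suc m)"

lemma summable_cantor: "summable (\<lambda>m. 2 * of_bool (d m) / 3 ^ Suc m :: real)"
proof (rule summable_comparison_test[of _ "\<lambda>m. (2/3) * (1/3) ^ m"])
  show "\<exists>N. \<forall>n\<ge>N. norm (2 * of_bool (d n) / 3 ^ Suc n :: real) \<le> 2 / 3 * (1 / 3) ^ n"
    by (auto simp: power_divide)
qed (intro summable_mult summable_geometric, simp)

lemma cantor_code_shift:
  "cantor_code d = (2 * of_bool (d 0) + cantor_code (\<lambda>m. d (Suc m))) / 3"
proof -
  have "cantor_code d = 2 * of_bool (d 0) / 3 + (\<Sum>m. 2 * of_bool (d (Suc m)) / 3 ^ Suc (Suc m))"
    unfolding cantor_code_def using suminf_split_head[OF summable_cantor[of d]] by simp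
  also have "(\<Sum>m. 2 * of_bool (d (Suc m)) / 3 ^ Suc (Suc m)) = (\<Sum>m. 2 * of_bool (d (Suc m)) / 3 ^ Suc m / 3 :: real)"
    by (simp add: field_simps)
  also have "\<dots> = cantor_code (\<lambda>m. d (Suc m)) / 3"
    unfolding cantor_code_def using suminf_divide[OF summable_cantor[of "\<lambda>m. d (Suc m)"], of 3] by simp
  finally show ?thesis by (simp add: field_simps)
qed

lemma cantor_code_bounds: "0 \<le> cantor_code d" "cantor_code d \<le> 1"
proof -
  show "0 \<le> cantor_code d" unfolding cantor_code_def by (intro suminf_nonneg summable_cantor) auto
  have "cantor_code d \<le> (\<Sum>m. (2/3) * (1/3) ^ m)"
    unfolding cantor_code_def
    by (intro suminf_le summable_cantor summable_mult summable_geometric) (auto simp: power_divide)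
  also have "\<dots> = 1" by (subst suminf_mult) (auto simp: suminf_geometric summable_geometric)
  finally show "cantor_code d \<le> 1" .
qed

text \<open>Multiplying by \<open>3 ^ m\<close> shifts the ternary expansion. The integer part split
  off is even, as all digits are 0 or 2, and \<open>schoenberg\<close> has period 2, so only the
  leading digit of the shifted code counts: it places the point in [0, 1/3], where the function is
  0, or in [2/3, 1], where it is 1.\<close>

lemma schoenberg_cantor_code: "schoenberg (3 ^ m * cantor_code d) = of_bool (d m)"
proof (induction m arbitrary: d)
  case 0
  let ?c = "cantor_code (\<lambda>m. d (Suc m))"
  have c: "0 \<le> ?c" "?c \<le> 1" by (rule cantor_code_bounds)+
  show ?case
  proof (cases "d 0")
    case True
    have "cos (pi * ((2 + ?c) / 3)) \<le> cos (pi * (2/3))"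
      using c by (intro cos_monotone_0_pi_le mult_left_mono) (auto simp: field_simps)
    also have "pi * (2/3) = pi - pi / 3" by simp
    also have "cos (pi - pi/3) = - (1/2)" by (simp only: cos_pi_minus cos_60)
    finally show ?thesis using True by (subst cantor_code_shift) (simp add: schoenberg_def)
  next
    case False
    have "cos (pi * (?c / 3)) \<ge> cos (pi * (1/3))"
      using c by (intro cos_monotone_0_pi_le mult_left_mono) (auto simp: field_simps)
    moreover have "cos (pi * (1/3)) = 1/2" using cos_60 by simp
    ultimately show ?thesis using False by (subst cantor_code_shift) (simp add: schoenberg_def)
  qed
next
  case (Suc m)
  have "3 ^ Suc m * cantor_code d = 2 * of_int (3 ^ m * of_bool (d 0)) + 3 ^ m * cantor_code (\<lambda>m. d (Suc m))"
    by (subst cantor_code_shift) (simp add: algebra_simps)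
  thus ?case using Suc.IH[of "\<lambda>m. d (Suc m)"] schoenberg_periodic by metis
qed

definition bin_digit :: "nat \<Rightarrow> real \<Rightarrow> bool" where
  "bin_digit j x \<longleftrightarrow> odd \<lfloor>2 ^ Suc j * x\<rfloor>"

text \<open>Binary truncation: \<open>\<lfloor>2 ^ N * x\<rfloor>\<close> is the quotient by 2 of
  the next floor, whose parity is the new digit.\<close>

lemma bin_digits_sum:
  assumes "0 \<le> x" "x < 1"
  shows "(\<Sum>j<N. of_bool (bin_digit j x) / 2 ^ Suc j) = (of_int \<lfloor>2 ^ N * x\<rfloor> / 2 ^ N :: real)"
proof (induction N)
  case 0
  have "\<lfloor>x\<rfloor> = 0" using assms by (simp add: floor_eq_iff)
  thus ?case by simp
next
  case (Suc N)
  let ?n = "\<lfloor>2 ^ Suc N * x\<rfloor>"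
  have "\<lfloor>2 ^ N * x\<rfloor> = \<lfloor>(2 ^ Suc N * x) / real_of_int 2\<rfloor>" by simp
  also have "\<dots> = ?n div 2" by (subst floor_divide_real_eq_div) simp_all
  finally have *: "\<lfloor>2 ^ N * x\<rfloor> = ?n div 2" .
  define k where "k = ?n"
  have "real_of_int k = 2 * of_int (k div 2) + of_bool (odd k)"
    by (cases "odd k") (auto elim!: oddE evenE)
  hence "of_int (k div 2) / 2 ^ N + of_bool (odd k) / 2 ^ Suc N = (of_int k / 2 ^ Suc N :: real)"
    by (simp add: add_divide_distrib)
  moreover have "bin_digit N x \<longleftrightarrow> odd k" by (simp add: bin_digit_def k_def)
  ultimately show ?case using Suc * by (simp only: sum.lessThan_Suc k_def)
qed

lemma bin_digits_sums:
  assumes "0 \<le> x" "x < 1"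
  shows "(\<lambda>j. of_bool (bin_digit j x) / 2 ^ Suc j) sums x"
  unfolding sums_def bin_digits_sum[OF assms]
proof (rule LIMSEQ_I)
  fix e :: real assume "e > 0"
  obtain N where N: "(1/2) ^ N < e" using real_arch_pow_inv[OF \<open>e > 0\<close>, of "1/2"] by auto
  show "\<exists>no. \<forall>n\<ge>no. norm (of_int \<lfloor>2 ^ n * x\<rfloor> / 2 ^ n - x) < e"
  proof (intro exI allI impI)
    fix n assume "n \<ge> N"
    have "\<bar>of_int \<lfloor>2 ^ n * x\<rfloor> - 2 ^ n * x\<bar> < 1" by linarith
    moreover have "of_int \<lfloor>2 ^ n * x\<rfloor> / 2 ^ n - x = (of_int \<lfloor>2 ^ n * x\<rfloor> - 2 ^ n * x) / 2 ^ n"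
      by (simp add: field_simps)
    ultimately have "norm (of_int \<lfloor>2 ^ n * x\<rfloor> / 2 ^ n - x) \<le> (1/2) ^ n"
      by (simp add: power_divide divide_right_mono)
    also have "\<dots> \<le> (1/2) ^ N" using \<open>n \<ge> N\<close> by (intro power_decreasing) auto
    finally show "norm (of_int \<lfloor>2 ^ n * x\<rfloor> / 2 ^ n - x) < e" using N by simp
  qed
qed

text \<open>The digits of all coordinates are interleaved in one sequence: digit \<open>j\<close> of
  coordinate \<open>i\<close> sits at the position
  \<open>prod_encode (to_nat_on Basis i, j)\<close>. The function is continuous on the whole line,
  also off the Cantor set.\<close>

definition curve_coord :: "'a::euclidean_space \<Rightarrow> real \<Rightarrow> real" where
  "curve_coord i r = (\<Sum>j. schoenberg (3 ^ prod_encode (to_nat_on Basis i, j) * r) / 2 ^ Suc j)"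

text \<open>A right inverse of the curve on the half-open cube. It jumps at dyadic coordinates, so
  it is Borel but not continuous; all continuity is on the decoding side.\<close>

definition curve_code :: "'a::euclidean_space \<Rightarrow> real" where
  "curve_code z = cantor_code (\<lambda>m. bin_digit (snd (prod_decode m))
     (z \<bullet> from_nat_into Basis (fst (prod_decode m))))"

lemma curve_coord_code:
  fixes z :: "'a::euclidean_space"
  assumes "i \<in> Basis" "0 \<le> z \<bullet> i" "z \<bullet> i < 1"
  shows "curve_coord i (curve_code z) = z \<bullet> i"
proof -
  have "from_nat_into Basis (to_nat_on Basis i) = i"
    using assms(1) by (simp add: countable_finite)
  thus ?thesis
    unfolding curve_coord_def curve_code_def schoenberg_cantor_code
    using bin_digits_sums[OF assms(2,3)] by (simp add: sums_iff)
qed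

lemma continuous_on_curve_coord: "continuous_on UNIV (curve_coord i)"
  unfolding curve_coord_def
proof (rule uniform_limit_theorem)
  show "uniform_limit UNIV (\<lambda>n r. \<Sum>j<n. schoenberg (3 ^ prod_encode (to_nat_on Basis i, j) * r) / 2 ^ Suc j)
    (\<lambda>r. \<Sum>j. schoenberg (3 ^ prod_encode (to_nat_on Basis i, j) * r) / 2 ^ Suc j) sequentially"
  proof (rule Weierstrass_m_test)
    show "norm (schoenberg (3 ^ prod_encode (to_nat_on Basis i, j) * r) / 2 ^ Suc j) \<le> (1/2) * (1/2) ^ j" for j r
      using schoenberg_bounds[of "3 ^ prod_encode (to_nat_on Basis i, j) * r"]
      by (simp add: power_divide divide_right_mono)
  qed (intro summable_mult summable_geometric, simp)
qed (auto intro!: always_eventually continuous_intros)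

lemma borel_measurable_curve_code [measurable]: "curve_code \<in> borel_measurable (borel :: 'a::euclidean_space measure)"
  unfolding curve_code_def[abs_def] cantor_code_def bin_digit_def of_bool_def
  by measurable

text \<open>Escape to infinity becomes approach to the faces of the cube, which are the
  singularities of the tangent in \<open>curve_decode\<close>. Tightness will rule the faces
  out.\<close>

definition cube_map :: "'a::euclidean_space \<Rightarrow> 'a" where
  "cube_map x = (\<Sum>i\<in>Basis. (1/2 + arctan (x \<bullet> i) / pi) *\<^sub>R i)"

lemma cube_map_inner:
  assumes "i \<in> Basis"
  shows "cube_map x \<bullet> i = 1/2 + arctan (x \<bullet> i) / pi" "0 < cube_map x \<bullet> i" "cube_map x \<bullet> i < 1"
proof -
  show *: "cube_map x \<bullet> i = 1/2 + arctan (x \<bullet> i) / pi"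
    using assms by (simp add: cube_map_def inner_sum_left_Basis)
  show "0 < cube_map x \<bullet> i" "cube_map x \<bullet> i < 1"
    using arctan[of "x \<bullet> i"] pi_gt_zero unfolding * by (auto simp: field_simps)
qed

definition curve_decode :: "real \<Rightarrow> 'a::euclidean_space" where
  "curve_decode r = (\<Sum>i\<in>Basis. tan (pi * (curve_coord i r - 1/2)) *\<^sub>R i)"

lemma curve_decode_code: "curve_decode (curve_code (cube_map x)) = (x :: 'a::euclidean_space)"
proof (rule euclidean_eqI)
  fix i :: 'a assume i: "i \<in> Basis"
  have "curve_coord i (curve_code (cube_map x)) = 1/2 + arctan (x \<bullet> i) / pi"
    using curve_coord_code[OF i] cube_map_inner[OF i, of x] by simp
  thus "curve_decode (curve_code (cube_map x)) \<bullet> i = x \<bullet> i"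
    using i by (simp add: curve_decode_def inner_sum_left_Basis tan_arctan)
qed

lemma borel_measurable_curve_coord [measurable]: "curve_coord i \<in> borel_measurable borel"
  by (rule borel_measurable_continuous_onI[OF continuous_on_curve_coord])

lemma borel_measurable_curve_decode [measurable]:
  "(curve_decode :: real \<Rightarrow> 'a::euclidean_space) \<in> borel_measurable borel"
  unfolding curve_decode_def[abs_def] tan_def by measurable

lemma isCont_curve_decode:
  assumes "\<And>i. i \<in> (Basis :: 'a set) \<Longrightarrow> 0 < curve_coord i r \<and> curve_coord i r < 1"
  shows "isCont (curve_decode :: real \<Rightarrow> 'a::euclidean_space) r"
  unfolding curve_decode_def[abs_def]
proof (intro continuous_intros)
  fix i :: 'a assume i: "i \<in> Basis"
  show "isCont (curve_coord i) r" using continuous_on_curve_coord[of i] by (simp add: continuous_on_eq_continuous_at)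
  have "cos (pi * (curve_coord i r - 1/2)) > 0"
    using assms[OF i] by (intro cos_gt_zero_pi) (auto simp: field_simps)
  thus "cos (pi * (curve_coord i r - 1/2)) \<noteq> 0" by simp
qed

section \<open>Transfer of Helly's theorem from the line\<close>

lemma prob_algebraD:
  assumes "M \<in> space (prob_algebra N)"
  shows "prob_space M" "sets M = sets N" "space M = space N"
  using assms sets_eq_imp_space_eq by (auto simp: space_prob_algebra)

text \<open>Helly's theorem is applied to the images under the Borel code \<open>c\<close>. The
  jumps of \<open>c\<close> do no harm: \<open>f x\<close> is the value of
  \<open>f \<circ> curve_decode\<close> at the code of \<open>x\<close>, and this function of a real
  variable is continuous outside the sets \<open>U i\<close>. The limit law on the line gives them
  no mass, and weak convergence on the line extends to bounded functions whose discontinuities form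
  a null set.\<close>

theorem tight_weak_subsequence:
  fixes M :: "nat \<Rightarrow> 'a::euclidean_space measure"
  assumes M: "\<And>k. M k \<in> space (prob_algebra borel)"
    and tight: "\<And>e. e > 0 \<Longrightarrow> \<exists>R. \<forall>k. measure (M k) {x. R < norm x} \<le> e"
  obtains r N where "strict_mono (r :: nat \<Rightarrow> nat)" "N \<in> space (prob_algebra borel)"
    "\<And>f :: 'a \<Rightarrow> real. continuous_on UNIV f \<Longrightarrow> bounded (range f) \<Longrightarrow>
       (\<lambda>k. \<integral>x. f x \<partial>M (r k)) \<longlonglongrightarrow> (\<integral>x. f x \<partial>N)"
proof -
  define c where "c = (\<lambda>x :: 'a. curve_code (cube_map x))"
  define \<mu> where "\<mu> k = distr (M k) borel c" for k
  have [measurable_cong, simp]: "sets (M k) = sets borel" for k using M prob_algebraD by blast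
  have sp: "space (M k) = UNIV" for k using prob_algebraD(3)[OF M] by simp
  have ps: "prob_space (M k)" for k using M prob_algebraD by blast
  have cm [measurable]: "(cube_map :: 'a \<Rightarrow> 'a) \<in> borel_measurable borel"
    unfolding cube_map_def[abs_def] by (intro borel_measurable_continuous_onI continuous_intros) auto
  have c [measurable]: "c \<in> borel_measurable borel" unfolding c_def by measurable
  have rd: "real_distribution (\<mu> k)" for k
    unfolding \<mu>_def using c by (intro prob_space.real_distribution_distr[OF ps]) measurable
  have int: "(\<integral>r. g r \<partial>\<mu> k) = (\<integral>x. g (c x) \<partial>M k)" if "g \<in> borel_measurable borel" for g :: "real \<Rightarrow> real" and k
    unfolding \<mu>_def using that by (intro integral_distr) measurable
  \<comment> \<open>On the line tightness is free, since all codes lie in [0, 1]; the tightness of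
    \<open>M\<close> is spent below, on the faces.\<close>
  have "tight \<mu>"
    unfolding tight_def
  proof (intro conjI allI impI rd)
    fix e :: real assume "e > 0"
    have "measure (\<mu> k) {-1<..1} = 1" for k
    proof -
      have "c -` {-1<..1} \<inter> space (M k) = space (M k)"
        by (auto simp: c_def curve_code_def cantor_code_bounds intro!: less_le_trans[OF _ cantor_code_bounds(1), of "-1"])
      thus ?thesis unfolding \<mu>_def by (subst measure_distr) (simp_all add: prob_space.prob_space[OF ps])
    qed
    thus "\<exists>a b. a < b \<and> (\<forall>n. 1 - e < measure (\<mu> n) {a<..b})"
      using \<open>e > 0\<close> by (intro exI[of _ "-1"] exI[of _ 1]) auto
  qed
  from tight_imp_convergent_subsubsequence[OF this strict_mono_id]
  obtain r N' where r: "strict_mono r" and N': "real_distribution N'" "weak_conv_m (\<mu> \<circ> id \<circ> r) N'"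
    by blast
  interpret N': real_distribution N' by fact
  have wc: "(\<lambda>k. \<integral>x. g (c x) \<partial>M (r k)) \<longlonglongrightarrow> (\<integral>r. g r \<partial>N')"
    if "N' {x. \<not> isCont g x} = 0" "\<And>x. norm (g x) \<le> B" "g \<in> borel_measurable borel" for g :: "real \<Rightarrow> real" and B
    using weak_conv_imp_bdd_ae_continuous_conv[OF _ N'(1) N'(2) that] rd int that(3) by simp
  \<comment> \<open>The parameters at which coordinate \<open>i\<close> of the curve meets a face.
    Their mass under the limit is bounded through a continuous majorant of the indicator, along
    which the integrals converge.\<close>
  define U where "U i = {r. curve_coord i r \<le> 0 \<or> curve_coord i r \<ge> 1}" for i :: 'a
  have [measurable]: "U i \<in> sets borel" for i unfolding U_def by measurable
  have U0: "measure N' (U i) = 0" if i: "i \<in> Basis" for i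
  proof -
    have "measure N' (U i) \<le> 0 + e" if e: "e > 0" for e
    proof -
      from tight[OF e] obtain R where R: "\<And>k. measure (M k) {x. R < norm x} \<le> e" by blast
      \<comment> \<open>\<open>d\<close> is the distance from the faces that
        \<open>\<bar>x \<bullet> i\<bar> \<le> R\<close> guarantees; \<open>\<theta>\<close> is 1 on
        the faces and 0 from distance \<open>d\<close> on.\<close>
      define d where "d = 1/2 - arctan R / pi"
      have "d > 0" using arctan[of R] by (auto simp: d_def field_simps)
      define \<theta> where "\<theta> y = max 0 (min 1 (1 - min y (1 - y) / d))" for y
      have \<theta>01: "0 \<le> \<theta> y" "\<theta> y \<le> 1" for y by (auto simp: \<theta>_def)
      have \<theta>c: "continuous_on UNIV (\<lambda>r. \<theta> (curve_coord i r))"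
        unfolding \<theta>_def using \<open>d > 0\<close> by (intro continuous_intros continuous_on_curve_coord) auto
      have [measurable]: "\<theta> \<in> borel_measurable borel" unfolding \<theta>_def by measurable
      have lim: "(\<lambda>k. \<integral>x. \<theta> (curve_coord i (c x)) \<partial>M (r k)) \<longlonglongrightarrow> (\<integral>r. \<theta> (curve_coord i r) \<partial>N')"
        by (rule wc[of _ 1])
          (use \<theta>c \<theta>01 in \<open>auto simp: continuous_on_eq_continuous_at\<close>)
      have le: "(\<integral>x. \<theta> (curve_coord i (c x)) \<partial>M k) \<le> e" for k
      proof -
        interpret Mk: prob_space "M k" by (rule ps)
        have *: "\<theta> (curve_coord i (c x)) \<le> indicator {x. R < norm x} x" for x
        proof (cases "R < norm x")
          case False
          hence "\<bar>x \<bullet> i\<bar> \<le> R" using Basis_le_norm[OF i, of x] by linarith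
          hence "arctan (x \<bullet> i) \<le> arctan R" "arctan (- R) \<le> arctan (x \<bullet> i)" unfolding arctan_le_iff by auto
          hence "arctan (x \<bullet> i) / pi \<le> arctan R / pi" "- arctan R / pi \<le> arctan (x \<bullet> i) / pi"
            by (intro divide_right_mono; simp add: arctan_minus)+
          hence "d \<le> cube_map x \<bullet> i" "cube_map x \<bullet> i \<le> 1 - d"
            by (auto simp: d_def cube_map_inner(1)[OF i])
          hence "\<theta> (cube_map x \<bullet> i) = 0" using \<open>d > 0\<close> by (auto simp: \<theta>_def field_simps)
          thus ?thesis using False curve_coord_code[OF i, of "cube_map x"] cube_map_inner[OF i, of x]
            by (simp add: c_def)
        qed (use \<theta>01 in simp)
        have "(\<integral>x. \<theta> (curve_coord i (c x)) \<partial>M k) \<le> (\<integral>x. indicator {x. R < norm x} x \<partial>M k)"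
          by (intro integral_mono Mk.integrable_const_bound[where B = 1] *) (use \<theta>01 in \<open>auto split: split_indicator\<close>)
        also have "\<dots> = measure (M k) {x. R < norm x}" by (simp add: sp)
        finally show ?thesis using R[of k] by linarith
      qed
      have "measure N' (U i) = (\<integral>r. indicator (U i) r \<partial>N')" by simp
      also have "\<dots> \<le> (\<integral>r. \<theta> (curve_coord i r) \<partial>N')"
      proof (intro integral_mono N'.integrable_const_bound[where B = 1])
        show "indicator (U i) r \<le> \<theta> (curve_coord i r)" for r
        proof (cases "r \<in> U i")
          case True
          hence "min (curve_coord i r) (1 - curve_coord i r) \<le> 0" by (auto simp: U_def)
          hence "min (curve_coord i r) (1 - curve_coord i r) / d \<le> 0" using \<open>d > 0\<close> by (simp add: divide_le_0_iff)
          thus ?thesis using True by (auto simp: \<theta>_def)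
        qed (use \<theta>01 in simp)
      qed (use \<theta>01 in \<open>auto split: split_indicator\<close>)
      also have "\<dots> \<le> e" using LIMSEQ_le_const2[OF lim] le by blast
      finally show ?thesis by simp
    qed
    hence "measure N' (U i) \<le> 0" by (rule field_le_epsilon)
    thus ?thesis using measure_nonneg[of N' "U i"] by linarith
  qed
  define N where "N = distr N' borel (curve_decode :: real \<Rightarrow> 'a)"
  have "prob_space N" unfolding N_def by (intro N'.prob_space_distr) measurable
  hence N: "N \<in> space (prob_algebra borel)" by (simp add: space_prob_algebra N_def)
  show thesis
  proof (rule that[OF r N])
    fix f :: "'a \<Rightarrow> real" assume f: "continuous_on UNIV f" "bounded (range f)"
    from f(2) obtain B where B: "\<And>x. norm (f x) \<le> B" unfolding bounded_iff by auto
    have [measurable]: "f \<in> borel_measurable borel" using f(1) by (rule borel_measurable_continuous_onI)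
    have sub: "{x. \<not> isCont (\<lambda>r. f (curve_decode r)) x} \<subseteq> (\<Union>i\<in>(Basis :: 'a set). U i)"
    proof -
      have "isCont (\<lambda>r. f (curve_decode r)) x" if "x \<notin> (\<Union>i\<in>(Basis :: 'a set). U i)" for x
        using isCont_o2[OF isCont_curve_decode, of x f] that f(1)
        by (auto simp: U_def continuous_on_eq_continuous_at not_le)
      thus ?thesis by blast
    qed
    have "emeasure N' (\<Union>i\<in>(Basis :: 'a set). U i) \<le> (\<Sum>i\<in>(Basis :: 'a set). emeasure N' (U i))"
      by (intro emeasure_subadditive_finite) auto
    also have "\<dots> = 0" by (simp add: N'.emeasure_eq_measure U0)
    finally have "emeasure N' (\<Union>i\<in>(Basis :: 'a set). U i) = 0" by simp
    hence "N' {x. \<not> isCont (\<lambda>r. f (curve_decode r)) x} = 0"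
      using emeasure_mono[OF sub, of N'] sets.finite_UN[of "Basis :: 'a set" U borel] by simp
    from wc[OF this B] have "(\<lambda>k. \<integral>x. f (curve_decode (c x)) \<partial>M (r k)) \<longlonglongrightarrow> (\<integral>r. f (curve_decode r) \<partial>N')"
      by simp
    moreover have "(\<integral>r. f (curve_decode r) \<partial>N') = (\<integral>x. f x \<partial>N)"
      unfolding N_def by (subst integral_distr) auto
    ultimately show "(\<lambda>k. \<integral>x. f x \<partial>M (r k)) \<longlonglongrightarrow> (\<integral>x. f x \<partial>N)"
      by (simp add: c_def curve_decode_code)
  qed
qed

section \<open>The random walk\<close>

text \<open>The Markov operator of the chain that moves by a uniformly chosen map
  \<open>F j\<close>.\<close>

definition avg :: "'i set \<Rightarrow> ('i \<Rightarrow> 'a \<Rightarrow> 'a) \<Rightarrow> ('a \<Rightarrow> real) \<Rightarrow> 'a \<Rightarrow> real" where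
  "avg J F g x = (\<Sum>j\<in>J. g (F j x)) / card J"

section \<open>Averages as positive operators and Jensen's inequality\<close>

context
  fixes J :: "'i set" and F :: "'i \<Rightarrow> 'a \<Rightarrow> 'a"
  assumes J: "finite J" "J \<noteq> {}"
begin

lemma card_J: "real (card J) > 0"
  using J by (simp add: card_gt_0_iff)

lemma avg_mono: "(\<And>j. j \<in> J \<Longrightarrow> f (F j x) \<le> g (F j x)) \<Longrightarrow> avg J F f x \<le> avg J F g x"
  unfolding avg_def by (intro divide_right_mono sum_mono) auto

lemma avg_add: "avg J F (\<lambda>x. f x + g x) = (\<lambda>x. avg J F f x + avg J F g x)"
  by (simp add: avg_def sum.distrib add_divide_distrib fun_eq_iff)

lemma avg_cmult: "avg J F (\<lambda>x. c * f x) = (\<lambda>x. c * avg J F f x)"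
  by (simp add: avg_def sum_distrib_left fun_eq_iff)

lemma avg_const: "avg J F (\<lambda>x. c) = (\<lambda>x. c)"
  using card_J by (simp add: avg_def fun_eq_iff)

lemma avg_iter_Suc: "(avg J F ^^ Suc m) f x = avg J F ((avg J F ^^ m) f) x"
  by simp

lemma avg_iter_mono:
  "(\<And>x. f x \<le> g x) \<Longrightarrow> (avg J F ^^ m) f x \<le> (avg J F ^^ m) g x"
  by (induction m arbitrary: x) (auto intro: avg_mono)

lemma avg_iter_add: "(avg J F ^^ m) (\<lambda>x. f x + g x) = (\<lambda>x. (avg J F ^^ m) f x + (avg J F ^^ m) g x)"
  by (induction m) (simp_all add: avg_add)

lemma avg_iter_cmult: "(avg J F ^^ m) (\<lambda>x. c * f x) = (\<lambda>x. c * (avg J F ^^ m) f x)"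
  by (induction m) (simp_all add: avg_cmult)

lemma avg_iter_const: "(avg J F ^^ m) (\<lambda>x. c) = (\<lambda>x. c)"
  by (induction m) (simp_all add: avg_const)

lemma avg_iter_nonneg: "(\<And>x. 0 \<le> f x) \<Longrightarrow> 0 \<le> (avg J F ^^ m) f x"
  using avg_iter_mono[of "\<lambda>x. 0" f m x] by (simp add: avg_iter_const)

lemma avg_iter_abs_le:
  assumes "\<And>x. \<bar>f x\<bar> \<le> B"
  shows "\<bar>(avg J F ^^ m) f x\<bar> \<le> B"
proof -
  have "- B \<le> f x" "f x \<le> B" for x using assms[of x] by auto
  thus ?thesis
    using avg_iter_mono[of "\<lambda>x. - B" f m x] avg_iter_mono[of f "\<lambda>x. B" m x]
    by (simp add: avg_iter_const abs_le_iff minus_le_iff)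
qed

text \<open>The centre is free. The mean as centre yields Jensen's inequality; the value at the
  noiseless point \<open>drift h x\<close> yields the variance estimate of the walk.\<close>

lemma avg_var_eq:
  "avg J F (\<lambda>x. (g x)\<^sup>2) x - (avg J F g x)\<^sup>2 = avg J F (\<lambda>y. (g y - c)\<^sup>2) x - (avg J F g x - c)\<^sup>2"
proof -
  have "(\<lambda>y. (g y - c)\<^sup>2) = (\<lambda>y. (g y)\<^sup>2 + ((- 2 * c) * g y + c\<^sup>2))"
    by (simp add: power2_eq_square algebra_simps)
  hence "avg J F (\<lambda>y. (g y - c)\<^sup>2) x = avg J F (\<lambda>y. (g y)\<^sup>2) x + ((- 2 * c) * avg J F g x + c\<^sup>2)"
    by (simp only: avg_add avg_cmult avg_const)
  thus ?thesis by (simp add: power2_eq_square algebra_simps)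
qed

lemma avg_square_le: "(avg J F g x)\<^sup>2 \<le> avg J F (\<lambda>x. (g x)\<^sup>2) x"
proof -
  have "0 \<le> avg J F (\<lambda>y. (g y - avg J F g x)\<^sup>2) x"
    unfolding avg_def by (intro divide_nonneg_nonneg sum_nonneg) auto
  thus ?thesis using avg_var_eq[of g x "avg J F g x"] by simp
qed

lemma avg_iter_square_le: "((avg J F ^^ m) g x)\<^sup>2 \<le> (avg J F ^^ m) (\<lambda>x. (g x)\<^sup>2) x"
proof (induction m arbitrary: x)
  case (Suc m)
  have "((avg J F ^^ Suc m) g x)\<^sup>2 \<le> avg J F (\<lambda>x. ((avg J F ^^ m) g x)\<^sup>2) x"
    by (simp add: avg_square_le)
  also have "\<dots> \<le> avg J F ((avg J F ^^ m) (\<lambda>x. (g x)\<^sup>2)) x" by (intro avg_mono Suc)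
  finally show ?case by simp
qed simp

lemma avg_var_le: "avg J F (\<lambda>x. (g x)\<^sup>2) x - (avg J F g x)\<^sup>2 \<le> avg J F (\<lambda>y. (g y - c)\<^sup>2) x"
  using avg_var_eq[of g x c] by simp

lemma avg_abs_diff_le: "\<bar>avg J F f x - avg J F g y\<bar> \<le> (\<Sum>j\<in>J. \<bar>f (F j x) - g (F j y)\<bar>) / card J"
  unfolding avg_def diff_divide_distrib[symmetric] sum_subtractf[symmetric]
  using sum_abs[of "\<lambda>j. f (F j x) - g (F j y)" J] card_J
  by (simp add: abs_divide divide_right_mono)

end

section \<open>Euler steps with two-point noise and their contraction\<close>

locale euler_scheme =
  fixes b :: "real ^ 'n::finite \<Rightarrow> real ^ 'n" and S :: "real ^ 'n ^ 'n"
    and v :: "nat \<Rightarrow> real ^ 'n" and M :: nat and a L l\<^sub>1 l\<^sub>2 :: real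
  assumes M_pos: "M > 0" and a_pos: "a > 0" and l1_pos: "l\<^sub>1 > 0"
    and S_sym: "transpose S = S"
    and S_lower: "l\<^sub>1 * (norm x)\<^sup>2 \<le> (S *v x) \<bullet> x"
    and S_upper: "(S *v x) \<bullet> x \<le> l\<^sub>2 * (norm x)\<^sup>2"
    and b_lip: "L-lipschitz_on UNIV b"
    and b_diss: "(S *v (b x - b y)) \<bullet> (x - y) \<le> - a * (norm (x - y))\<^sup>2"
    and b_diff: "b differentiable (at x)"
begin

definition q :: "real ^ 'n \<Rightarrow> real" where "q x = (S *v x) \<bullet> x"

definition J :: "(nat \<times> bool) set" where "J = {..<M} \<times> UNIV"

text \<open>One of the \<open>M\<close> directions is drawn uniformly; the factor \<open>2 * M\<close> makes the mean of
  \<open>w\<close> times its transpose equal to \<open>2 * h\<close> times the diffusion matrix.\<close>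

definition w :: "real \<Rightarrow> nat \<times> bool \<Rightarrow> real ^ 'n" where
  "w h j = ((if snd j then 1 else - 1) * sqrt (2 * real M * h)) *\<^sub>R v (fst j)"

definition drift :: "real \<Rightarrow> real ^ 'n \<Rightarrow> real ^ 'n" where "drift h x = x + h *\<^sub>R b x"

definition F :: "real \<Rightarrow> nat \<times> bool \<Rightarrow> real ^ 'n \<Rightarrow> real ^ 'n" where
  "F h j x = drift h x + w h j"

abbreviation K :: "real \<Rightarrow> (real ^ 'n \<Rightarrow> real) \<Rightarrow> real ^ 'n \<Rightarrow> real" where
  "K h \<equiv> avg J (F h)"

text \<open>As \<open>q x \<le> l\<^sub>2 * (norm x)\<^sup>2\<close>, a Euclidean dissipation rate
  \<open>a\<close> is worth at least \<open>a / l\<^sub>2\<close> when measured by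
  \<open>q\<close>.\<close>

definition \<kappa> :: real where "\<kappa> = a / l\<^sub>2"
text \<open>The first bound lets the quadratic error
  \<open>h\<^sup>2 * l\<^sub>2 * L\<^sup>2\<close> of an Euler step consume at most half of its gain
  \<open>2 * h * a\<close>; the second keeps \<open>1 - \<kappa> * h\<close> at least 1/2. The
  summand 1 covers \<open>L = 0\<close>.\<close>

definition h\<^sub>0 :: real where "h\<^sub>0 = min (a / (l\<^sub>2 * L\<^sup>2 + 1)) (1 / (2 * \<kappa>))"
text \<open>A bound on \<open>q (w h j)\<close> per unit of \<open>h\<close>, valid for every
  \<open>j\<close> since the sum dominates each direction.\<close>

definition c\<^sub>w :: real where "c\<^sub>w = 2 * real M * (\<Sum>k<M. q (v k))"

lemma J: "finite J" "J \<noteq> {}" using M_pos by (auto simp: J_def)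

lemma card_J_eq: "card J = 2 * M" by (simp add: J_def card_cartesian_product)

lemma l2_pos: "l\<^sub>2 > 0"
  using S_lower[of "axis undefined 1"] S_upper[of "axis undefined 1"] l1_pos by simp

lemma kappa_pos: "\<kappa> > 0" using a_pos l2_pos by (simp add: \<kappa>_def)
lemma h0_pos: "h\<^sub>0 > 0"
proof -
  have "l\<^sub>2 * L\<^sup>2 + 1 > 0" using l2_pos by (intro add_nonneg_pos mult_nonneg_nonneg) auto
  thus ?thesis using a_pos kappa_pos by (simp add: h\<^sub>0_def)
qed

lemma kappa_h: "0 < h \<Longrightarrow> h \<le> h\<^sub>0 \<Longrightarrow> \<kappa> * h \<le> 1/2"
  using kappa_pos by (simp add: h\<^sub>0_def field_simps)

lemma q_nonneg: "q x \<ge> 0"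
proof -
  have "0 \<le> l\<^sub>1 * (norm x)\<^sup>2" using l1_pos by simp
  thus ?thesis using S_lower[of x] unfolding q_def by linarith
qed

lemma q_lower: "l\<^sub>1 * (norm x)\<^sup>2 \<le> q x" and q_upper: "q x \<le> l\<^sub>2 * (norm x)\<^sup>2"
  using S_lower S_upper by (simp_all add: q_def)

lemma S_inner_commute: "(S *v x) \<bullet> y = (S *v y) \<bullet> x"
proof -
  have "(S *v x) \<bullet> y = x \<bullet> (transpose S *v y)"
    by (metis dot_lmul_matrix inner_commute transpose_matrix_vector)
  thus ?thesis by (simp add: S_sym inner_commute)
qed

lemma q_add: "q (x + y) = q x + 2 * ((S *v x) \<bullet> y) + q y"
  using S_inner_commute[of x y]
  by (simp add: q_def matrix_vector_right_distrib inner_add_left inner_add_right)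

lemma q_scale: "q (c *\<^sub>R x) = c\<^sup>2 * q x"
  by (simp add: q_def matrix_vector_mult_scaleR power2_eq_square)

text \<open>Nonnegativity of \<open>q\<close> at
  \<open>sqrt e *\<^sub>R x - (1 / sqrt e) *\<^sub>R y\<close>.\<close>

lemma q_young:
  assumes "e > 0"
  shows "q (x + y) \<le> (1 + e) * q x + (1 + 1 / e) * q y"
proof -
  define s where "s = sqrt e"
  have s: "s > 0" "s\<^sup>2 = e" using assms by (auto simp: s_def)
  have "0 \<le> q (s *\<^sub>R x + (- 1 / s) *\<^sub>R y)" by (rule q_nonneg)
  also have "\<dots> = e * q x - 2 * ((S *v x) \<bullet> y) + (1 / e) * q y"
    using s unfolding q_add q_scale
    by (simp add: matrix_vector_mult_scaleR power_divide)
  finally show ?thesis unfolding q_add by (simp add: algebra_simps)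
qed

text \<open>The cross term contributes \<open>- 2 * h * a\<close> times the squared distance. The
  choice of \<open>h\<^sub>0\<close> limits the term of order \<open>h\<^sup>2\<close> to half of
  that, and what is left is converted into \<open>q\<close> by \<open>q_upper\<close>.\<close>

lemma q_drift:
  assumes h: "0 < h" "h \<le> h\<^sub>0"
  shows "q (drift h x - drift h y) \<le> (1 - \<kappa> * h) * q (x - y)"
proof -
  let ?n = "(norm (x - y))\<^sup>2"
  have hb: "h * (l\<^sub>2 * L\<^sup>2) \<le> a"
  proof -
    have p: "l\<^sub>2 * L\<^sup>2 + 1 > 0" using l2_pos by (intro add_nonneg_pos mult_nonneg_nonneg) auto
    have "h \<le> a / (l\<^sub>2 * L\<^sup>2 + 1)" using h by (simp add: h\<^sub>0_def)
    hence "h * (l\<^sub>2 * L\<^sup>2 + 1) \<le> a" using p by (simp add: field_simps)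
    thus ?thesis using h by (simp add: algebra_simps)
  qed
  have "norm (b x - b y) \<le> L * norm (x - y)"
    using lipschitz_onD[OF b_lip, of x y] by (simp add: dist_norm)
  hence "(norm (b x - b y))\<^sup>2 \<le> L\<^sup>2 * ?n" by (metis norm_ge_zero power_mono power_mult_distrib)
  hence qb: "q (b x - b y) \<le> l\<^sub>2 * (L\<^sup>2 * ?n)"
    using q_upper[of "b x - b y"] l2_pos by (meson mult_left_mono order_trans less_imp_le)
  have "drift h x - drift h y = (x - y) + h *\<^sub>R (b x - b y)" by (simp add: drift_def algebra_simps)
  hence "q (drift h x - drift h y) = q (x - y) + 2 * h * ((S *v (b x - b y)) \<bullet> (x - y)) + h\<^sup>2 * q (b x - b y)"
    unfolding q_add q_scale using S_inner_commute[of "x - y" "b x - b y"]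
    by (simp only: q_add q_scale inner_scaleR_right)
  also have "\<dots> \<le> q (x - y) + 2 * h * (- a * ?n) + h\<^sup>2 * (l\<^sub>2 * (L\<^sup>2 * ?n))"
    using h b_diss[of x y] qb by (intro add_mono mult_left_mono order_refl) auto
  also have "\<dots> = q (x - y) - 2 * h * a * ?n + h * ?n * (h * (l\<^sub>2 * L\<^sup>2))"
    by (simp add: power2_eq_square algebra_simps)
  also have "\<dots> \<le> q (x - y) - 2 * h * a * ?n + h * ?n * a"
    using h hb by (intro add_mono mult_left_mono order_refl) auto
  also have "\<dots> = q (x - y) - h * a * ?n" by simp
  also have "\<dots> \<le> q (x - y) - h * a * (q (x - y) / l\<^sub>2)"
    using q_upper[of "x - y"] h a_pos l2_pos by (intro diff_left_mono mult_left_mono) (auto simp: field_simps)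
  also have "\<dots> = (1 - \<kappa> * h) * q (x - y)" by (simp add: \<kappa>_def algebra_simps)
  finally show ?thesis .
qed

lemma F_diff: "F h j x - F h j y = drift h x - drift h y" by (simp add: F_def)

lemma q_F: "0 < h \<Longrightarrow> h \<le> h\<^sub>0 \<Longrightarrow> q (F h j x - F h j y) \<le> (1 - \<kappa> * h) * q (x - y)"
  using q_drift by (simp add: F_diff)

lemma q_w: "0 \<le> h \<Longrightarrow> j \<in> J \<Longrightarrow> q (w h j) \<le> c\<^sub>w * h"
proof -
  assume h: "0 \<le> h" and j: "j \<in> J"
  have "q (w h j) = 2 * real M * h * q (v (fst j))" using h by (simp add: w_def q_scale)
  also have "\<dots> \<le> 2 * real M * h * (\<Sum>k<M. q (v k))"
    using h j by (intro mult_left_mono member_le_sum q_nonneg) (auto simp: J_def)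
  finally show ?thesis by (simp add: c\<^sub>w_def algebra_simps)
qed

lemma cw_nonneg: "c\<^sub>w \<ge> 0" unfolding c\<^sub>w_def by (intro mult_nonneg_nonneg sum_nonneg q_nonneg) auto

text \<open>The quadratic remainder allows \<open>G\<close> to be the length of the gradient of a smooth function. Only that
  function is expanded, so no bound on the second derivatives of \<open>b\<close> is needed.\<close>

lemma K_local_lipschitz:
  assumes h: "0 < h" "h \<le> h\<^sub>0" and C: "C \<ge> 0" and G: "\<And>x. G x \<ge> 0"
    and g: "\<And>x y. \<bar>g x - g y\<bar> \<le> G x * sqrt (q (x - y)) + C * q (x - y)"
  shows "\<bar>K h g x - K h g y\<bar> \<le> sqrt (1 - \<kappa> * h) * K h G x * sqrt (q (x - y)) + C * (1 - \<kappa> * h) * q (x - y)"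
proof -
  let ?r = "1 - \<kappa> * h"
  have r: "?r \<ge> 0" using kappa_h[OF h] by simp
  have "\<bar>K h g x - K h g y\<bar> \<le> (\<Sum>j\<in>J. \<bar>g (F h j x) - g (F h j y)\<bar>) / card J"
    by (rule avg_abs_diff_le[OF J])
  also have "\<dots> \<le> (\<Sum>j\<in>J. sqrt ?r * sqrt (q (x - y)) * G (F h j x) + C * ?r * q (x - y)) / card J"
  proof (intro divide_right_mono sum_mono)
    fix j assume "j \<in> J"
    have "sqrt (q (F h j x - F h j y)) \<le> sqrt ?r * sqrt (q (x - y))"
      using q_F[OF h, of j x y] by (metis real_sqrt_le_mono real_sqrt_mult)
    thus "\<bar>g (F h j x) - g (F h j y)\<bar> \<le> sqrt ?r * sqrt (q (x - y)) * G (F h j x) + C * ?r * q (x - y)"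
      using order_trans[OF g[of "F h j x" "F h j y"] add_mono[OF mult_left_mono[OF _ G]
        mult_left_mono[OF q_F[OF h, of j x y] C]], of "sqrt ?r * sqrt (q (x - y))"]
      by (simp only: mult.assoc mult.commute[of "G _"])
  qed simp
  also have "\<dots> = sqrt ?r * sqrt (q (x - y)) * K h G x + C * ?r * q (x - y)"
    using card_J[OF J] by (simp add: avg_def sum.distrib sum_distrib_left[symmetric] add_divide_distrib)
  finally show ?thesis by (simp add: mult_ac)
qed

text \<open>A discrete gradient commutation: a step turns the pair of \<open>G\<close> and
  \<open>C\<close> into \<open>sqrt (1 - \<kappa> * h) * K h G\<close> and
  \<open>(1 - \<kappa> * h) * C\<close>, which is again admissible, so the one-step lemma iterates.
  Keeping \<open>K h G\<close> rather than a supremum of \<open>G\<close> is what later leaves the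
  integral of the squared gradient in the Poincare inequality.\<close>

lemma K_iter_local_lipschitz:
  assumes h: "0 < h" "h \<le> h\<^sub>0" and C: "C \<ge> 0" and G: "\<And>x. G x \<ge> 0"
    and g: "\<And>x y. \<bar>g x - g y\<bar> \<le> G x * sqrt (q (x - y)) + C * q (x - y)"
  shows "\<bar>(K h ^^ m) g x - (K h ^^ m) g y\<bar>
    \<le> sqrt (1 - \<kappa> * h) ^ m * (K h ^^ m) G x * sqrt (q (x - y)) + C * (1 - \<kappa> * h) ^ m * q (x - y)"
proof (induction m arbitrary: x y)
  case (Suc m)
  have r: "1 - \<kappa> * h \<ge> 0" using kappa_h[OF h] by simp
  have "\<bar>K h ((K h ^^ m) g) x - K h ((K h ^^ m) g) y\<bar>
     \<le> sqrt (1 - \<kappa> * h) * K h (\<lambda>x. sqrt (1 - \<kappa> * h) ^ m * (K h ^^ m) G x) x * sqrt (q (x - y))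
        + (C * (1 - \<kappa> * h) ^ m) * (1 - \<kappa> * h) * q (x - y)"
    using Suc C r by (intro K_local_lipschitz h mult_nonneg_nonneg avg_iter_nonneg[OF J] G) auto
  thus ?case by (simp add: avg_cmult[OF J] mult_ac)
qed (use g in simp)

lemma K_iter_lipschitz:
  assumes h: "0 < h" "h \<le> h\<^sub>0" and C: "C \<ge> 0"
    and g: "\<And>x y. \<bar>g x - g y\<bar> \<le> C * sqrt (q (x - y))"
  shows "\<bar>(K h ^^ m) g x - (K h ^^ m) g y\<bar> \<le> C * sqrt (1 - \<kappa> * h) ^ m * sqrt (q (x - y))"
  using K_iter_local_lipschitz[OF h, of 0 "\<lambda>x. C" g m x y] g C
  by (simp add: avg_iter_const[OF J] mult_ac)

section \<open>Second moments of the walk\<close>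

lemma sum_w_pm: "(\<Sum>j\<in>J. f (w h j)) = (\<Sum>k<M. f (sqrt (2 * real M * h) *\<^sub>R v k) + f (- (sqrt (2 * real M * h) *\<^sub>R v k)))"
  unfolding J_def sum.cartesian_product' by (simp add: w_def UNIV_bool add.commute)

text \<open>The growth rate of the second moment about \<open>c\<close>: the noise, and the
  displacement of \<open>c\<close> itself, which need not be a zero of \<open>b\<close>. The weight
  \<open>h\<^sub>0 + 2 / \<kappa>\<close> comes from Young's inequality in
  \<open>K_moment\<close>.\<close>

definition d\<^sub>m :: "real ^ 'n \<Rightarrow> real" where "d\<^sub>m c = c\<^sub>w + (h\<^sub>0 + 2 / \<kappa>) * q (b c)"

lemma dm_nonneg: "d\<^sub>m c \<ge> 0"
  using cw_nonneg h0_pos kappa_pos q_nonneg by (simp add: d\<^sub>m_def)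

text \<open>The two signs of the noise cancel the cross term. Young's inequality with parameter
  \<open>\<kappa> * h / 2\<close> spends half of the contraction on the displacement
  \<open>h *\<^sub>R b c\<close> of the centre; its other weight,
  \<open>1 + 2 / (\<kappa> * h)\<close>, is compensated by the factor \<open>h\<^sup>2\<close> of
  the squared displacement.\<close>

lemma K_moment:
  assumes h: "0 < h" "h \<le> h\<^sub>0"
  shows "K h (\<lambda>y. q (y - c)) y \<le> (1 - \<kappa> * h / 2) * q (y - c) + h * d\<^sub>m c"
proof -
  let ?z = "drift h y - c"
  have k: "\<kappa> * h > 0" using h kappa_pos by simp
  have "K h (\<lambda>y. q (y - c)) y = (\<Sum>j\<in>J. q (?z + w h j)) / card J"
    by (simp add: avg_def F_def algebra_simps)
  also have "(\<Sum>j\<in>J. q (?z + w h j)) = (\<Sum>j\<in>J. q ?z + q (w h j)) + (\<Sum>j\<in>J. 2 * ((S *v ?z) \<bullet> w h j))"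
    by (simp add: q_add sum.distrib)
  also have "(\<Sum>j\<in>J. 2 * ((S *v ?z) \<bullet> w h j)) = 0"
    using sum_w_pm[of "\<lambda>u. 2 * ((S *v ?z) \<bullet> u)" h] by (simp add: inner_minus_right)
  also have "((\<Sum>j\<in>J. q ?z + q (w h j)) + 0) / card J \<le> ((\<Sum>j\<in>J. q ?z + c\<^sub>w * h) + 0) / card J"
    using q_w h by (intro divide_right_mono add_mono sum_mono) auto
  also have "\<dots> = q ?z + c\<^sub>w * h" using card_J[OF J] by simp
  also have "q ?z = q ((drift h y - drift h c) + h *\<^sub>R b c)" by (simp add: drift_def algebra_simps)
  also have "\<dots> \<le> (1 + \<kappa> * h / 2) * q (drift h y - drift h c) + (1 + 1 / (\<kappa> * h / 2)) * q (h *\<^sub>R b c)"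
    using k by (intro q_young) simp
  also have "\<dots> \<le> (1 + \<kappa> * h / 2) * ((1 - \<kappa> * h) * q (y - c)) + (1 + 1 / (\<kappa> * h / 2)) * q (h *\<^sub>R b c)"
    using k q_drift[OF h] by (intro add_mono mult_left_mono) auto
  also have "\<dots> = (1 - \<kappa> * h / 2) * q (y - c) - (\<kappa> * h)\<^sup>2 / 2 * q (y - c) + h * ((h + 2 / \<kappa>) * q (b c))"
    using h kappa_pos by (simp add: q_scale field_simps power2_eq_square)
  also have "\<dots> \<le> (1 - \<kappa> * h / 2) * q (y - c) - 0 + h * ((h\<^sub>0 + 2 / \<kappa>) * q (b c))"
    using h q_nonneg by (intro add_mono diff_mono mult_left_mono mult_right_mono) auto
  finally show ?thesis by (simp add: d\<^sub>m_def algebra_simps)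
qed

text \<open>The short-time bound: started at \<open>y = c\<close> it is of order
  \<open>m * h\<close>, as regularity in time requires.\<close>

lemma K_iter_moment_linear:
  assumes h: "0 < h" "h \<le> h\<^sub>0"
  shows "(K h ^^ m) (\<lambda>y. q (y - c)) y \<le> q (y - c) + m * h * d\<^sub>m c"
proof (induction m arbitrary: y)
  case (Suc m)
  have "(K h ^^ Suc m) (\<lambda>y. q (y - c)) y \<le> K h (\<lambda>y. q (y - c) + m * h * d\<^sub>m c) y"
    by (simp only: avg_iter_Suc[OF J]) (intro avg_mono Suc J)
  also have "\<dots> = K h (\<lambda>y. q (y - c)) y + m * h * d\<^sub>m c"
    by (simp add: avg_add[OF J] avg_const[OF J])
  also have "\<dots> \<le> ((1 - \<kappa> * h / 2) * q (y - c) + h * d\<^sub>m c) + m * h * d\<^sub>m c"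
    using K_moment[OF h] by simp
  also have "(1 - \<kappa> * h / 2) * q (y - c) \<le> 1 * q (y - c)"
    using h kappa_pos q_nonneg by (intro mult_right_mono) auto
  finally show ?case by (simp add: algebra_simps)
qed simp

text \<open>The long-time bound: \<open>2 * d\<^sub>m c / \<kappa>\<close> is the fixed point of the
  recursion in \<open>K_moment\<close>, so the estimate is uniform in \<open>m\<close>. It is the
  source of all tightness.\<close>

lemma K_iter_moment_bounded:
  assumes h: "0 < h" "h \<le> h\<^sub>0"
  shows "(K h ^^ m) (\<lambda>y. q (y - c)) y \<le> q (y - c) + 2 * d\<^sub>m c / \<kappa>"
proof (induction m)
  case 0
  thus ?case using dm_nonneg[of c] kappa_pos by simp
next
  case (Suc m)
  let ?r = "1 - \<kappa> * h / 2"
  have r: "0 \<le> ?r" "?r \<le> 1" using kappa_h[OF h] h kappa_pos by auto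
  have "(K h ^^ Suc m) (\<lambda>y. q (y - c)) y = (K h ^^ m) (K h (\<lambda>y. q (y - c))) y"
    by (simp add: funpow_swap1)
  also have "\<dots> \<le> (K h ^^ m) (\<lambda>y. ?r * q (y - c) + h * d\<^sub>m c) y"
    by (intro avg_iter_mono[OF J] K_moment h)
  also have "\<dots> = ?r * (K h ^^ m) (\<lambda>y. q (y - c)) y + h * d\<^sub>m c"
    by (simp add: avg_iter_add[OF J] avg_iter_cmult[OF J] avg_iter_const[OF J])
  also have "\<dots> \<le> ?r * (q (y - c) + 2 * d\<^sub>m c / \<kappa>) + h * d\<^sub>m c"
    using Suc r h by (intro add_mono mult_left_mono) auto
  also have "\<dots> = ?r * q (y - c) + 2 * d\<^sub>m c / \<kappa>" using kappa_pos by (simp add: field_simps)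
  also have "\<dots> \<le> 1 * q (y - c) + 2 * d\<^sub>m c / \<kappa>" using r q_nonneg by (intro add_mono mult_right_mono) auto
  finally show ?case by simp
qed

text \<open>The law of total variance with the first step split off: the variances over the
  remaining \<open>m\<close> steps are averaged by the induction hypothesis, and the first step adds
  the variance of the conditional mean \<open>?g\<close>. Since \<open>?g\<close> has been damped by
  \<open>m\<close> drift steps, this addition carries the weight
  \<open>(1 - \<kappa> * h) ^ m\<close>.\<close>

lemma K_iter_variance_sum:
  assumes h: "0 < h" "h \<le> h\<^sub>0" and C: "C \<ge> 0" and G: "\<And>x. G x \<ge> 0"
    and f: "\<And>x y. \<bar>f x - f y\<bar> \<le> G x * sqrt (q (x - y)) + C * q (x - y)"
  shows "(K h ^^ m) (\<lambda>x. (f x)\<^sup>2) x - ((K h ^^ m) f x)\<^sup>2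
    \<le> (\<Sum>k<m. (1 - \<kappa> * h) ^ k) * (2 * c\<^sub>w * h * (K h ^^ m) (\<lambda>x. (G x)\<^sup>2) x + 2 * C\<^sup>2 * c\<^sub>w\<^sup>2 * h\<^sup>2)"
proof (induction m arbitrary: x)
  case 0
  show ?case by simp
next
  case (Suc m)
  let ?r = "1 - \<kappa> * h" and ?g = "(K h ^^ m) f" and ?s = "\<Sum>k<m. (1 - \<kappa> * h) ^ k"
  let ?H = "(K h ^^ m) (\<lambda>x. (G x)\<^sup>2)" and ?c = "2 * C\<^sup>2 * c\<^sub>w\<^sup>2 * h\<^sup>2"
  have r: "0 \<le> ?r" "?r \<le> 1" using kappa_h[OF h] h kappa_pos by auto
  have IH: "(K h ^^ m) (\<lambda>x. (f x)\<^sup>2) y \<le> (?g y)\<^sup>2 + (?s * (2 * c\<^sub>w * h) * ?H y + ?s * ?c)" for y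
    using Suc[of y] by (simp add: algebra_simps)
  \<comment> \<open>With the noiseless point as centre, the increments of \<open>?g\<close> come
    from \<open>w h j\<close> alone, and \<open>q (w h j)\<close> is at most
    \<open>c\<^sub>w * h\<close>.\<close>
  have "K h (\<lambda>y. (?g y)\<^sup>2) x - (K h ?g x)\<^sup>2 \<le> K h (\<lambda>y. (?g y - ?g (drift h x))\<^sup>2) x"
    by (rule avg_var_le[OF J])
  also have "\<dots> \<le> K h (\<lambda>y. ?r ^ m * (2 * c\<^sub>w * h) * ?H y + ?r ^ m * ?c) x"
  proof (rule avg_mono[OF J])
    fix j assume j: "j \<in> J"
    let ?y = "F h j x" and ?q = "q (w h j)"
    have q: "0 \<le> ?q" "?q \<le> c\<^sub>w * h" using q_nonneg q_w[of h j] h j by auto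
    have "F h j x - drift h x = w h j" by (simp add: F_def)
    hence "\<bar>?g ?y - ?g (drift h x)\<bar> \<le> sqrt ?r ^ m * (K h ^^ m) G ?y * sqrt ?q + C * ?r ^ m * ?q"
      using K_iter_local_lipschitz[OF h C G f, where m = m and x = ?y and y = "drift h x"] by simp
    hence "(?g ?y - ?g (drift h x))\<^sup>2 \<le> (sqrt ?r ^ m * (K h ^^ m) G ?y * sqrt ?q + C * ?r ^ m * ?q)\<^sup>2"
      by (metis abs_ge_zero power2_abs power_mono)
    \<comment> \<open>Separating the gradient part from the quadratic remainder costs the factor 2
      that appears in the Poincare constant.\<close>
    also have "\<dots> \<le> 2 * (sqrt ?r ^ m * (K h ^^ m) G ?y * sqrt ?q)\<^sup>2 + 2 * (C * ?r ^ m * ?q)\<^sup>2"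
      using sum_squares_bound[of "sqrt ?r ^ m * (K h ^^ m) G ?y * sqrt ?q" "C * ?r ^ m * ?q"]
      by (simp add: power2_sum)
    also have "(sqrt ?r ^ m * (K h ^^ m) G ?y * sqrt ?q)\<^sup>2 = ?r ^ m * ((K h ^^ m) G ?y)\<^sup>2 * ?q"
    proof -
      have "(sqrt ?r ^ m)\<^sup>2 = (sqrt ?r ^ 2) ^ m" by (simp only: power_mult[symmetric] mult.commute)
      thus ?thesis using r q by (simp add: power_mult_distrib)
    qed
    also have "\<dots> \<le> ?r ^ m * ?H ?y * (c\<^sub>w * h)"
      using r q avg_iter_square_le[OF J, where m = m and g = G and x = ?y and F = "F h"]
      by (intro mult_mono mult_nonneg_nonneg avg_iter_nonneg[OF J]) auto
    also have "(C * ?r ^ m * ?q)\<^sup>2 \<le> ?r ^ m * (C\<^sup>2 * (c\<^sub>w * h)\<^sup>2)"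
    proof -
      \<comment> \<open>The remainder decays like \<open>?r ^ (2 * m)\<close>; one power is given up
        so that both terms share a geometric weight.\<close>
      have "(?r ^ m)\<^sup>2 \<le> ?r ^ m"
        using r power_le_one[of ?r m] by (simp add: power2_eq_square mult_left_le)
      hence "(?r ^ m)\<^sup>2 * (C\<^sup>2 * ?q\<^sup>2) \<le> ?r ^ m * (C\<^sup>2 * (c\<^sub>w * h)\<^sup>2)"
        using q r C by (intro mult_mono power_mono mult_nonneg_nonneg) auto
      thus ?thesis by (simp add: power_mult_distrib mult_ac)
    qed
    finally show "(?g ?y - ?g (drift h x))\<^sup>2 \<le> ?r ^ m * (2 * c\<^sub>w * h) * ?H ?y + ?r ^ m * ?c"
      by (simp add: power_mult_distrib algebra_simps)
  qed
  also have "\<dots> = ?r ^ m * (2 * c\<^sub>w * h) * K h ?H x + ?r ^ m * ?c"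
    by (simp add: avg_add[OF J] avg_cmult[OF J] avg_const[OF J])
  finally have 1: "K h (\<lambda>y. (?g y)\<^sup>2) x - (K h ?g x)\<^sup>2 \<le> ?r ^ m * (2 * c\<^sub>w * h) * K h ?H x + ?r ^ m * ?c" .
  have "K h ((K h ^^ m) (\<lambda>x. (f x)\<^sup>2)) x \<le> K h (\<lambda>y. (?g y)\<^sup>2 + (?s * (2 * c\<^sub>w * h) * ?H y + ?s * ?c)) x"
    by (intro avg_mono[OF J] IH)
  also have "\<dots> = K h (\<lambda>y. (?g y)\<^sup>2) x + (?s * (2 * c\<^sub>w * h) * K h ?H x + ?s * ?c)"
    by (simp only: avg_add[OF J] avg_cmult[OF J] avg_const[OF J])
  finally have 2: "K h ((K h ^^ m) (\<lambda>x. (f x)\<^sup>2)) x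
    \<le> K h (\<lambda>y. (?g y)\<^sup>2) x + (?s * (2 * c\<^sub>w * h) * K h ?H x + ?s * ?c)" .
  have 3: "A - D \<le> (s + r) * (\<alpha> * H + c)"
    if "B - D \<le> r * \<alpha> * H + r * c" "A \<le> B + (s * \<alpha> * H + s * c)" for A B D s r \<alpha> H c :: real
    using that by (simp add: algebra_simps)
  show ?case
    unfolding avg_iter_Suc[OF J] sum.lessThan_Suc by (rule 3[OF 1 2])
qed

text \<open>The geometric series is at most \<open>1 / (\<kappa> * h)\<close>, which cancels the
  factor \<open>h\<close> of the noise. The constant in front of the gradient is thus free of
  \<open>m\<close> and \<open>h\<close>, while the remainder, of order \<open>h\<^sup>2\<close> per
  step, keeps one factor \<open>h\<close>.\<close>

lemma K_iter_variance:
  assumes h: "0 < h" "h \<le> h\<^sub>0" and C: "C \<ge> 0" and G: "\<And>x. G x \<ge> 0"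
    and f: "\<And>x y. \<bar>f x - f y\<bar> \<le> G x * sqrt (q (x - y)) + C * q (x - y)"
  shows "(K h ^^ m) (\<lambda>x. (f x)\<^sup>2) x - ((K h ^^ m) f x)\<^sup>2
    \<le> (2 * c\<^sub>w / \<kappa>) * (K h ^^ m) (\<lambda>x. (G x)\<^sup>2) x + (2 * C\<^sup>2 * c\<^sub>w\<^sup>2 / \<kappa>) * h"
proof -
  have r: "0 \<le> 1 - \<kappa> * h" "\<kappa> * h > 0" using kappa_h[OF h] h kappa_pos by auto
  have "(\<Sum>k<m. (1 - \<kappa> * h) ^ k) = (1 - (1 - \<kappa> * h) ^ m) / (\<kappa> * h)"
    using r by (subst sum_gp_strict) (auto simp: field_simps)
  also have "\<dots> \<le> 1 / (\<kappa> * h)" using r by (intro divide_right_mono) auto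
  finally have s: "(\<Sum>k<m. (1 - \<kappa> * h) ^ k) \<le> 1 / (\<kappa> * h)" .
  have "(K h ^^ m) (\<lambda>x. (f x)\<^sup>2) x - ((K h ^^ m) f x)\<^sup>2
    \<le> 1 / (\<kappa> * h) * (2 * c\<^sub>w * h * (K h ^^ m) (\<lambda>x. (G x)\<^sup>2) x + 2 * C\<^sup>2 * c\<^sub>w\<^sup>2 * h\<^sup>2)"
    using K_iter_variance_sum[OF h C G f, of m x] h cw_nonneg
    by (elim order_trans) (intro mult_right_mono s add_nonneg_nonneg mult_nonneg_nonneg avg_iter_nonneg[OF J], auto)
  also have "\<dots> = (2 * c\<^sub>w / \<kappa>) * (K h ^^ m) (\<lambda>x. (G x)\<^sup>2) x + (2 * C\<^sup>2 * c\<^sub>w\<^sup>2 / \<kappa>) * h"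
    using h kappa_pos by (simp add: field_simps power2_eq_square)
  finally show ?thesis .
qed

end

section \<open>Consistency with the generator\<close>

abbreviation dd :: "('a::real_normed_vector \<Rightarrow> 'b::real_normed_vector) \<Rightarrow> 'a \<Rightarrow> 'a \<Rightarrow> 'b" where
  "dd f e x \<equiv> frechet_derivative f (at x) e"

lemma dd_works: "f differentiable (at x) \<Longrightarrow> (f has_derivative (\<lambda>e. dd f e x)) (at x)"
  by (simp add: frechet_derivative_works)

lemma dd_unique: "(f has_derivative f') (at x) \<Longrightarrow> dd f e x = f' e"
  by (metis frechet_derivative_at)

lemma dd_scaleR: "f differentiable (at x) \<Longrightarrow> dd f (c *\<^sub>R e) x = c *\<^sub>R dd f e x"
  using linear_frechet_derivative linear_cmul by blast

lemma dd_add: "f differentiable (at x) \<Longrightarrow> dd f (e + e') x = dd f e x + dd f e' x"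
  using linear_frechet_derivative linear_add by blast

lemma dd_vector_derivative:
  assumes "f differentiable (at (x + t *\<^sub>R e))"
  shows "((\<lambda>t. f (x + t *\<^sub>R e)) has_vector_derivative dd f e (x + t *\<^sub>R e)) (at t)"
proof -
  have "((\<lambda>t. x + t *\<^sub>R e) has_derivative (\<lambda>s. s *\<^sub>R e)) (at t)" by (auto intro!: derivative_eq_intros)
  from has_derivative_compose[OF this dd_works[OF assms]] show ?thesis
    using assms by (simp add: has_vector_derivative_def dd_scaleR)
qed

lemma dd_tendsto:
  assumes "f differentiable (at x)"
  shows "((\<lambda>t. (f (x + t *\<^sub>R e) - f x) /\<^sub>R t) \<longlongrightarrow> dd f e x) (at 0)"
proof -
  have "((\<lambda>t. f (x + t *\<^sub>R e)) has_derivative (\<lambda>s. s *\<^sub>R dd f e x)) (at 0)"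
    using dd_vector_derivative[of f x 0 e] assms by (simp add: has_vector_derivative_def)
  hence *: "((\<lambda>t. norm (f (x + t *\<^sub>R e) - f x - t *\<^sub>R dd f e x) / norm t) \<longlongrightarrow> 0) (at 0)"
    by (simp add: has_derivative_at)
  have "((\<lambda>t. norm ((f (x + t *\<^sub>R e) - f x) /\<^sub>R t - dd f e x)) \<longlongrightarrow> 0) (at 0)"
  proof (rule Lim_transform_eventually[OF *])
    have "norm (f (x + t *\<^sub>R e) - f x - t *\<^sub>R dd f e x) / norm t = norm ((f (x + t *\<^sub>R e) - f x) /\<^sub>R t - dd f e x)"
      if "t \<noteq> 0" for t
    proof -
      have "(f (x + t *\<^sub>R e) - f x) /\<^sub>R t - dd f e x = (f (x + t *\<^sub>R e) - f x - t *\<^sub>R dd f e x) /\<^sub>R t"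
        using that by (simp add: scaleR_diff_right)
      thus ?thesis by (simp add: divide_inverse mult.commute)
    qed
    thus "\<forall>\<^sub>F t in at 0. norm (f (x + t *\<^sub>R e) - f x - t *\<^sub>R dd f e x) / norm t
        = norm ((f (x + t *\<^sub>R e) - f x) /\<^sub>R t - dd f e x)"
      by (auto simp: eventually_at_filter)
  qed
  thus ?thesis by (rule LIM_zero_cancel[OF tendsto_norm_zero_cancel])
qed

lemma dd_LIMSEQ:
  assumes "f differentiable (at x)" "\<And>k. S k \<noteq> 0" "S \<longlonglongrightarrow> 0"
  shows "(\<lambda>k. (f (x + S k *\<^sub>R e) - f x) /\<^sub>R S k) \<longlonglongrightarrow> dd f e x"
  using dd_tendsto[OF assms(1), of e] assms(2,3) unfolding LIMSEQ_SEQ_conv[symmetric] by blast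

lemma lipschitz_norm_diff_le: "C-lipschitz_on UNIV f \<Longrightarrow> norm (f x - f y) \<le> C * norm (x - y)"
  using lipschitz_onD[of C UNIV f x y] by (simp add: dist_norm)

lemma lipschitz_quotient_le:
  assumes "C-lipschitz_on UNIV f"
  shows "norm ((f (x + t *\<^sub>R e) - f x) /\<^sub>R t) \<le> C * norm e"
proof (cases "t = 0")
  case True
  thus ?thesis using lipschitz_on_nonneg[OF assms] by simp
next
  case False
  hence "norm (f (x + t *\<^sub>R e) - f x) / \<bar>t\<bar> \<le> C * norm e"
    using lipschitz_norm_diff_le[OF assms, of "x + t *\<^sub>R e" x] by (simp add: divide_le_eq mult_ac)
  thus ?thesis by (simp add: divide_inverse mult.commute)
qed

lemma dd_bound:
  assumes "C-lipschitz_on UNIV f" "f differentiable (at x)"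
  shows "norm (dd f e x) \<le> C * norm e"
  by (rule tendsto_upperbound[OF tendsto_norm[OF dd_tendsto[OF assms(2)]]])
    (intro always_eventually allI lipschitz_quotient_le[OF assms(1)], simp)

lemma differentiable_imp_measurable:
  assumes "\<And>x. (f :: 'a::euclidean_space \<Rightarrow> 'b::euclidean_space) differentiable (at x)"
  shows "f \<in> borel_measurable borel"
  using assms by (intro borel_measurable_continuous_onI)
    (auto simp: continuous_on_eq_continuous_at intro!: differentiable_imp_continuous_within)

lemma inverse_Suc_seq: "(\<lambda>k. inverse (real (Suc k))) \<longlonglongrightarrow> 0" "inverse (real (Suc k)) \<noteq> 0"
  using LIMSEQ_inverse_real_of_nat by auto

lemma dd_measurable:
  assumes "\<And>x. (f :: 'a::euclidean_space \<Rightarrow> 'b::euclidean_space) differentiable (at x)"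
  shows "dd f e \<in> borel_measurable borel"
proof (rule borel_measurable_LIMSEQ_metric)
  have [measurable]: "f \<in> borel_measurable borel" by (rule differentiable_imp_measurable[OF assms])
  show "(\<lambda>x. (f (x + inverse (real (Suc k)) *\<^sub>R e) - f x) /\<^sub>R inverse (real (Suc k))) \<in> borel_measurable borel" for k
    by measurable
  show "(\<lambda>k. (f (x + inverse (real (Suc k)) *\<^sub>R e) - f x) /\<^sub>R inverse (real (Suc k))) \<longlonglongrightarrow> dd f e x" for x
    by (rule dd_LIMSEQ[OF assms inverse_Suc_seq(2,1)])
qed

section \<open>Integration by parts for functions of bounded support\<close>

lemma integrable_bounded_support:
  fixes f :: "'a::euclidean_space \<Rightarrow> real"
  assumes "f \<in> borel_measurable borel" "\<And>x. norm x \<le> R \<Longrightarrow> \<bar>f x\<bar> \<le> B" "\<And>x. R < norm x \<Longrightarrow> f x = 0"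
  shows "integrable lborel f"
proof (rule integrableI_bounded_set[where A = "cball 0 R" and B = B])
  show "emeasure lborel (cball 0 R :: 'a set) < \<infinity>" by (rule emeasure_lborel_cball_finite)
qed (use assms in auto)

lemma integral_translate:
  fixes f :: "'a::euclidean_space \<Rightarrow> real"
  assumes "f \<in> borel_measurable borel"
  shows "(\<integral>x. f (x + c) \<partial>lborel) = (\<integral>x. f x \<partial>lborel)"
proof -
  have "(\<integral>x. f x \<partial>lborel) = (\<integral>x. f x \<partial>distr lborel borel ((+) c))" by (simp add: lborel_distr_plus)
  also have "\<dots> = (\<integral>x. f (c + x) \<partial>lborel)" using assms by (intro integral_distr) measurable
  finally show ?thesis by (simp add: add.commute)
qed

text \<open>What integration by parts uses, in a class stable under multiplication by Lipschitz
  differentiable factors such as the components of \<open>b\<close>.\<close>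

definition bump :: "real \<Rightarrow> ('a::euclidean_space \<Rightarrow> real) \<Rightarrow> bool" where
  "bump R f \<longleftrightarrow> (\<exists>C. C-lipschitz_on UNIV f) \<and> (\<forall>x. f differentiable (at x)) \<and> (\<forall>x. R < norm x \<longrightarrow> f x = 0)"

lemma bumpD:
  assumes "bump R f"
  shows "\<exists>C. C-lipschitz_on UNIV f" "f differentiable (at x)" "R < norm x \<Longrightarrow> f x = 0"
    "f \<in> borel_measurable borel" "continuous_on A f"
proof -
  have d: "f differentiable (at x)" for x using assms by (simp add: bump_def)
  show "\<exists>C. C-lipschitz_on UNIV f" "f differentiable (at x)" "R < norm x \<Longrightarrow> f x = 0"
    using assms by (simp_all add: bump_def)
  show "f \<in> borel_measurable borel" by (rule differentiable_imp_measurable[OF d])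
  show "continuous_on A f"
    by (intro continuous_at_imp_continuous_on ballI differentiable_imp_continuous_within d)
qed

lemma bump_bounded:
  assumes "bump R f"
  obtains B where "B > 0" "\<And>x. \<bar>f x\<bar> \<le> B"
proof -
  have "compact (f ` cball 0 R)" by (intro compact_continuous_image bumpD[OF assms] compact_cball)
  then obtain B where B: "\<And>x. x \<in> cball 0 R \<Longrightarrow> \<bar>f x\<bar> \<le> B"
    using compact_imp_bounded bounded_iff by (metis image_eqI real_norm_def)
  have "\<bar>f x\<bar> \<le> max B 1" for x
    using B[of x] bumpD(3)[OF assms, of x] by (cases "norm x \<le> R") auto
  thus thesis by (intro that[of "max B 1"]) auto
qed

lemma bump_dd_zero:
  assumes "bump R f" "R < norm x"
  shows "dd f e x = 0"
proof -
  have "open {x :: 'a. R < norm x}" by (intro open_Collect_less continuous_intros)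
  hence "(f has_derivative (\<lambda>_. 0)) (at x)"
    by (rule has_derivative_transform_within_open[OF has_derivative_const])
      (use assms bumpD(3)[OF assms(1)] in auto)
  thus ?thesis by (simp add: dd_unique)
qed

lemma bump_integrable: "bump R f \<Longrightarrow> integrable lborel f"
  by (rule bump_bounded, assumption) (blast intro: integrable_bounded_support[of f R] bumpD(3,4))

text \<open>By translation invariance every difference quotient has integral 0. The Lipschitz
  constant dominates the quotients, and they vanish outside the ball of radius
  \<open>R + norm e\<close>, since the increments are at most 1.\<close>

lemma bump_integral_dd:
  assumes f: "bump R f"
  shows "(\<integral>x. dd f e x \<partial>lborel) = 0"
proof -
  obtain C where C: "C-lipschitz_on UNIV f" using bumpD(1)[OF f] by blast
  have [measurable]: "f \<in> borel_measurable borel" by (rule bumpD(4)[OF f])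
  let ?t = "\<lambda>k. inverse (real (Suc k))"
  have "(\<lambda>k. \<integral>x. (f (x + ?t k *\<^sub>R e) - f x) /\<^sub>R ?t k \<partial>lborel) \<longlonglongrightarrow> (\<integral>x. dd f e x \<partial>lborel)"
  proof (rule integral_dominated_convergence[where w = "\<lambda>x. C * norm e * indicator (cball 0 (R + norm e)) x"])
    show "dd f e \<in> borel_measurable lborel" using dd_measurable[OF bumpD(2)[OF f]] by simp
    show "integrable lborel (\<lambda>x. C * norm e * indicator (cball 0 (R + norm e)) x :: real)"
      using emeasure_lborel_cball_finite by (intro integrable_mult_right integrable_real_indicator) auto
    show "AE x in lborel. (\<lambda>k. (f (x + ?t k *\<^sub>R e) - f x) /\<^sub>R ?t k) \<longlonglongrightarrow> dd f e x"
      by (intro AE_I2 dd_LIMSEQ bumpD[OF f] inverse_Suc_seq)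
    show "AE x in lborel. norm ((f (x + ?t k *\<^sub>R e) - f x) /\<^sub>R ?t k) \<le> C * norm e * indicator (cball 0 (R + norm e)) x" for k
    proof (rule AE_I2)
      fix x :: 'a
      show "norm ((f (x + ?t k *\<^sub>R e) - f x) /\<^sub>R ?t k) \<le> C * norm e * indicator (cball 0 (R + norm e)) x"
      proof (cases "norm x \<le> R + norm e")
        case True
        thus ?thesis using lipschitz_quotient_le[OF C, where x = x and t = "?t k" and e = e] by simp
      next
        case False
        have "\<bar>?t k\<bar> \<le> 1" by (simp add: divide_simps)
        hence "norm (?t k *\<^sub>R e) \<le> norm e" unfolding norm_scaleR by (rule mult_left_le_one_le[OF norm_ge_zero abs_ge_zero])
        hence "R < norm (x + ?t k *\<^sub>R e)" "R < norm x"
          using False norm_diff_ineq[of x "?t k *\<^sub>R e"] norm_ge_zero[of e] by linarith+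
        thus ?thesis using False bumpD(3)[OF f] by simp
      qed
    qed
  qed measurable
  moreover have "(\<integral>x. (f (x + ?t k *\<^sub>R e) - f x) /\<^sub>R ?t k \<partial>lborel) = 0" for k
  proof -
    have "integrable lborel (\<lambda>x. f (x + ?t k *\<^sub>R e))"
    proof -
      have "integrable (distr lborel borel ((+) (?t k *\<^sub>R e))) f"
        using bump_integrable[OF f] by (simp add: lborel_distr_plus)
      thus ?thesis by (subst (asm) integrable_distr_eq) (auto simp: add.commute)
    qed
    thus ?thesis using bump_integrable[OF f] integral_translate[of f "?t k *\<^sub>R e"] by simp
  qed
  ultimately have "(\<lambda>k :: nat. 0) \<longlonglongrightarrow> (\<integral>x. dd f e x \<partial>lborel)" by (simp only:)
  thus ?thesis by (rule LIMSEQ_unique[OF _ tendsto_const])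
qed

lemma lipschitz_bounded_on_cball:
  assumes "C-lipschitz_on UNIV g" "norm x \<le> R"
  shows "norm (g x) \<le> norm (g 0) + C * R"
  using lipschitz_norm_diff_le[OF assms(1), of x 0] norm_triangle_ineq[of "g x - g 0" "g 0"]
    mult_left_mono[OF assms(2) lipschitz_on_nonneg[OF assms(1)]] by simp

text \<open>\<open>g\<close> may be unbounded, so the Lipschitz estimate is anchored at a point of
  the ball, where \<open>B'\<close> bounds \<open>g\<close>. By symmetry it is enough that one of
  the two points lies there, and outside the ball the product vanishes.\<close>

lemma bump_mult:
  fixes g :: "'a::euclidean_space \<Rightarrow> real"
  assumes f: "bump R f" and g: "C-lipschitz_on UNIV g" "\<And>x. g differentiable (at x)"
  shows "bump R (\<lambda>x. g x * f x)"
proof -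
  obtain D where D: "D-lipschitz_on UNIV f" using bumpD(1)[OF f] by blast
  obtain B where B: "B > 0" "\<And>x. \<bar>f x\<bar> \<le> B" using bump_bounded[OF f] by blast
  define B' where "B' = \<bar>g 0\<bar> + C * \<bar>R\<bar>"
  have CD: "C \<ge> 0" "D \<ge> 0" using g(1) D lipschitz_on_nonneg by auto
  have B'0: "B' \<ge> 0" using CD by (simp add: B'_def)
  have gB: "\<bar>g y\<bar> \<le> B'" if "norm y \<le> R" for y
    using lipschitz_bounded_on_cball[OF g(1), of y "\<bar>R\<bar>"] that by (simp add: B'_def)
  have *: "\<bar>g x * f x - g y * f y\<bar> \<le> (B' * D + C * B) * norm (x - y)" if y: "norm y \<le> R" for x y
  proof -
    have "g x * f x - g y * f y = g y * (f x - f y) + (g x - g y) * f x" by (simp add: algebra_simps)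
    hence "\<bar>g x * f x - g y * f y\<bar> \<le> \<bar>g y\<bar> * \<bar>f x - f y\<bar> + \<bar>g x - g y\<bar> * \<bar>f x\<bar>"
      using abs_triangle_ineq by (simp add: abs_mult[symmetric])
    also have "\<dots> \<le> B' * (D * norm (x - y)) + (C * norm (x - y)) * B"
      using gB[OF y] lipschitz_norm_diff_le[OF D, of x y] lipschitz_norm_diff_le[OF g(1), of x y] B CD B'0
      by (intro add_mono mult_mono) auto
    finally show ?thesis by (simp add: algebra_simps)
  qed
  have "(B' * D + C * B)-lipschitz_on UNIV (\<lambda>x. g x * f x)"
  proof (rule lipschitz_onI)
    fix x y :: 'a
    show "dist (g x * f x) (g y * f y) \<le> (B' * D + C * B) * dist x y"
    proof (cases "norm y \<le> R \<or> norm x \<le> R")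
      case True
      thus ?thesis using *[of y x] *[of x y] by (auto simp: dist_norm norm_minus_commute abs_minus_commute)
    next
      case False
      hence "f x = 0" "f y = 0" using bumpD(3)[OF f] by auto
      thus ?thesis using B'0 CD B by simp
    qed
  qed (use CD B B'0 in simp)
  moreover have "(\<lambda>x. g x * f x) differentiable (at x)" for x
    using g(2) bumpD(2)[OF f] by (intro differentiable_mult)
  ultimately show ?thesis unfolding bump_def using bumpD(3)[OF f] by auto
qed

lemma dd_mult:
  fixes f g :: "'a::euclidean_space \<Rightarrow> real"
  assumes "f differentiable (at x)" "g differentiable (at x)"
  shows "dd (\<lambda>x. g x * f x) e x = g x * dd f e x + dd g e x * f x"
  by (rule dd_unique[OF has_derivative_mult[OF dd_works[OF assms(2)] dd_works[OF assms(1)]], THEN trans]) simp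

lemma bump_mult_integrable:
  fixes g :: "'a::euclidean_space \<Rightarrow> real"
  assumes f: "bump R f" and g: "g \<in> borel_measurable borel" "\<And>x. norm x \<le> R \<Longrightarrow> \<bar>g x\<bar> \<le> B"
  shows "integrable lborel (\<lambda>x. g x * f x)"
proof -
  obtain D where D: "D > 0" "\<And>x. \<bar>f x\<bar> \<le> D" using bump_bounded[OF f] by blast
  have [measurable]: "f \<in> borel_measurable borel" by (rule bumpD(4)[OF f])
  show ?thesis
    using g D bumpD(3)[OF f]
    by (intro integrable_bounded_support[of _ R "B * D"])
      (auto simp: abs_mult intro!: mult_mono order_trans[OF abs_ge_zero g(2)])
qed

lemma bump_mult_dd_integrable:
  fixes g :: "'a::euclidean_space \<Rightarrow> real"
  assumes f: "bump R f" and g: "g \<in> borel_measurable borel" "\<And>x. norm x \<le> R \<Longrightarrow> \<bar>g x\<bar> \<le> B"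
  shows "integrable lborel (\<lambda>x. g x * dd f e x)"
proof -
  obtain C where C: "C-lipschitz_on UNIV f" using bumpD(1)[OF f] by blast
  have [measurable]: "dd f e \<in> borel_measurable borel" by (rule dd_measurable[OF bumpD(2)[OF f]])
  have d: "\<bar>dd f e x\<bar> \<le> C * norm e" for x using dd_bound[OF C bumpD(2)[OF f], where e = e and x = x] by simp
  show ?thesis
    using g d bump_dd_zero[OF f]
    by (intro integrable_bounded_support[of _ R "B * (C * norm e)"])
      (auto simp: abs_mult intro!: mult_mono order_trans[OF abs_ge_zero g(2)])
qed

lemma integration_by_parts_dd:
  fixes g :: "'a::euclidean_space \<Rightarrow> real"
  assumes f: "bump R f" and g: "C-lipschitz_on UNIV g" "\<And>x. g differentiable (at x)"
  shows "(\<integral>x. dd g e x * f x \<partial>lborel) = - (\<integral>x. g x * dd f e x \<partial>lborel)"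
proof -
  have "0 = (\<integral>x. dd (\<lambda>x. g x * f x) e x \<partial>lborel)"
    using bump_integral_dd[OF bump_mult[OF f g]] by simp
  also have "\<dots> = (\<integral>x. g x * dd f e x + dd g e x * f x \<partial>lborel)"
    using dd_mult[OF bumpD(2)[OF f] g(2)] by simp
  also have "\<dots> = (\<integral>x. g x * dd f e x \<partial>lborel) + (\<integral>x. dd g e x * f x \<partial>lborel)"
  proof (rule Bochner_Integration.integral_add)
    show "integrable lborel (\<lambda>x. g x * dd f e x)"
      using lipschitz_bounded_on_cball[OF g(1)]
      by (intro bump_mult_dd_integrable[OF f, where B = "\<bar>g 0\<bar> + C * R"] differentiable_imp_measurable[OF g(2)]) auto
    show "integrable lborel (\<lambda>x. dd g e x * f x)"
      using dd_bound[OF g(1) g(2)]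
      by (intro bump_mult_integrable[OF f, where B = "C * norm e"] dd_measurable[OF g(2)]) auto
  qed
  finally show ?thesis by simp
qed

section \<open>The first order part of the operator and the drift step\<close>

lemma differentiable_vec_nth:
  fixes b :: "'a::real_normed_vector \<Rightarrow> real ^ 'n::finite"
  assumes "b differentiable (at x)"
  shows "(\<lambda>x. b x $ i) differentiable (at x)" "dd (\<lambda>x. b x $ i) e x = dd b e x $ i"
proof -
  have *: "((\<lambda>x. b x $ i) has_derivative (\<lambda>e. dd b e x $ i)) (at x)"
    by (rule bounded_linear.has_derivative[OF bounded_linear_vec_nth dd_works[OF assms]])
  show "(\<lambda>x. b x $ i) differentiable (at x)" using * differentiableI by blast
  show "dd (\<lambda>x. b x $ i) e x = dd b e x $ i" by (rule dd_unique[OF *])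
qed

lemma lipschitz_vec_nth:
  fixes b :: "'a::metric_space \<Rightarrow> real ^ 'n::finite"
  assumes "C-lipschitz_on UNIV b"
  shows "C-lipschitz_on UNIV (\<lambda>x. b x $ i)"
  using assms unfolding lipschitz_on_def by (blast intro: order_trans[OF dist_vec_nth_le])

lemma dd_linear_sum:
  fixes f :: "real ^ 'n::finite \<Rightarrow> real"
  assumes "f differentiable (at x)"
  shows "dd f e x = (\<Sum>i\<in>UNIV. e $ i * dd f (axis i 1) x)"
proof -
  have "dd f e x = dd f (\<Sum>i\<in>UNIV. e $ i *\<^sub>R axis i 1) x"
    using basis_expansion[of e] by (simp add: scalar_mult_eq_scaleR)
  also have "\<dots> = (\<Sum>i\<in>UNIV. e $ i * dd f (axis i 1) x)"
    using linear_frechet_derivative[OF assms] by (simp add: linear_sum linear_cmul)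
  finally show ?thesis .
qed

text \<open>The divergence of the vector field \<open>f\<close> times \<open>b\<close>; its negative
  is the formal adjoint of the first order part, applied to \<open>f\<close>.\<close>

definition divergence_mult :: "(real ^ 'n \<Rightarrow> real ^ 'n::finite) \<Rightarrow> (real ^ 'n \<Rightarrow> real) \<Rightarrow> real ^ 'n \<Rightarrow> real" where
  "divergence_mult b f x = (\<Sum>i\<in>UNIV. dd (\<lambda>x. b x $ i * f x) (axis i 1) x)"

context
  fixes b :: "real ^ 'n::finite \<Rightarrow> real ^ 'n" and L :: real and f :: "real ^ 'n \<Rightarrow> real" and R :: real
  assumes b: "L-lipschitz_on UNIV b" "\<And>x. b differentiable (at x)" and f: "bump R f"
begin

lemma bump_component_mult: "bump R (\<lambda>x. b x $ i * f x)"
  by (rule bump_mult[OF f lipschitz_vec_nth[OF b(1)] differentiable_vec_nth(1)[OF b(2)]])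

lemma bump_divergence_mult:
  assumes g: "g \<in> borel_measurable borel" "\<And>x. norm x \<le> R \<Longrightarrow> \<bar>g x\<bar> \<le> B"
  shows "integrable lborel (\<lambda>x. g x * divergence_mult b f x)"
    "(\<integral>x. g x * divergence_mult b f x \<partial>lborel)
       = (\<Sum>i\<in>UNIV. \<integral>x. g x * dd (\<lambda>x. b x $ i * f x) (axis i 1) x \<partial>lborel)"
  unfolding divergence_mult_def sum_distrib_left
  by (intro Bochner_Integration.integrable_sum Bochner_Integration.integral_sum
     bump_mult_dd_integrable[OF bump_component_mult g]; assumption)+

lemma divergence_mult_measurable: "divergence_mult b f \<in> borel_measurable borel"
  unfolding divergence_mult_def[abs_def]
  by (intro borel_measurable_sum dd_measurable bumpD(2)[OF bump_component_mult])

lemma integral_divergence_mult: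
  assumes g: "C-lipschitz_on UNIV g" "\<And>x. g differentiable (at x)"
  shows "(\<integral>x. dd g (b x) x * f x \<partial>lborel) = - (\<integral>x. g x * divergence_mult b f x \<partial>lborel)"
proof -
  have gm: "g \<in> borel_measurable borel" by (rule differentiable_imp_measurable[OF g(2)])
  have gB: "norm x \<le> R \<Longrightarrow> \<bar>g x\<bar> \<le> \<bar>g 0\<bar> + C * R" for x
    using lipschitz_bounded_on_cball[OF g(1), of x R] by simp
  have "(\<integral>x. dd g (b x) x * f x \<partial>lborel) = (\<integral>x. (\<Sum>i\<in>UNIV. dd g (axis i 1) x * (b x $ i * f x)) \<partial>lborel)"
    by (subst dd_linear_sum[OF g(2)]) (simp add: sum_distrib_right mult.assoc mult.left_commute)
  also have "\<dots> = (\<Sum>i\<in>UNIV. \<integral>x. dd g (axis i 1) x * (b x $ i * f x) \<partial>lborel)"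
    using dd_bound[OF g(1) g(2)]
    by (intro Bochner_Integration.integral_sum bump_mult_integrable[OF bump_component_mult, where B = "C * 1"] dd_measurable[OF g(2)])
      (auto intro!: order_trans[OF dd_bound[OF g(1) g(2), unfolded real_norm_def]] simp: norm_axis_1)
  also have "\<dots> = (\<Sum>i\<in>UNIV. - (\<integral>x. g x * dd (\<lambda>x. b x $ i * f x) (axis i 1) x \<partial>lborel))"
    using integration_by_parts_dd[OF bump_component_mult g] by simp
  also have "\<dots> = - (\<integral>x. g x * divergence_mult b f x \<partial>lborel)"
    using bump_divergence_mult(2)[OF gm gB] by (simp add: sum_negf)
  finally show ?thesis .
qed

text \<open>Differentiation under the integral sign, dominated by
  \<open>C * (norm (b x) * \<bar>f x\<bar>)\<close>, where \<open>f\<close> cuts off the linear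
  growth of \<open>b\<close>.\<close>

lemma drift_integral_DERIV:
  assumes g: "C-lipschitz_on UNIV g" "\<And>x. g differentiable (at x)"
  shows "((\<lambda>s. \<integral>x. g (x + s *\<^sub>R b x) * f x \<partial>lborel) has_real_derivative
     (\<integral>x. dd g (b x) (x + s *\<^sub>R b x) * f x \<partial>lborel)) (at s)"
  unfolding DERIV_def LIMSEQ_SEQ_conv[symmetric]
proof (intro allI impI, elim conjE)
  fix T :: "nat \<Rightarrow> real" assume T: "\<forall>n. T n \<noteq> 0" "T \<longlonglongrightarrow> 0"
  have C: "C \<ge> 0" using g(1) lipschitz_on_nonneg by blast
  have gm [measurable]: "g \<in> borel_measurable borel" by (rule differentiable_imp_measurable[OF g(2)])
  have bm [measurable]: "b \<in> borel_measurable borel" by (rule differentiable_imp_measurable[OF b(2)])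
  have fm [measurable]: "f \<in> borel_measurable borel" by (rule bumpD(4)[OF f])
  have bB: "norm (b x) \<le> norm (b 0) + L * R" if "norm x \<le> R" for x
    using lipschitz_bounded_on_cball[OF b(1) that] .
  have int: "integrable lborel (\<lambda>x. g (x + r *\<^sub>R b x) * f x)" for r
  proof (rule bump_mult_integrable[OF f])
    show "\<bar>g (x + r *\<^sub>R b x)\<bar> \<le> \<bar>g 0\<bar> + C * (R + \<bar>r\<bar> * (norm (b 0) + L * R))" if x: "norm x \<le> R" for x
    proof -
      have "norm (x + r *\<^sub>R b x) \<le> R + \<bar>r\<bar> * (norm (b 0) + L * R)"
        using x bB[OF x] by (intro norm_triangle_le add_mono) (auto intro!: mult_left_mono)
      thus ?thesis using lipschitz_bounded_on_cball[OF g(1)] by simp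
    qed
  qed measurable
  let ?Q = "\<lambda>k x. (g ((x + s *\<^sub>R b x) + T k *\<^sub>R b x) - g (x + s *\<^sub>R b x)) /\<^sub>R T k * f x"
  have "(\<lambda>k. \<integral>x. ?Q k x \<partial>lborel) \<longlonglongrightarrow> (\<integral>x. dd g (b x) (x + s *\<^sub>R b x) * f x \<partial>lborel)"
  proof (rule integral_dominated_convergence[where w = "\<lambda>x. C * (norm (b x) * \<bar>f x\<bar>)"])
    have lim: "(\<lambda>k. ?Q k x) \<longlonglongrightarrow> dd g (b x) (x + s *\<^sub>R b x) * f x" for x
      by (intro tendsto_mult_right dd_LIMSEQ g(2)) (use T in auto)
    thus "AE x in lborel. (\<lambda>k. ?Q k x) \<longlonglongrightarrow> dd g (b x) (x + s *\<^sub>R b x) * f x" by simp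
    show "(\<lambda>x. dd g (b x) (x + s *\<^sub>R b x) * f x) \<in> borel_measurable lborel"
      by (rule borel_measurable_LIMSEQ_real[OF lim]) measurable
    have "integrable lborel (\<lambda>x. norm (b x) * f x)"
      using bB by (intro bump_mult_integrable[OF f, where B = "norm (b 0) + L * R"]) auto
    hence "integrable lborel (\<lambda>x. \<bar>norm (b x) * f x\<bar>)" by (rule integrable_abs)
    thus "integrable lborel (\<lambda>x. C * (norm (b x) * \<bar>f x\<bar>))" by (simp add: abs_mult)
    show "AE x in lborel. norm (?Q k x) \<le> C * (norm (b x) * \<bar>f x\<bar>)" for k
    proof (rule AE_I2)
      fix x
      show "norm (?Q k x) \<le> C * (norm (b x) * \<bar>f x\<bar>)"
        using mult_right_mono[OF lipschitz_quotient_le[OF g(1), where x = "x + s *\<^sub>R b x" and t = "T k" and e = "b x"], of "\<bar>f x\<bar>"]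
        by (simp add: abs_mult mult.assoc)
    qed
  qed measurable
  moreover have "(\<integral>x. ?Q k x \<partial>lborel) =
      ((\<integral>x. g (x + (s + T k) *\<^sub>R b x) * f x \<partial>lborel) - (\<integral>x. g (x + s *\<^sub>R b x) * f x \<partial>lborel)) / T k" for k
  proof -
    have "?Q k x = (g (x + (s + T k) *\<^sub>R b x) * f x - g (x + s *\<^sub>R b x) * f x) / T k" for x
      by (simp add: scaleR_add_left add.assoc divide_inverse algebra_simps)
    thus ?thesis by (simp add: Bochner_Integration.integral_diff[OF int int])
  qed
  ultimately show "(\<lambda>k. ((\<integral>x. g (x + (s + T k) *\<^sub>R b x) * f x \<partial>lborel) - (\<integral>x. g (x + s *\<^sub>R b x) * f x \<partial>lborel)) / T k)
      \<longlonglongrightarrow> (\<integral>x. dd g (b x) (x + s *\<^sub>R b x) * f x \<partial>lborel)" by simp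
qed

text \<open>The bound must not involve second derivatives of \<open>g\<close>. With \<open>G x = g (x + s *\<^sub>R b x)\<close>, the derivative
  of \<open>g\<close> at \<open>x + s *\<^sub>R b x\<close> in direction \<open>b x\<close> differs from that of \<open>G\<close> at \<open>x\<close> by \<open>s\<close> times a bounded
  quantity, and the derivative of \<open>G\<close> is moved to \<open>f\<close> by parts.\<close>

lemma drift_consistency:
  obtains c where "c \<ge> 0"
    "\<And>g C h. C-lipschitz_on UNIV g \<Longrightarrow> (\<And>x. g differentiable (at x)) \<Longrightarrow> 0 < h \<Longrightarrow>
      \<bar>(\<integral>x. g (x + h *\<^sub>R b x) * f x \<partial>lborel) - (\<integral>x. g x * f x \<partial>lborel)
        + h * (\<integral>x. g x * divergence_mult b f x \<partial>lborel)\<bar> \<le> C * c * h\<^sup>2"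
proof -
  have bm [measurable]: "b \<in> borel_measurable borel" by (rule differentiable_imp_measurable[OF b(2)])
  have fm [measurable]: "f \<in> borel_measurable borel" by (rule bumpD(4)[OF f])
  note [measurable] = divergence_mult_measurable
  have bB: "norm (b x) \<le> norm (b 0) + L * R" if "norm x \<le> R" for x
    using lipschitz_bounded_on_cball[OF b(1) that] .
  have i1: "integrable lborel (\<lambda>x. norm (b x) * \<bar>divergence_mult b f x\<bar>)"
    using integrable_abs[OF bump_divergence_mult(1)[of "\<lambda>x. norm (b x)" "norm (b 0) + L * R"]] bB by (simp add: abs_mult)
  have i2: "integrable lborel (\<lambda>x. norm (b x) * \<bar>f x\<bar>)"
    using integrable_abs[OF bump_mult_integrable[OF f, of "\<lambda>x. norm (b x)" "norm (b 0) + L * R"]] bB by (simp add: abs_mult)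
  have L: "L \<ge> 0" using b(1) lipschitz_on_nonneg by blast
  \<comment> \<open>Per unit of \<open>s\<close> and \<open>C\<close>, the first summand bounds the
    pairing of \<open>g - G\<close> with the divergence, the second the term in which
    \<open>b\<close> is differentiated.\<close>
  define c where "c = (\<integral>x. norm (b x) * \<bar>divergence_mult b f x\<bar> \<partial>lborel) + L * (\<integral>x. norm (b x) * \<bar>f x\<bar> \<partial>lborel)"
  show thesis
  proof (rule that[of c])
    show "c \<ge> 0" unfolding c_def using L by (intro add_nonneg_nonneg mult_nonneg_nonneg integral_nonneg) auto
    fix g :: "real ^ 'n \<Rightarrow> real" and C h :: real assume g: "C-lipschitz_on UNIV g" "\<And>x. g differentiable (at x)" and h: "0 < h"
    have C: "C \<ge> 0" using g(1) lipschitz_on_nonneg by blast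
    have gm [measurable]: "g \<in> borel_measurable borel" by (rule differentiable_imp_measurable[OF g(2)])
    define I where "I = (\<integral>x. g x * divergence_mult b f x \<partial>lborel)"
    define D where "D s = (\<integral>x. dd g (b x) (x + s *\<^sub>R b x) * f x \<partial>lborel)" for s
    \<comment> \<open>The derivative of the integral in \<open>s\<close> stays within
      \<open>s * (C * c)\<close> of \<open>- I\<close>, its value at \<open>s = 0\<close>; the mean
      value theorem over a step then produces the order \<open>h\<^sup>2\<close>.\<close>
    have D: "\<bar>D s + I\<bar> \<le> s * (C * c)" if s: "s \<ge> 0" for s
    proof -
      define G where "G x = g (x + s *\<^sub>R b x)" for x
      have dG: "((\<lambda>x. g (x + s *\<^sub>R b x)) has_derivative (\<lambda>e. dd g (e + s *\<^sub>R dd b e x) (x + s *\<^sub>R b x))) (at x)" for x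
        by (rule has_derivative_compose[OF _ dd_works[OF g(2)]])
          (auto intro!: derivative_eq_intros dd_works b(2))
      have G2: "G differentiable (at x)" for x using dG differentiableI unfolding G_def by blast
      have Gdd: "dd G (b x) x = dd g (b x) (x + s *\<^sub>R b x) + s * dd g (dd b (b x) x) (x + s *\<^sub>R b x)" for x
        unfolding G_def using dd_unique[OF dG] g(2) by (simp add: dd_add dd_scaleR)
      have "1-lipschitz_on UNIV (\<lambda>x :: real ^ 'n. x)" by (simp add: lipschitz_intros)
      hence "(1 + \<bar>s\<bar> * L)-lipschitz_on UNIV (\<lambda>x. x + s *\<^sub>R b x)"
        by (intro lipschitz_on_add lipschitz_on_cmult b)
      from lipschitz_on_compose2[OF this, of C g] have G1: "(C * (1 + \<bar>s\<bar> * L))-lipschitz_on UNIV G"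
        using g(1) unfolding G_def by (auto intro: lipschitz_on_subset)
      have [measurable]: "G \<in> borel_measurable borel" by (rule differentiable_imp_measurable[OF G2])
      have GB: "\<bar>G x\<bar> \<le> \<bar>G 0\<bar> + (C * (1 + \<bar>s\<bar> * L)) * R" if "norm x \<le> R" for x
        using lipschitz_bounded_on_cball[OF G1 that] by simp
      have gB: "\<bar>g x\<bar> \<le> \<bar>g 0\<bar> + C * R" if "norm x \<le> R" for x
        using lipschitz_bounded_on_cball[OF g(1) that] by simp
      have bd1: "\<bar>dd G (b x) x\<bar> \<le> (C * (1 + \<bar>s\<bar> * L)) * norm (b x)" for x
        using dd_bound[OF G1 G2, where e = "b x" and x = x] by simp
      have bd2: "\<bar>dd g (dd b (b x) x) (x + s *\<^sub>R b x)\<bar> \<le> C * (L * norm (b x))" for x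
        using dd_bound[OF g(1) g(2), where e = "dd b (b x) x" and x = "x + s *\<^sub>R b x"] mult_left_mono[OF dd_bound[OF b(1) b(2), where e = "b x" and x = x] C]
        by simp
      \<comment> \<open>The direction \<open>b x\<close> varies with \<open>x\<close>, so
        measurability is read off the difference quotients, not off
        \<open>dd_measurable\<close>.\<close>
      have m0: "(\<lambda>x. dd g (b x) (x + s *\<^sub>R b x)) \<in> borel_measurable borel"
        by (rule borel_measurable_LIMSEQ_real[where u = "\<lambda>k x. (g ((x + s *\<^sub>R b x) + inverse (real (Suc k)) *\<^sub>R b x) - g (x + s *\<^sub>R b x)) /\<^sub>R inverse (real (Suc k))"])
          (use dd_LIMSEQ[OF g(2) inverse_Suc_seq(2,1)] in auto)
      have m1: "(\<lambda>x. dd G (b x) x) \<in> borel_measurable borel"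
        by (rule borel_measurable_LIMSEQ_real[where u = "\<lambda>k x. (G (x + inverse (real (Suc k)) *\<^sub>R b x) - G x) /\<^sub>R inverse (real (Suc k))"])
          (use dd_LIMSEQ[OF G2 inverse_Suc_seq(2,1)] in auto)
      have e: "s * dd g (dd b (b x) x) (x + s *\<^sub>R b x) = dd G (b x) x - dd g (b x) (x + s *\<^sub>R b x)" for x
        using Gdd[of x] by simp
      have m2: "(\<lambda>x. s * dd g (dd b (b x) x) (x + s *\<^sub>R b x)) \<in> borel_measurable borel"
        unfolding e using m0 m1 by measurable
      have B0: "norm (b 0) + L * R \<ge> 0" if "norm x \<le> R" for x :: "real ^ 'n"
        using bB[OF that] norm_ge_zero[of "b x"] by linarith
      have j1: "integrable lborel (\<lambda>x. dd G (b x) x * f x)"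
        using bB C L by (intro bump_mult_integrable[OF f m1, of "(C * (1 + \<bar>s\<bar> * L)) * (norm (b 0) + L * R)"])
          (auto intro!: order_trans[OF bd1] mult_left_mono)
      have j2: "integrable lborel (\<lambda>x. (s * dd g (dd b (b x) x) (x + s *\<^sub>R b x)) * f x)"
      proof (rule bump_mult_integrable[OF f m2])
        show "\<bar>s * dd g (dd b (b x) x) (x + s *\<^sub>R b x)\<bar> \<le> s * (C * (L * (norm (b 0) + L * R)))" if "norm x \<le> R" for x
          using bB[OF that] s C L bd2[of x] by (auto simp: abs_mult intro!: mult_left_mono order_trans[OF bd2])
      qed
      have "D s = (\<integral>x. dd G (b x) x * f x - (s * dd g (dd b (b x) x) (x + s *\<^sub>R b x)) * f x \<partial>lborel)"
        unfolding D_def Gdd by (simp add: algebra_simps)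
      also have "\<dots> = (\<integral>x. dd G (b x) x * f x \<partial>lborel) - (\<integral>x. (s * dd g (dd b (b x) x) (x + s *\<^sub>R b x)) * f x \<partial>lborel)"
        by (rule Bochner_Integration.integral_diff[OF j1 j2])
      also have "(\<integral>x. dd G (b x) x * f x \<partial>lborel) = - (\<integral>x. G x * divergence_mult b f x \<partial>lborel)"
        by (rule integral_divergence_mult[OF G1 G2])
      finally have "D s + I = (\<integral>x. g x * divergence_mult b f x \<partial>lborel) - (\<integral>x. G x * divergence_mult b f x \<partial>lborel)
         - (\<integral>x. (s * dd g (dd b (b x) x) (x + s *\<^sub>R b x)) * f x \<partial>lborel)" by (simp add: I_def)
      also have "\<dots> = (\<integral>x. (g x - G x) * divergence_mult b f x \<partial>lborel)
         - (\<integral>x. (s * dd g (dd b (b x) x) (x + s *\<^sub>R b x)) * f x \<partial>lborel)"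
        by (subst Bochner_Integration.integral_diff[symmetric])
          (auto intro!: bump_divergence_mult(1)[OF _ GB] bump_divergence_mult(1)[OF _ gB] simp: left_diff_distrib)
      finally have "\<bar>D s + I\<bar> \<le> \<bar>\<integral>x. (g x - G x) * divergence_mult b f x \<partial>lborel\<bar>
         + \<bar>\<integral>x. (s * dd g (dd b (b x) x) (x + s *\<^sub>R b x)) * f x \<partial>lborel\<bar>" by linarith
      also have "\<dots> \<le> (\<integral>x. C * s * (norm (b x) * \<bar>divergence_mult b f x\<bar>) \<partial>lborel) + (\<integral>x. s * C * L * (norm (b x) * \<bar>f x\<bar>) \<partial>lborel)"
      proof (intro add_mono)
        show "\<bar>\<integral>x. (g x - G x) * divergence_mult b f x \<partial>lborel\<bar> \<le> (\<integral>x. C * s * (norm (b x) * \<bar>divergence_mult b f x\<bar>) \<partial>lborel)"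
        proof (rule order_trans[OF integral_abs_bound], rule integral_mono)
          show "integrable lborel (\<lambda>x. \<bar>(g x - G x) * divergence_mult b f x\<bar>)"
            unfolding left_diff_distrib
            by (intro integrable_abs Bochner_Integration.integrable_diff bump_divergence_mult(1)[OF _ GB] bump_divergence_mult(1)[OF _ gB]) auto
          show "integrable lborel (\<lambda>x. C * s * (norm (b x) * \<bar>divergence_mult b f x\<bar>))" using i1 by (intro integrable_mult_right)
          fix x
          have "\<bar>g x - G x\<bar> \<le> C * (s * norm (b x))"
            using lipschitz_norm_diff_le[OF g(1), of x "x + s *\<^sub>R b x"] s by (simp add: G_def)
          from mult_right_mono[OF this, of "\<bar>divergence_mult b f x\<bar>"]
          show "\<bar>(g x - G x) * divergence_mult b f x\<bar> \<le> C * s * (norm (b x) * \<bar>divergence_mult b f x\<bar>)"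
            by (simp add: abs_mult mult_ac)
        qed
        show "\<bar>\<integral>x. (s * dd g (dd b (b x) x) (x + s *\<^sub>R b x)) * f x \<partial>lborel\<bar> \<le> (\<integral>x. s * C * L * (norm (b x) * \<bar>f x\<bar>) \<partial>lborel)"
        proof (rule order_trans[OF integral_abs_bound], rule integral_mono)
          show "integrable lborel (\<lambda>x. \<bar>(s * dd g (dd b (b x) x) (x + s *\<^sub>R b x)) * f x\<bar>)" using j2 by (rule integrable_abs)
          show "integrable lborel (\<lambda>x. s * C * L * (norm (b x) * \<bar>f x\<bar>))" using i2 by (intro integrable_mult_right)
          fix x
          from mult_right_mono[OF mult_left_mono[OF bd2[of x] s], of "\<bar>f x\<bar>"] s
          show "\<bar>(s * dd g (dd b (b x) x) (x + s *\<^sub>R b x)) * f x\<bar> \<le> s * C * L * (norm (b x) * \<bar>f x\<bar>)"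
            by (simp add: abs_mult mult_ac)
        qed
      qed
      also have "\<dots> = s * (C * c)" by (simp add: c_def algebra_simps)
      finally show ?thesis .
    qed
    from MVT2[OF h, of "\<lambda>s. \<integral>x. g (x + s *\<^sub>R b x) * f x \<partial>lborel" D]
    obtain z where z: "0 < z" "z < h"
      "(\<integral>x. g (x + h *\<^sub>R b x) * f x \<partial>lborel) - (\<integral>x. g (x + 0 *\<^sub>R b x) * f x \<partial>lborel) = (h - 0) * D z"
      using drift_integral_DERIV[OF g] unfolding D_def by blast
    have "(\<integral>x. g (x + h *\<^sub>R b x) * f x \<partial>lborel) - (\<integral>x. g x * f x \<partial>lborel) + h * I = h * (D z + I)"
      using z(3) by (simp add: algebra_simps)
    also have "\<bar>\<dots>\<bar> \<le> h * (h * (C * c))"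
    proof -
      have "\<bar>D z + I\<bar> \<le> z * (C * c)" using D z by simp
      also have "\<dots> \<le> h * (C * c)" using z C \<open>c \<ge> 0\<close> by (intro mult_right_mono) auto
      finally show ?thesis using h by (simp add: abs_mult)
    qed
    finally show "\<bar>(\<integral>x. g (x + h *\<^sub>R b x) * f x \<partial>lborel) - (\<integral>x. g x * f x \<partial>lborel)
        + h * (\<integral>x. g x * divergence_mult b f x \<partial>lborel)\<bar> \<le> C * c * h\<^sup>2"
      by (simp add: I_def power2_eq_square mult_ac)
  qed
qed

end

section \<open>Test functions\<close>

lemma test_functionsD:
  assumes "\<phi> \<in> test_functions UNIV"
  shows "\<phi> differentiable (at x)" "continuous_on A \<phi>" "compact (tsupport \<phi>)"
proof -
  have d: "\<phi> differentiable (at x)" for x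
    using assms by (auto simp: test_functions_def smooth_on_def iter_partial_def dest: spec[of _ "[]"])
  show "\<phi> differentiable (at x)" by (rule d)
  show "continuous_on A \<phi>"
    by (intro continuous_at_imp_continuous_on ballI differentiable_imp_continuous_within d)
  show "compact (tsupport \<phi>)" using assms by (simp add: test_functions_def)
qed

lemma test_functions_zero: "x \<notin> tsupport \<phi> \<Longrightarrow> \<phi> x = 0"
  unfolding tsupport_def using closure_subset[of "{x. \<phi> x \<noteq> 0}"] by auto

lemma partial_deriv_zero:
  assumes "x \<notin> tsupport \<phi>"
  shows "partial_deriv i \<phi> x = 0"
proof -
  have o: "open (- tsupport \<phi>)" by (auto simp: tsupport_def)
  have "((\<lambda>_. 0) has_derivative (\<lambda>_. 0)) (at x)" by simp
  from has_derivative_transform_within_open[OF this o, of \<phi>]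
  have "(\<phi> has_derivative (\<lambda>_. 0)) (at x)" using assms test_functions_zero[of _ \<phi>] by simp
  thus ?thesis by (simp add: partial_deriv_def dd_unique)
qed

lemma partial_deriv_test_function:
  assumes "\<phi> \<in> test_functions UNIV"
  shows "partial_deriv i \<phi> \<in> test_functions UNIV"
proof -
  have "{x. partial_deriv i \<phi> x \<noteq> 0} \<subseteq> tsupport \<phi>" using partial_deriv_zero by blast
  hence sub: "tsupport (partial_deriv i \<phi>) \<subseteq> tsupport \<phi>"
    unfolding tsupport_def[of "partial_deriv i \<phi>"]
    by (rule closure_minimal) (simp add: tsupport_def)
  have "compact (tsupport (partial_deriv i \<phi>))"
    using test_functionsD(3)[OF assms] sub
    by (metis closed_closure closed_Int_compact inf.absorb1 tsupport_def)
  moreover have "smooth_on UNIV (partial_deriv i \<phi>)"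
    unfolding smooth_on_def
  proof (intro allI ballI)
    fix "is" x
    have "iter_partial is (partial_deriv i \<phi>) = iter_partial (is @ [i]) \<phi>" by (simp add: iter_partial_def)
    thus "iter_partial is (partial_deriv i \<phi>) differentiable at x"
      using assms by (auto simp: test_functions_def smooth_on_def)
  qed
  ultimately show ?thesis by (simp add: test_functions_def)
qed

lemma test_functions_norm_bound:
  assumes "\<phi> \<in> test_functions UNIV"
  obtains R where "R > 0" "\<And>x. R < norm x \<Longrightarrow> \<phi> x = 0"
proof -
  obtain R where "R > 0" "\<And>x. x \<in> tsupport \<phi> \<Longrightarrow> norm x \<le> R"
    using compact_imp_bounded[OF test_functionsD(3)[OF assms]] bounded_pos by blast
  thus thesis using that[of R] test_functions_zero by fastforce
qed

lemma test_functions_bounded: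
  assumes "\<phi> \<in> test_functions UNIV"
  obtains B where "B \<ge> 0" "\<And>x. \<bar>\<phi> x\<bar> \<le> B"
proof -
  have "compact (\<phi> ` tsupport \<phi>)" using test_functionsD[OF assms] by (intro compact_continuous_image) auto
  then obtain B where B: "\<And>x. x \<in> tsupport \<phi> \<Longrightarrow> \<bar>\<phi> x\<bar> \<le> B"
    using compact_imp_bounded bounded_iff by (metis image_eqI real_norm_def)
  have "\<bar>\<phi> x\<bar> \<le> max B 0" for x
    using B[of x] test_functions_zero[of x \<phi>] by (cases "x \<in> tsupport \<phi>") auto
  thus thesis by (intro that[of "max B 0"]) auto
qed

lemma test_functions_bump:
  assumes \<phi>: "\<phi> \<in> test_functions UNIV"
  obtains R where "R > 0" "bump R \<phi>"
proof -
  obtain R where R: "R > 0" "\<And>x. R < norm x \<Longrightarrow> \<phi> x = 0" using test_functions_norm_bound[OF \<phi>] by blast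
  have "\<exists>B\<ge>0. \<forall>x. \<bar>partial_deriv i \<phi> x\<bar> \<le> B" for i
    using test_functions_bounded[OF partial_deriv_test_function[OF \<phi>]] by metis
  then obtain B where B: "\<And>i. B i \<ge> 0" "\<And>i x. \<bar>partial_deriv i \<phi> x\<bar> \<le> B i" by metis
  have "(\<Sum>i\<in>UNIV. B i)-lipschitz_on UNIV \<phi>"
  proof (rule bounded_derivative_imp_lipschitz)
    show "(\<phi> has_derivative (\<lambda>e. dd \<phi> e x)) (at x within UNIV)" for x
      using dd_works[OF test_functionsD(1)[OF \<phi>]] by simp
    show "onorm (\<lambda>e. dd \<phi> e x) \<le> (\<Sum>i\<in>UNIV. B i)" for x
    proof (rule onorm_le)
      fix e
      have "norm (dd \<phi> e x) \<le> (\<Sum>i\<in>UNIV. norm (e $ i * partial_deriv i \<phi> x))"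
      proof -
        have "dd \<phi> e x = (\<Sum>i\<in>UNIV. e $ i * partial_deriv i \<phi> x)"
          unfolding partial_deriv_def by (rule dd_linear_sum[OF test_functionsD(1)[OF \<phi>]])
        thus ?thesis by (simp only: norm_sum)
      qed
      also have "\<dots> \<le> (\<Sum>i\<in>UNIV. norm e * B i)"
        using B component_le_norm_cart by (intro sum_mono) (auto simp: abs_mult intro!: mult_mono)
      also have "\<dots> = (\<Sum>i\<in>UNIV. B i) * norm e" by (simp only: sum_distrib_right mult.commute[of "norm e"])
      finally show "norm (dd \<phi> e x) \<le> (\<Sum>i\<in>UNIV. B i) * norm e" .
    qed
  qed (auto intro: sum_nonneg B)
  thus thesis using R test_functionsD(1)[OF \<phi>] by (intro that[of R]) (auto simp: bump_def)
qed

text \<open>The Hessian form of \<open>\<phi>\<close> at \<open>x\<close>, evaluated on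
  \<open>v\<close>.\<close>

definition second_deriv :: "(real ^ 'n::finite \<Rightarrow> real) \<Rightarrow> real ^ 'n \<Rightarrow> real ^ 'n \<Rightarrow> real" where
  "second_deriv \<phi> v x = (\<Sum>i\<in>UNIV. v $ i * (\<Sum>j\<in>UNIV. v $ j * partial_deriv j (partial_deriv i \<phi>) x))"

lemma second_deriv_cont:
  assumes "\<phi> \<in> test_functions UNIV"
  shows "continuous_on A (second_deriv \<phi> v)"
  unfolding second_deriv_def
  by (intro continuous_intros test_functionsD(2) partial_deriv_test_function assms)

lemma second_deriv_measurable:
  assumes "\<phi> \<in> test_functions UNIV"
  shows "second_deriv \<phi> v \<in> borel_measurable borel"
  by (intro borel_measurable_continuous_onI second_deriv_cont assms)

lemma second_deriv_zero: "x \<notin> tsupport \<phi> \<Longrightarrow> second_deriv \<phi> v x = 0"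
proof -
  assume x: "x \<notin> tsupport \<phi>"
  have "{x. partial_deriv i \<phi> x \<noteq> 0} \<subseteq> tsupport \<phi>" for i using partial_deriv_zero by blast
  hence "tsupport (partial_deriv i \<phi>) \<subseteq> tsupport \<phi>" for i
    unfolding tsupport_def[of "partial_deriv i \<phi>"]
    by (intro closure_minimal) (auto simp: tsupport_def)
  hence "partial_deriv j (partial_deriv i \<phi>) x = 0" for i j using x by (intro partial_deriv_zero) auto
  thus ?thesis by (simp add: second_deriv_def)
qed

lemma second_deriv_bounded:
  assumes "\<phi> \<in> test_functions UNIV"
  obtains B where "B \<ge> 0" "\<And>x. \<bar>second_deriv \<phi> v x\<bar> \<le> B"
proof -
  have "compact (second_deriv \<phi> v ` tsupport \<phi>)"
    using test_functionsD[OF assms] second_deriv_cont[OF assms] by (intro compact_continuous_image) auto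
  then obtain B where B: "\<And>x. x \<in> tsupport \<phi> \<Longrightarrow> \<bar>second_deriv \<phi> v x\<bar> \<le> B"
    using compact_imp_bounded bounded_iff by (metis image_eqI real_norm_def)
  have "\<bar>second_deriv \<phi> v x\<bar> \<le> max B 0" for x
    using B[of x] second_deriv_zero[of x \<phi> v] by (cases "x \<in> tsupport \<phi>") auto
  thus thesis by (intro that[of "max B 0"]) auto
qed

section \<open>Second differences of test functions\<close>

lemma DERIV_along_line:
  fixes f :: "real ^ 'n::finite \<Rightarrow> real"
  assumes "f differentiable (at (x + t *\<^sub>R v))"
  shows "((\<lambda>t. f (x + t *\<^sub>R v)) has_real_derivative (\<Sum>i\<in>UNIV. v $ i * partial_deriv i f (x + t *\<^sub>R v))) (at t)"
  using dd_vector_derivative[OF assms] dd_linear_sum[OF assms, of v]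
  by (simp add: has_real_derivative_iff_has_vector_derivative partial_deriv_def)

text \<open>The mean value theorem twice: for the increment over a length \<open>d\<close> as a
  function of its endpoint, then for the first derivative. An exact intermediate point reduces the
  convergence of second difference quotients to continuity of the Hessian form.\<close>

lemma second_difference_mvt:
  assumes \<phi>: "\<phi> \<in> test_functions UNIV" and d: "d > 0"
  obtains z where "\<bar>z\<bar> < d"
    "\<phi> (x + d *\<^sub>R v) + \<phi> (x - d *\<^sub>R v) - 2 * \<phi> x = d\<^sup>2 * second_deriv \<phi> v (x + z *\<^sub>R v)"
proof -
  define p1 where "p1 t = (\<Sum>i\<in>UNIV. v $ i * partial_deriv i \<phi> (x + t *\<^sub>R v))" for t
  have D1: "((\<lambda>t. \<phi> (x + t *\<^sub>R v)) has_real_derivative p1 t) (at t)" for t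
    unfolding p1_def by (rule DERIV_along_line[OF test_functionsD(1)[OF \<phi>]])
  have D2: "(p1 has_real_derivative second_deriv \<phi> v (x + t *\<^sub>R v)) (at t)" for t
    unfolding p1_def[abs_def] second_deriv_def
    by (intro DERIV_sum DERIV_cmult DERIV_along_line test_functionsD(1) partial_deriv_test_function \<phi>)
  have "((\<lambda>t. \<phi> (x + t *\<^sub>R v) - \<phi> (x + (t - d) *\<^sub>R v)) has_real_derivative p1 t - p1 (t - d)) (at t)" for t
    using DERIV_shift[of "\<lambda>t. \<phi> (x + t *\<^sub>R v)" "p1 (t - d)" t "- d"] D1[of "t - d"]
    by (intro DERIV_diff D1) simp
  with MVT2[OF d, of "\<lambda>t. \<phi> (x + t *\<^sub>R v) - \<phi> (x + (t - d) *\<^sub>R v)" "\<lambda>t. p1 t - p1 (t - d)"]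
  obtain y where y: "0 < y" "y < d"
    "(\<phi> (x + d *\<^sub>R v) - \<phi> x) - (\<phi> x - \<phi> (x - d *\<^sub>R v)) = d * (p1 y - p1 (y - d))"
    by auto
  have "y - d < y" using d by simp
  from MVT2[OF this, of p1 "\<lambda>t. second_deriv \<phi> v (x + t *\<^sub>R v)"] D2
  obtain z where z: "y - d < z" "z < y" "p1 y - p1 (y - d) = d * second_deriv \<phi> v (x + z *\<^sub>R v)" by auto
  show thesis
    by (rule that[of z]) (use y z in \<open>auto simp: power2_eq_square algebra_simps\<close>)
qed

definition second_quotient :: "(nat \<Rightarrow> real ^ 'n::finite) \<Rightarrow> nat \<Rightarrow> (real ^ 'n \<Rightarrow> real) \<Rightarrow> real \<Rightarrow> real ^ 'n \<Rightarrow> real" where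
  "second_quotient v M \<phi> d x = (\<Sum>k<M. (\<phi> (x + d *\<^sub>R v k) + \<phi> (x - d *\<^sub>R v k) - 2 * \<phi> x) / d\<^sup>2)"

text \<open>Convergence is in the mean because the quotients will be paired with functions
  controlled by a uniform bound. The bound \<open>d N \<le> D\<close> keeps all supports in one
  ball, on which the sums of the Hessian bounds dominate.\<close>

lemma second_quotient_limit:
  fixes \<phi> :: "real ^ 'n::finite \<Rightarrow> real"
  assumes \<phi>: "\<phi> \<in> test_functions UNIV" and d: "\<And>N. d N > 0" "\<And>N. d N \<le> D" "d \<longlonglongrightarrow> 0"
  shows "(\<lambda>N. \<integral>x. \<bar>second_quotient v M \<phi> (d N) x - (\<Sum>k<M. second_deriv \<phi> (v k) x)\<bar> \<partial>lborel) \<longlonglongrightarrow> 0"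
proof -
  obtain R where R: "R > 0" "\<And>x. R < norm x \<Longrightarrow> x \<notin> tsupport \<phi>"
    using compact_imp_bounded[OF test_functionsD(3)[OF \<phi>]] bounded_pos by (metis not_le)
  have "\<exists>B\<ge>0. \<forall>x. \<bar>second_deriv \<phi> (v k) x\<bar> \<le> B" for k
    using second_deriv_bounded[OF \<phi>] by metis
  then obtain B where B: "\<And>k. B k \<ge> 0" "\<And>k x. \<bar>second_deriv \<phi> (v k) x\<bar> \<le> B k" by metis
  have D: "D > 0" using d(1,2)[of 0] by simp
  define R' where "R' = R + D * (\<Sum>k<M. norm (v k))"
  have vk: "k < M \<Longrightarrow> D * norm (v k) \<le> D * (\<Sum>k<M. norm (v k))" for k
    using D by (intro mult_left_mono member_le_sum) auto
  define mid where "mid N k x y \<longleftrightarrow> \<bar>y\<bar> < d N \<and> \<phi> (x + d N *\<^sub>R v k) + \<phi> (x - d N *\<^sub>R v k) - 2 * \<phi> x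
      = (d N)\<^sup>2 * second_deriv \<phi> (v k) (x + y *\<^sub>R v k)" for N k x y
  \<comment> \<open>The intermediate points are chosen without measurability in \<open>x\<close>;
    they enter only pointwise bounds and limits, while the integrands remain difference
    quotients.\<close>
  define z where "z N k x = (SOME y. mid N k x y)" for N k x
  have "mid N k x (z N k x)" for N k x
  proof -
    have "\<exists>y. mid N k x y"
      unfolding mid_def by (rule second_difference_mvt[OF \<phi> d(1)[of N], of x "v k"]) blast
    thus ?thesis unfolding z_def by (rule someI_ex)
  qed
  hence z: "\<And>N k x. \<bar>z N k x\<bar> < d N"
    "\<And>N k x. \<phi> (x + d N *\<^sub>R v k) + \<phi> (x - d N *\<^sub>R v k) - 2 * \<phi> x
      = (d N)\<^sup>2 * second_deriv \<phi> (v k) (x + z N k x *\<^sub>R v k)" by (auto simp: mid_def)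
  have eq: "second_quotient v M \<phi> (d N) x = (\<Sum>k<M. second_deriv \<phi> (v k) (x + z N k x *\<^sub>R v k))" for N x
    unfolding second_quotient_def z(2) using d(1)[of N] by simp
  have [measurable]: "\<phi> \<in> borel_measurable borel"
    by (intro borel_measurable_continuous_onI test_functionsD(2) \<phi>)
  note [measurable] = second_deriv_measurable[OF \<phi>]
  have "(\<lambda>N. \<integral>x. \<bar>second_quotient v M \<phi> (d N) x - (\<Sum>k<M. second_deriv \<phi> (v k) x)\<bar> \<partial>lborel) \<longlonglongrightarrow> (\<integral>x. 0 \<partial>(lborel :: (real ^ 'n) measure))"
  proof (rule integral_dominated_convergence[where w = "\<lambda>x. (2 * (\<Sum>k<M. B k)) * indicator (cball 0 R') x"])
    show "integrable lborel (\<lambda>x. (2 * (\<Sum>k<M. B k)) * indicator (cball 0 R') x :: real)"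
      using emeasure_lborel_cball_finite by (intro integrable_mult_right integrable_real_indicator) auto
    show "AE x in lborel. (\<lambda>N. \<bar>second_quotient v M \<phi> (d N) x - (\<Sum>k<M. second_deriv \<phi> (v k) x)\<bar>) \<longlonglongrightarrow> 0"
    proof (rule AE_I2)
      fix x
      have "(\<lambda>N. second_deriv \<phi> (v k) (x + z N k x *\<^sub>R v k)) \<longlonglongrightarrow> second_deriv \<phi> (v k) (x + 0 *\<^sub>R v k)" for k
      proof -
        have z0: "(\<lambda>N. z N k x) \<longlonglongrightarrow> 0"
          by (rule Lim_null_comparison[OF _ d(3)]) (auto intro: always_eventually less_imp_le z(1))
        have "isCont (second_deriv \<phi> (v k)) (x + 0 *\<^sub>R v k)"
          using second_deriv_cont[OF \<phi>, of UNIV] by (simp add: continuous_on_eq_continuous_at)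
        thus ?thesis by (rule isCont_tendsto_compose) (intro tendsto_intros z0)
      qed
      hence "(\<lambda>N. second_quotient v M \<phi> (d N) x) \<longlonglongrightarrow> (\<Sum>k<M. second_deriv \<phi> (v k) x)"
        unfolding eq by (intro tendsto_sum) simp
      thus "(\<lambda>N. \<bar>second_quotient v M \<phi> (d N) x - (\<Sum>k<M. second_deriv \<phi> (v k) x)\<bar>) \<longlonglongrightarrow> 0"
        using LIM_zero tendsto_rabs_zero by blast
    qed
    show "AE x in lborel. norm \<bar>second_quotient v M \<phi> (d N) x - (\<Sum>k<M. second_deriv \<phi> (v k) x)\<bar>
        \<le> (2 * (\<Sum>k<M. B k)) * indicator (cball 0 R') x" for N
    proof (rule AE_I2)
      fix x
      show "norm \<bar>second_quotient v M \<phi> (d N) x - (\<Sum>k<M. second_deriv \<phi> (v k) x)\<bar>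
        \<le> (2 * (\<Sum>k<M. B k)) * indicator (cball 0 R') x"
      proof (cases "norm x \<le> R'")
        case True
        have "\<bar>second_quotient v M \<phi> (d N) x\<bar> \<le> (\<Sum>k<M. B k)" "\<bar>\<Sum>k<M. second_deriv \<phi> (v k) x\<bar> \<le> (\<Sum>k<M. B k)"
          unfolding eq by (intro order_trans[OF sum_abs] sum_mono B(2))+
        thus ?thesis using True by simp
      next
        case False
        have "0 \<le> (\<Sum>k<M. norm (v k))" by (intro sum_nonneg) auto
        hence "R < norm x" using False D unfolding R'_def by (smt (verit) mult_nonneg_nonneg)
        hence 1: "(\<Sum>k<M. second_deriv \<phi> (v k) x) = 0" using R second_deriv_zero by (intro sum.neutral) auto
        have "second_deriv \<phi> (v k) (x + z N k x *\<^sub>R v k) = 0" if k: "k < M" for k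
        proof -
          have "norm (z N k x *\<^sub>R v k) \<le> D * norm (v k)"
            using z(1)[of N k x] d(2)[of N] by (simp add: mult_right_mono)
          also have "\<dots> \<le> D * (\<Sum>k<M. norm (v k))" by (rule vk[OF k])
          finally have "R < norm (x + z N k x *\<^sub>R v k)"
            using False norm_diff_ineq[of x "z N k x *\<^sub>R v k"] unfolding R'_def by linarith
          thus ?thesis using R second_deriv_zero by blast
        qed
        hence "second_quotient v M \<phi> (d N) x = 0" unfolding eq by (intro sum.neutral) auto
        thus ?thesis using 1 False by simp
      qed
    qed
  qed (unfold second_quotient_def, measurable)
  thus ?thesis by simp
qed

section \<open>One step of the walk against a test function\<close>

context euler_scheme
begin

definition hs :: "nat \<Rightarrow> real" where "hs N = inverse (real (Suc N))"

lemma hs: "0 < hs N" "hs N \<le> 1" "hs \<longlonglongrightarrow> 0"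
  using LIMSEQ_inverse_real_of_nat by (auto simp: hs_def[abs_def] divide_simps)

text \<open>The formal adjoint of the diffusion operator, once \<open>A\<close> is the sum of the
  products of \<open>v k\<close> with its transpose.\<close>

definition adjoint_gen :: "(real ^ 'n \<Rightarrow> real) \<Rightarrow> real ^ 'n \<Rightarrow> real" where
  "adjoint_gen \<phi> x = (\<Sum>k<M. second_deriv \<phi> (v k) x) - divergence_mult b \<phi> x"

lemma adjoint_gen_integrable:
  assumes \<phi>: "\<phi> \<in> test_functions UNIV" and g: "g \<in> borel_measurable borel" "\<And>x. \<bar>g x\<bar> \<le> B"
  shows "integrable lborel (\<lambda>x. g x * second_deriv \<phi> u x)"
    "integrable lborel (\<lambda>x. g x * divergence_mult b \<phi> x)"
    "integrable lborel (\<lambda>x. g x * adjoint_gen \<phi> x)"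
    "(\<integral>x. g x * adjoint_gen \<phi> x \<partial>lborel)
      = (\<Sum>k<M. \<integral>x. g x * second_deriv \<phi> (v k) x \<partial>lborel) - (\<integral>x. g x * divergence_mult b \<phi> x \<partial>lborel)"
proof -
  obtain R where R: "R > 0" "\<And>x. R < norm x \<Longrightarrow> x \<notin> tsupport \<phi>"
    using compact_imp_bounded[OF test_functionsD(3)[OF \<phi>]] bounded_pos by (metis not_le)
  obtain R' where R': "R' > 0" "bump R' \<phi>" using test_functions_bump[OF \<phi>] by blast
  note [measurable] = g(1) second_deriv_measurable[OF \<phi>]
  have 1: "integrable lborel (\<lambda>x. g x * second_deriv \<phi> u x)" for u
  proof -
    obtain D where D: "D \<ge> 0" "\<And>x. \<bar>second_deriv \<phi> u x\<bar> \<le> D" using second_deriv_bounded[OF \<phi>] by blast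
    show ?thesis
    proof (rule integrable_bounded_support[of _ R "B * D"])
      show "\<bar>g x * second_deriv \<phi> u x\<bar> \<le> B * D" for x
        using D(2) g(2) order_trans[OF abs_ge_zero g(2)[of x]] by (auto simp: abs_mult intro!: mult_mono)
    qed (use R second_deriv_zero in auto)
  qed
  show "integrable lborel (\<lambda>x. g x * second_deriv \<phi> u x)" by (rule 1)
  show 2: "integrable lborel (\<lambda>x. g x * divergence_mult b \<phi> x)"
    by (rule bump_divergence_mult(1)[OF b_lip b_diff R'(2) g])
  have eq: "(\<lambda>x. g x * adjoint_gen \<phi> x) = (\<lambda>x. (\<Sum>k<M. g x * second_deriv \<phi> (v k) x) - g x * divergence_mult b \<phi> x)"
    by (simp add: adjoint_gen_def fun_eq_iff algebra_simps sum_distrib_left)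
  show "integrable lborel (\<lambda>x. g x * adjoint_gen \<phi> x)"
    unfolding eq by (intro Bochner_Integration.integrable_diff Bochner_Integration.integrable_sum 1 2)
  show "(\<integral>x. g x * adjoint_gen \<phi> x \<partial>lborel)
      = (\<Sum>k<M. \<integral>x. g x * second_deriv \<phi> (v k) x \<partial>lborel) - (\<integral>x. g x * divergence_mult b \<phi> x \<partial>lborel)"
    unfolding eq
    by (subst Bochner_Integration.integral_diff)
      (intro Bochner_Integration.integrable_sum 1 2, intro 2, simp add: Bochner_Integration.integral_sum 1)
qed

text \<open>The noise half of a step. \<open>K h g\<close> is \<open>smear h g\<close> composed with
  the drift map, so the two halves can be compared with the two parts of the generator
  separately.\<close>

definition smear :: "real \<Rightarrow> (real ^ 'n \<Rightarrow> real) \<Rightarrow> real ^ 'n \<Rightarrow> real" where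
  "smear h g x = (\<Sum>j\<in>J. g (x + w h j)) / card J"

lemma K_eq_smear: "K h g x = smear h g (x + h *\<^sub>R b x)"
  by (simp add: avg_def F_def drift_def smear_def)

lemma smear_bound:
  assumes "\<And>x. \<bar>g x\<bar> \<le> B"
  shows "\<bar>smear h g x\<bar> \<le> B"
proof -
  have "\<bar>\<Sum>j\<in>J. g (x + w h j)\<bar> \<le> (\<Sum>j\<in>J. B)"
    by (intro order_trans[OF sum_abs] sum_mono assms)
  thus ?thesis using card_J[OF J] by (simp add: smear_def abs_divide divide_le_eq mult.commute)
qed

lemma smear_differentiable:
  assumes "\<And>x. g differentiable (at x)"
  shows "smear h g differentiable (at x)"
proof -
  have "(\<lambda>x. g (x + u)) differentiable (at x)" for u x
  proof -
    have "((\<lambda>x. x + u) has_derivative (\<lambda>e. e)) (at x)" by (auto intro!: derivative_eq_intros)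
    from has_derivative_compose[OF this dd_works[OF assms]] show ?thesis by (rule differentiableI)
  qed
  moreover have "smear h g = (\<lambda>x. inverse (real (card J)) * (\<Sum>j\<in>J. g (x + w h j)))"
    by (simp add: smear_def fun_eq_iff divide_inverse)
  ultimately show ?thesis by (auto intro!: differentiable_mult differentiable_sum simp: J)
qed

lemma smear_lipschitz:
  assumes "C-lipschitz_on UNIV g"
  shows "C-lipschitz_on UNIV (smear h g)"
proof (rule lipschitz_onI)
  fix x y
  have "smear h g x - smear h g y = (\<Sum>j\<in>J. g (x + w h j) - g (y + w h j)) / card J"
    by (simp add: smear_def diff_divide_distrib sum_subtractf)
  also have "\<bar>\<dots>\<bar> \<le> (\<Sum>j\<in>J. C * norm (x - y)) / card J"
    unfolding abs_divide abs_of_nat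
    by (intro divide_right_mono order_trans[OF sum_abs] sum_mono)
      (use lipschitz_norm_diff_le[OF assms, of "x + w h j" "y + w h j" for j] in auto)
  also have "\<dots> = C * norm (x - y)" using card_J[OF J] by simp
  finally show "dist (smear h g x) (smear h g y) \<le> C * dist x y" by (simp add: dist_norm)
qed (rule lipschitz_on_nonneg[OF assms])

definition c\<^sub>v :: real where "c\<^sub>v = sqrt (2 * real M) * (\<Sum>k<M. norm (v k))"

lemma norm_w: "0 \<le> h \<Longrightarrow> j \<in> J \<Longrightarrow> norm (w h j) \<le> sqrt h * c\<^sub>v"
proof -
  assume h: "0 \<le> h" and j: "j \<in> J"
  have "norm (w h j) = sqrt (2 * real M * h) * norm (v (fst j))" using h by (simp add: w_def)
  also have "\<dots> \<le> sqrt (2 * real M * h) * (\<Sum>k<M. norm (v k))"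
    using h j by (intro mult_left_mono member_le_sum) (auto simp: J_def)
  finally show ?thesis by (simp add: c\<^sub>v_def real_sqrt_mult mult_ac)
qed

text \<open>Only of order \<open>sqrt h\<close>, as no second derivative of \<open>g\<close> is
  controlled. This suffices in \<open>K_adjoint_consistency\<close>, where the difference carries a
  further factor \<open>h\<close>.\<close>

lemma smear_diff:
  assumes "C-lipschitz_on UNIV g" "0 \<le> h"
  shows "\<bar>smear h g x - g x\<bar> \<le> C * (sqrt h * c\<^sub>v)"
proof -
  have C: "C \<ge> 0" using assms(1) lipschitz_on_nonneg by blast
  have "smear h g x - g x = (\<Sum>j\<in>J. g (x + w h j) - g x) / card J"
    using card_J[OF J] by (simp add: smear_def diff_divide_distrib sum_subtractf)
  also have "\<bar>\<dots>\<bar> \<le> (\<Sum>j\<in>J. C * (sqrt h * c\<^sub>v)) / card J"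
    unfolding abs_divide abs_of_nat
  proof (intro divide_right_mono order_trans[OF sum_abs] sum_mono)
    fix j assume j: "j \<in> J"
    show "\<bar>g (x + w h j) - g x\<bar> \<le> C * (sqrt h * c\<^sub>v)"
      using lipschitz_norm_diff_le[OF assms(1), of "x + w h j" x] mult_left_mono[OF norm_w[OF assms(2) j] C] by simp
  qed simp
  also have "\<dots> = C * (sqrt h * c\<^sub>v)" using card_J[OF J] by simp
  finally show ?thesis .
qed

text \<open>An identity without error: translation invariance moves the noise from \<open>g\<close>
  to \<open>\<phi>\<close>, and the two signs of a direction form a second difference of length
  \<open>sqrt (2 * M * h)\<close>. Its square supplies the factor \<open>2 * M\<close> that matches
  the number of elements of \<open>J\<close>.\<close>

lemma smear_adjoint:
  assumes \<phi>: "\<phi> \<in> test_functions UNIV" and g: "g \<in> borel_measurable borel" "\<And>x. \<bar>g x\<bar> \<le> B" and h: "0 < h"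
  shows "integrable lborel (\<lambda>x. g x * second_quotient v M \<phi> (sqrt (2 * real M * h)) x)"
    "(\<integral>x. smear h g x * \<phi> x \<partial>lborel) - (\<integral>x. g x * \<phi> x \<partial>lborel)
     = h * (\<integral>x. g x * second_quotient v M \<phi> (sqrt (2 * real M * h)) x \<partial>lborel)"
proof -
  obtain R where R: "R > 0" "bump R \<phi>" using test_functions_bump[OF \<phi>] by blast
  note [measurable] = g(1) bumpD(4)[OF R(2)]
  have B: "B \<ge> 0" using g(2)[of 0] by simp
  let ?d = "sqrt (2 * real M * h)"
  have d2: "?d\<^sup>2 = 2 * real M * h" using h by simp
  have Mh: "2 * real M * h > 0" using h M_pos by simp
  have i1: "integrable lborel (\<lambda>x. g (x + u) * \<phi> x)" for u
    by (rule bump_mult_integrable[OF R(2), where B = B]) (use g in auto)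
  have i2: "integrable lborel (\<lambda>x. g x * \<phi> (x - u))" for u
  proof -
    have "integrable (distr lborel borel ((+) u)) (\<lambda>x. g x * \<phi> (x - u))"
      by (subst integrable_distr_eq) (use i1[of u] in \<open>auto simp: add.commute\<close>)
    thus ?thesis by (simp add: lborel_distr_plus)
  qed
  have shift: "(\<integral>x. g (x + u) * \<phi> x \<partial>lborel) = (\<integral>x. g x * \<phi> (x - u) \<partial>lborel)" for u
    using integral_translate[of "\<lambda>x. g x * \<phi> (x - u)" u] by simp
  have sq: "(\<lambda>x. g x * second_quotient v M \<phi> ?d x)
     = (\<lambda>x. (\<Sum>k<M. g x * \<phi> (x - (- (?d *\<^sub>R v k))) + g x * \<phi> (x - ?d *\<^sub>R v k) - 2 * (g x * \<phi> (x - 0))) / (2 * real M * h))"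
    unfolding second_quotient_def d2 by (simp add: fun_eq_iff sum_divide_distrib[symmetric] sum_distrib_left algebra_simps)
  show "integrable lborel (\<lambda>x. g x * second_quotient v M \<phi> ?d x)"
    unfolding sq by (intro integrable_divide Bochner_Integration.integrable_sum Bochner_Integration.integrable_diff
      Bochner_Integration.integrable_add integrable_mult_right i2)
  have "h * (\<integral>x. g x * second_quotient v M \<phi> ?d x \<partial>lborel)
     = h * ((\<Sum>k<M. (\<integral>x. g x * \<phi> (x - (- (?d *\<^sub>R v k))) \<partial>lborel) + (\<integral>x. g x * \<phi> (x - ?d *\<^sub>R v k) \<partial>lborel)
          - 2 * (\<integral>x. g x * \<phi> (x - 0) \<partial>lborel)) / (2 * real M * h))"
    unfolding sq integral_divide_zero
    by (subst Bochner_Integration.integral_sum)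
      (intro Bochner_Integration.integrable_diff Bochner_Integration.integrable_add integrable_mult_right i2,
       simp only: Bochner_Integration.integral_diff Bochner_Integration.integral_add Bochner_Integration.integrable_add
         integral_mult_right_zero integrable_mult_right i2)
  also have "\<dots> = (\<Sum>k<M. (\<integral>x. g x * \<phi> (x - (?d *\<^sub>R v k)) \<partial>lborel) + (\<integral>x. g x * \<phi> (x - (- (?d *\<^sub>R v k))) \<partial>lborel)) / (2 * real M)
       - (\<integral>x. g x * \<phi> x \<partial>lborel)"
    using h M_pos by (simp add: sum.distrib sum_subtractf field_simps)
  also have "(\<Sum>k<M. (\<integral>x. g x * \<phi> (x - (?d *\<^sub>R v k)) \<partial>lborel) + (\<integral>x. g x * \<phi> (x - (- (?d *\<^sub>R v k))) \<partial>lborel)) / (2 * real M)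
      = (\<Sum>j\<in>J. \<integral>x. g x * \<phi> (x - w h j) \<partial>lborel) / card J"
    using sum_w_pm[of "\<lambda>u. \<integral>x. g x * \<phi> (x - u) \<partial>lborel" h] by (simp add: card_J_eq)
  also have "\<dots> = (\<Sum>j\<in>J. \<integral>x. g (x + w h j) * \<phi> x \<partial>lborel) / card J" by (simp only: shift)
  also have "\<dots> = (\<integral>x. (\<Sum>j\<in>J. g (x + w h j) * \<phi> x) / card J \<partial>lborel)"
    unfolding integral_divide_zero by (subst Bochner_Integration.integral_sum) (auto intro: i1)
  also have "\<dots> = (\<integral>x. smear h g x * \<phi> x \<partial>lborel)"
    by (simp add: smear_def sum_distrib_right)
  finally show "(\<integral>x. smear h g x * \<phi> x \<partial>lborel) - (\<integral>x. g x * \<phi> x \<partial>lborel)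
     = h * (\<integral>x. g x * second_quotient v M \<phi> ?d x \<partial>lborel)" by simp
qed

lemma K_adjoint_consistency:
  assumes \<phi>: "\<phi> \<in> test_functions UNIV"
  obtains e where "e \<longlonglongrightarrow> 0" "\<And>N. e N \<ge> 0"
    "\<And>N g B C. (\<And>x. \<bar>g x\<bar> \<le> B) \<Longrightarrow> C-lipschitz_on UNIV g \<Longrightarrow> (\<And>x. g differentiable (at x)) \<Longrightarrow>
      \<bar>(\<integral>x. K (hs N) g x * \<phi> x \<partial>lborel) - (\<integral>x. g x * \<phi> x \<partial>lborel)
        - hs N * (\<integral>x. g x * adjoint_gen \<phi> x \<partial>lborel)\<bar> \<le> hs N * ((B + C) * e N)"
proof -
  obtain R where R: "R > 0" "bump R \<phi>" using test_functions_bump[OF \<phi>] by blast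
  obtain c where c: "c \<ge> 0"
    "\<And>g C h. C-lipschitz_on UNIV g \<Longrightarrow> (\<And>x. g differentiable (at x)) \<Longrightarrow> 0 < h \<Longrightarrow>
      \<bar>(\<integral>x. g (x + h *\<^sub>R b x) * \<phi> x \<partial>lborel) - (\<integral>x. g x * \<phi> x \<partial>lborel)
        + h * (\<integral>x. g x * divergence_mult b \<phi> x \<partial>lborel)\<bar> \<le> C * c * h\<^sup>2"
    using drift_consistency[OF b_lip b_diff R(2)] by blast
  define d where "d N = sqrt (2 * real M * hs N)" for N
  define e1 where "e1 N = (\<integral>x. \<bar>second_quotient v M \<phi> (d N) x - (\<Sum>k<M. second_deriv \<phi> (v k) x)\<bar> \<partial>lborel)" for N
  define I where "I = (\<integral>x. \<bar>divergence_mult b \<phi> x\<bar> \<partial>lborel)"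
  \<comment> \<open>Three errors: second differences against the Hessian, the drift step, and the
    replacement of \<open>smear h g\<close> by \<open>g\<close> in the divergence term.\<close>
  define e where "e N = e1 N + c * hs N + sqrt (hs N) * c\<^sub>v * I" for N
  have d: "d N > 0" "d N \<le> sqrt (2 * real M)" "d \<longlonglongrightarrow> 0" for N
  proof -
    show "d N > 0" using hs(1)[of N] M_pos by (simp add: d_def)
    have "2 * real M * hs N \<le> 2 * real M * 1" using hs(2)[of N] by (intro mult_left_mono) auto
    thus "d N \<le> sqrt (2 * real M)" by (simp add: d_def)
    have "d \<longlonglongrightarrow> sqrt (2 * real M * 0)" unfolding d_def[abs_def] by (intro tendsto_intros hs(3))
    thus "d \<longlonglongrightarrow> 0" by simp
  qed
  have e1: "e1 \<longlonglongrightarrow> 0" unfolding e1_def[abs_def] by (rule second_quotient_limit[OF \<phi> d])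
  have cv: "c\<^sub>v \<ge> 0" unfolding c\<^sub>v_def by (intro mult_nonneg_nonneg sum_nonneg) auto
  have I: "I \<ge> 0" unfolding I_def by (intro Bochner_Integration.integral_nonneg) auto
  show thesis
  proof (rule that[of e])
    have "e \<longlonglongrightarrow> 0 + c * 0 + sqrt 0 * c\<^sub>v * I" unfolding e_def[abs_def] by (intro tendsto_intros e1 hs(3))
    thus "e \<longlonglongrightarrow> 0" by simp
    have e1n: "e1 N \<ge> 0" for N unfolding e1_def by (intro Bochner_Integration.integral_nonneg) auto
    show "e N \<ge> 0" for N
      unfolding e_def using c(1) hs(1)[of N] cv I e1n[of N] by (intro add_nonneg_nonneg mult_nonneg_nonneg) auto
    fix N B C and g :: "real ^ 'n \<Rightarrow> real"
    assume gB: "\<And>x. \<bar>g x\<bar> \<le> B" and gC: "C-lipschitz_on UNIV g" and gd: "\<And>x. g differentiable (at x)"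
    define h where "h = hs N"
    have h: "0 < h" using hs by (simp add: h_def)
    have gm [measurable]: "g \<in> borel_measurable borel" by (rule differentiable_imp_measurable[OF gd])
    have B: "B \<ge> 0" using gB[of 0] by simp
    have C: "C \<ge> 0" using gC lipschitz_on_nonneg by blast
    note s = smear_bound[OF gB, of h] smear_lipschitz[OF gC, of h] smear_differentiable[OF gd, of h]
    have sm [measurable]: "smear h g \<in> borel_measurable borel" by (rule differentiable_imp_measurable[OF s(3)])
    note [measurable] = second_deriv_measurable[OF \<phi>] bumpD(4)[OF R(2)] divergence_mult_measurable[OF b_lip b_diff R(2)]
    note ig = adjoint_gen_integrable[OF \<phi> gm gB]
    have i_div: "integrable lborel (\<lambda>x. \<bar>divergence_mult b \<phi> x\<bar>)"
      using adjoint_gen_integrable(2)[OF \<phi>, of "\<lambda>_. 1" 1] by (simp add: integrable_abs)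
    have T1: "\<bar>(\<integral>x. K h g x * \<phi> x \<partial>lborel) - (\<integral>x. smear h g x * \<phi> x \<partial>lborel)
        + h * (\<integral>x. smear h g x * divergence_mult b \<phi> x \<partial>lborel)\<bar> \<le> C * c * h\<^sup>2"
      unfolding K_eq_smear by (rule c(2)[OF s(2,3) h])
    have T2: "\<bar>(\<integral>x. smear h g x * divergence_mult b \<phi> x \<partial>lborel) - (\<integral>x. g x * divergence_mult b \<phi> x \<partial>lborel)\<bar>
        \<le> C * (sqrt h * c\<^sub>v) * I"
    proof -
      have i: "integrable lborel (\<lambda>x. smear h g x * divergence_mult b \<phi> x)"
        by (rule adjoint_gen_integrable(2)[OF \<phi> sm s(1)])
      have "\<bar>\<integral>x. smear h g x * divergence_mult b \<phi> x - g x * divergence_mult b \<phi> x \<partial>lborel\<bar>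
        \<le> (\<integral>x. C * (sqrt h * c\<^sub>v) * \<bar>divergence_mult b \<phi> x\<bar> \<partial>lborel)"
      proof (rule order_trans[OF integral_abs_bound], rule integral_mono)
        show "integrable lborel (\<lambda>x. \<bar>smear h g x * divergence_mult b \<phi> x - g x * divergence_mult b \<phi> x\<bar>)"
          by (intro integrable_abs Bochner_Integration.integrable_diff i ig(2))
        show "integrable lborel (\<lambda>x. C * (sqrt h * c\<^sub>v) * \<bar>divergence_mult b \<phi> x\<bar>)"
          using i_div by (rule integrable_mult_right)
        fix x
        from mult_right_mono[OF smear_diff[OF gC less_imp_le[OF h], of x], of "\<bar>divergence_mult b \<phi> x\<bar>"]
        show "\<bar>smear h g x * divergence_mult b \<phi> x - g x * divergence_mult b \<phi> x\<bar>
            \<le> C * (sqrt h * c\<^sub>v) * \<bar>divergence_mult b \<phi> x\<bar>"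
          by (simp add: abs_mult[symmetric] left_diff_distrib)
      qed
      thus ?thesis by (simp add: Bochner_Integration.integral_diff[OF i ig(2)] I_def)
    qed
    have T3: "(\<integral>x. smear h g x * \<phi> x \<partial>lborel) - (\<integral>x. g x * \<phi> x \<partial>lborel)
        = h * (\<integral>x. g x * second_quotient v M \<phi> (d N) x \<partial>lborel)"
      unfolding d_def h_def[symmetric] by (rule smear_adjoint(2)[OF \<phi> gm gB h])
    have i3: "integrable lborel (\<lambda>x. g x * second_quotient v M \<phi> (d N) x)"
      unfolding d_def h_def[symmetric] by (rule smear_adjoint(1)[OF \<phi> gm gB h])
    define A where "A x = (\<Sum>k<M. second_deriv \<phi> (v k) x)" for x
    have iA: "integrable lborel (\<lambda>x. f x * A x)" if "f \<in> borel_measurable borel" "\<And>x. \<bar>f x\<bar> \<le> D" for f D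
      unfolding A_def sum_distrib_left by (intro Bochner_Integration.integrable_sum adjoint_gen_integrable(1)[OF \<phi> that])
    have iq: "integrable lborel (\<lambda>x. \<bar>second_quotient v M \<phi> (d N) x - A x\<bar>)"
    proof -
      have "integrable lborel (\<lambda>x. 1 * second_quotient v M \<phi> (d N) x)"
        unfolding d_def h_def[symmetric] by (rule smear_adjoint(1)[OF \<phi> _ _ h, of _ 1]) auto
      thus ?thesis using iA[of "\<lambda>_. 1" 1] by (intro integrable_abs Bochner_Integration.integrable_diff) auto
    qed
    have T4: "\<bar>(\<integral>x. g x * second_quotient v M \<phi> (d N) x \<partial>lborel) - (\<integral>x. g x * A x \<partial>lborel)\<bar> \<le> B * e1 N"
    proof -
      have "\<bar>\<integral>x. g x * second_quotient v M \<phi> (d N) x - g x * A x \<partial>lborel\<bar>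
        \<le> (\<integral>x. B * \<bar>second_quotient v M \<phi> (d N) x - A x\<bar> \<partial>lborel)"
      proof (rule order_trans[OF integral_abs_bound], rule integral_mono)
        show "integrable lborel (\<lambda>x. \<bar>g x * second_quotient v M \<phi> (d N) x - g x * A x\<bar>)"
          by (intro integrable_abs Bochner_Integration.integrable_diff i3 iA[OF gm gB])
        show "integrable lborel (\<lambda>x. B * \<bar>second_quotient v M \<phi> (d N) x - A x\<bar>)"
          using iq by (rule integrable_mult_right)
        fix x
        from mult_right_mono[OF gB[of x], of "\<bar>second_quotient v M \<phi> (d N) x - A x\<bar>"]
        show "\<bar>g x * second_quotient v M \<phi> (d N) x - g x * A x\<bar> \<le> B * \<bar>second_quotient v M \<phi> (d N) x - A x\<bar>"
          by (simp add: abs_mult[symmetric] right_diff_distrib)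
      qed
      thus ?thesis unfolding Bochner_Integration.integral_diff[OF i3 iA[OF gm gB]] by (simp add: e1_def A_def)
    qed
    have T5: "(\<integral>x. g x * adjoint_gen \<phi> x \<partial>lborel) = (\<integral>x. g x * A x \<partial>lborel) - (\<integral>x. g x * divergence_mult b \<phi> x \<partial>lborel)"
    proof -
      have "g x * adjoint_gen \<phi> x = g x * A x - g x * divergence_mult b \<phi> x" for x
        by (simp add: adjoint_gen_def A_def right_diff_distrib)
      thus ?thesis by (simp add: Bochner_Integration.integral_diff[OF iA[OF gm gB] ig(2)])
    qed
    define k0 where "k0 = (\<integral>x. K h g x * \<phi> x \<partial>lborel)"
    define s0 where "s0 = (\<integral>x. smear h g x * \<phi> x \<partial>lborel)"
    define g0 where "g0 = (\<integral>x. g x * \<phi> x \<partial>lborel)"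
    define s1 where "s1 = (\<integral>x. smear h g x * divergence_mult b \<phi> x \<partial>lborel)"
    define g1 where "g1 = (\<integral>x. g x * divergence_mult b \<phi> x \<partial>lborel)"
    define gq where "gq = (\<integral>x. g x * second_quotient v M \<phi> (d N) x \<partial>lborel)"
    define gA where "gA = (\<integral>x. g x * A x \<partial>lborel)"
    \<comment> \<open>The full step is compared with the noise step, then \<open>smear h g\<close>
      with \<open>g\<close> in the first order term, then second differences with the Hessian;
      \<open>T3\<close> makes the noise step itself exact.\<close>
    have "k0 - g0 - h * (gA - g1) = (k0 - s0 + h * s1) - h * (s1 - g1) + h * (gq - gA)"
      using T3[folded s0_def g0_def gq_def] by (simp add: algebra_simps)
    moreover have "\<bar>h * (s1 - g1)\<bar> = h * \<bar>s1 - g1\<bar>" "\<bar>h * (gq - gA)\<bar> = h * \<bar>gq - gA\<bar>"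
      using h by (simp_all add: abs_mult)
    ultimately have "\<bar>k0 - g0 - h * (gA - g1)\<bar> \<le> \<bar>k0 - s0 + h * s1\<bar> + h * \<bar>s1 - g1\<bar> + h * \<bar>gq - gA\<bar>"
      by linarith
    also have "\<dots> \<le> C * c * h\<^sup>2 + h * (C * (sqrt h * c\<^sub>v) * I) + h * (B * e1 N)"
      using T1 T2 T4 h unfolding k0_def s0_def s1_def g1_def gq_def gA_def
      by (intro add_mono mult_left_mono) auto
    also have "\<dots> = h * (C * (c * h + sqrt h * c\<^sub>v * I) + B * e1 N)"
      by (simp add: power2_eq_square algebra_simps)
    also have "\<dots> \<le> h * (C * e N + B * e N)"
    proof -
      have "c * h + sqrt h * c\<^sub>v * I \<le> e N" "e1 N \<le> e N"
        unfolding e_def h_def[symmetric] using e1n[of N] h c(1) cv I by auto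
      thus ?thesis using h B C by (intro mult_left_mono add_mono) auto
    qed
    finally show "\<bar>(\<integral>x. K (hs N) g x * \<phi> x \<partial>lborel) - (\<integral>x. g x * \<phi> x \<partial>lborel)
        - hs N * (\<integral>x. g x * adjoint_gen \<phi> x \<partial>lborel)\<bar> \<le> hs N * ((B + C) * e N)"
      unfolding T5 k0_def g0_def gA_def g1_def h_def[symmetric] by (simp add: algebra_simps)
  qed
qed

end

section \<open>Convergence of the walk to the semigroup\<close>

text \<open>Arzela-Ascoli by a diagonal sequence on a countable dense set. Equicontinuity is asked
  for only from some \<open>N\<^sub>0\<close> on, since for fixed \<open>N\<close> the interpolated
  walk jumps in time; this still makes the sequence Cauchy at each point and the limit
  continuous.\<close>

lemma asymp_equicontinuous_subsequence:
  fixes u :: "nat \<Rightarrow> 'a::{second_countable_topology, metric_space} \<Rightarrow> real"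
  assumes bound: "\<And>N z. \<bar>u N z\<bar> \<le> B"
    and equi: "\<And>z e. e > 0 \<Longrightarrow> \<exists>d>0. \<exists>N\<^sub>0. \<forall>N\<ge>N\<^sub>0. \<forall>z'. dist z z' < d \<longrightarrow> \<bar>u N z - u N z'\<bar> \<le> e"
  obtains r U where "strict_mono (r :: nat \<Rightarrow> nat)" "\<And>z. (\<lambda>N. u (r N) z) \<longlonglongrightarrow> U z" "continuous_on UNIV U"
proof -
  obtain D :: "'a set" where D: "countable D" "\<And>X. open X \<Longrightarrow> X \<noteq> {} \<Longrightarrow> \<exists>d\<in>D. d \<in> X"
    using countable_dense_setE by metis
  have "D \<noteq> {}" using D(2)[of UNIV] by auto
  define p where "p = from_nat_into D"
  have p: "range p = D" unfolding p_def using \<open>D \<noteq> {}\<close> D(1) by (rule range_from_nat_into)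
  let ?P = "\<lambda>n s. convergent (\<lambda>k. u (s k) (p n))"
  interpret sub: subseqs ?P
  proof
    fix n :: nat and s :: "nat \<Rightarrow> nat"
    have "\<forall>k. u (s k) (p n) \<in> {-B..B}" using bound by (auto simp: abs_le_iff minus_le_iff)
    then obtain l r where "strict_mono r" "((\<lambda>k. u (s k) (p n)) \<circ> r) \<longlonglongrightarrow> l"
      using compact_Icc[of "-B" B] by (meson compact_imp_seq_compact seq_compactE)
    thus "\<exists>r'. strict_mono r' \<and> convergent (\<lambda>k. u ((s \<circ> r') k) (p n))"
      by (auto simp: convergent_def o_def)
  qed
  define r where "r = sub.diagseq"
  have r: "strict_mono r" unfolding r_def by (rule sub.subseq_diagseq)
  have conv_p: "convergent (\<lambda>k. u (r k) (p n))" for n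
  proof -
    have "convergent (\<lambda>k. u ((r \<circ> ((+) (Suc n))) k) (p n))"
      unfolding r_def
    proof (rule sub.diagseq_holds)
      fix r' s :: "nat \<Rightarrow> nat" and n assume "strict_mono r'" "convergent (\<lambda>k. u (s k) (p n))"
      thus "convergent (\<lambda>k. u ((s \<circ> r') k) (p n))"
        using convergent_subseq_convergent[of "\<lambda>k. u (s k) (p n)" r'] by (simp add: o_def)
    qed
    then obtain l where "(\<lambda>k. u (r (k + Suc n)) (p n)) \<longlonglongrightarrow> l" by (auto simp: convergent_def add.commute)
    hence "(\<lambda>k. u (r k) (p n)) \<longlonglongrightarrow> l" by (rule LIMSEQ_offset)
    thus ?thesis by (auto simp: convergent_def)
  qed
  have "convergent (\<lambda>N. u (r N) z)" for z
  proof -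
    have "Cauchy (\<lambda>N. u (r N) z)"
      unfolding Cauchy_def dist_real_def
    proof (intro allI impI)
      fix e :: real assume e: "e > 0"
      obtain d N0 where d: "d > 0" "\<And>N z'. N \<ge> N0 \<Longrightarrow> dist z z' < d \<Longrightarrow> \<bar>u N z - u N z'\<bar> \<le> e / 4"
        using equi[of "e / 4" z] e by auto
      obtain n where n: "dist z (p n) < d" using D(2)[of "ball z d"] d(1) p by (force simp: image_iff)
      have "Cauchy (\<lambda>N. u (r N) (p n))" using conv_p[of n] by (rule convergent_Cauchy)
      then obtain N1 where N1: "\<And>m k. m \<ge> N1 \<Longrightarrow> k \<ge> N1 \<Longrightarrow> \<bar>u (r m) (p n) - u (r k) (p n)\<bar> < e / 4"
        unfolding Cauchy_def dist_real_def using e by (metis divide_pos_pos zero_less_numeral)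
      show "\<exists>M. \<forall>m\<ge>M. \<forall>k\<ge>M. \<bar>u (r m) z - u (r k) z\<bar> < e"
      proof (intro exI[of _ "max N0 N1"] allI impI)
        fix m k assume mk: "m \<ge> max N0 N1" "k \<ge> max N0 N1"
        have "\<bar>u (r m) z - u (r m) (p n)\<bar> \<le> e / 4" "\<bar>u (r k) z - u (r k) (p n)\<bar> \<le> e / 4"
          using mk seq_suble[OF r, of m] seq_suble[OF r, of k] by (intro d(2) n; simp)+
        moreover have "\<bar>u (r m) (p n) - u (r k) (p n)\<bar> < e / 4" using N1 mk by simp
        ultimately show "\<bar>u (r m) z - u (r k) z\<bar> < e" using e by linarith
      qed
    qed
    thus ?thesis by (simp add: Cauchy_convergent_iff)
  qed
  then obtain U where U: "\<And>z. (\<lambda>N. u (r N) z) \<longlonglongrightarrow> U z" unfolding convergent_def by metis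
  have "continuous_on UNIV U"
    unfolding continuous_on_iff dist_real_def
  proof (intro ballI allI impI)
    fix z :: 'a and e :: real assume e: "e > 0"
    obtain d N0 where d: "d > 0" "\<And>N z'. N \<ge> N0 \<Longrightarrow> dist z z' < d \<Longrightarrow> \<bar>u N z - u N z'\<bar> \<le> e / 2"
      using equi[of "e / 2" z] e by auto
    have "\<bar>U z - U z'\<bar> \<le> e / 2" if "dist z z' < d" for z'
    proof (rule LIMSEQ_le_const2)
      show "(\<lambda>N. \<bar>u (r N) z - u (r N) z'\<bar>) \<longlonglongrightarrow> \<bar>U z - U z'\<bar>" by (intro tendsto_intros U)
      show "\<exists>N. \<forall>n\<ge>N. \<bar>u (r n) z - u (r n) z'\<bar> \<le> e / 2"
        using d(2)[OF _ that] seq_suble[OF r] le_trans by blast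
    qed
    thus "\<exists>d>0. \<forall>z'\<in>UNIV. dist z' z < d \<longrightarrow> \<bar>U z' - U z\<bar> < e"
      using d(1) e by (force simp: dist_commute abs_minus_commute)
  qed
  thus thesis using that[OF r U] by blast
qed

section \<open>Time steps, Riemann sums and continuous versions\<close>

lemma floor_steps_diff:
  assumes "h > 0"
  shows "\<bar>real (nat \<lfloor>t / h\<rfloor>) - real (nat \<lfloor>t' / h\<rfloor>)\<bar> * h \<le> \<bar>t - t'\<bar> + h"
proof -
  have "\<bar>real (nat \<lfloor>a\<rfloor>) - real (nat \<lfloor>b\<rfloor>)\<bar> \<le> \<bar>a - b\<bar> + 1" for a b :: real
    by (cases "\<lfloor>a\<rfloor> \<ge> 0"; cases "\<lfloor>b\<rfloor> \<ge> 0"; simp add: not_le; linarith)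
  from mult_right_mono[OF this[of "t / h" "t' / h"], of h]
  have "\<bar>real (nat \<lfloor>t / h\<rfloor>) - real (nat \<lfloor>t' / h\<rfloor>)\<bar> * h \<le> (\<bar>t / h - t' / h\<bar> + 1) * h" using assms by simp
  also have "\<dots> = \<bar>t - t'\<bar> + h"
  proof -
    have "\<bar>t / h - t' / h\<bar> = \<bar>t - t'\<bar> / h" using assms by (simp add: diff_divide_distrib[symmetric])
    thus ?thesis using assms by (simp add: field_simps)
  qed
  finally show ?thesis .
qed

lemma floor_steps_bounds:
  assumes "h > 0" "t \<ge> 0"
  shows "real (nat \<lfloor>t / h\<rfloor>) * h \<le> t" "t < (real (nat \<lfloor>t / h\<rfloor>) + 1) * h"
proof -
  have "t / h \<ge> 0" using assms by simp
  hence "real (nat \<lfloor>t / h\<rfloor>) \<le> t / h" "t / h < real (nat \<lfloor>t / h\<rfloor>) + 1" by linarith+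
  thus "real (nat \<lfloor>t / h\<rfloor>) * h \<le> t" "t < (real (nat \<lfloor>t / h\<rfloor>) + 1) * h"
    using assms by (simp_all only: pos_le_divide_eq pos_divide_less_eq)
qed

text \<open>For a function constant on the steps the Riemann sum is exact, except for the last
  incomplete step, which accounts for \<open>h * B\<close>.\<close>

lemma step_function_integral:
  fixes c :: "nat \<Rightarrow> real"
  assumes h: "h > 0" and c: "\<And>k. \<bar>c k\<bar> \<le> B" and t: "t \<ge> 0"
  shows "\<bar>(\<integral>s\<in>{0..t}. c (nat \<lfloor>s / h\<rfloor>) \<partial>lborel) - h * (\<Sum>k<nat \<lfloor>t / h\<rfloor>. c k)\<bar> \<le> h * B"
proof -
  let ?g = "\<lambda>s. c (nat \<lfloor>s / h\<rfloor>)"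
  have [measurable]: "?g \<in> borel_measurable borel" by measurable
  have int: "set_integrable lborel {x..<y} ?g" "set_integrable lborel {x..y} ?g" for x y
    unfolding set_integrable_def
    by (rule integrableI_bounded_set_indicator[where B = B]; use c in \<open>auto intro!: emeasure_bounded_finite[unfolded infinity_ennreal_def]\<close>)+
  have sum: "(\<integral>s\<in>{0..<real m * h}. ?g s \<partial>lborel) = h * (\<Sum>k<m. c k)" for m
  proof (induction m)
    case 0
    show ?case by (simp add: set_lebesgue_integral_def)
  next
    case (Suc m)
    have un: "{0..<real (Suc m) * h} = {0..<real m * h} \<union> {real m * h..<real (Suc m) * h}"
      using h by (intro ivl_disj_un_two(3)[symmetric] mult_nonneg_nonneg mult_right_mono) auto
    have "(\<integral>s\<in>{real m * h..<real (Suc m) * h}. ?g s \<partial>lborel) = (\<integral>s\<in>{real m * h..<real (Suc m) * h}. c m \<partial>lborel)"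
    proof (rule set_lebesgue_integral_cong)
      show "\<forall>s. s \<in> {real m * h..<real (Suc m) * h} \<longrightarrow> ?g s = c m"
      proof (intro allI impI)
        fix s assume "s \<in> {real m * h..<real (Suc m) * h}"
        hence "real m \<le> s / h" "s / h < real m + 1" using h by (auto simp: field_simps)
        hence "\<lfloor>s / h\<rfloor> = int m" by linarith
        thus "?g s = c m" by simp
      qed
    qed simp
    also have "\<dots> = h * c m"
      using h by (simp add: set_lebesgue_integral_def measure_lborel_Ico algebra_simps)
    finally show ?case
      unfolding un by (subst set_integral_Un) (auto intro!: int simp: Suc distrib_left)
  qed
  let ?m = "nat \<lfloor>t / h\<rfloor>"
  note m = floor_steps_bounds[OF h t]
  have un: "{0..t} = {0..<real ?m * h} \<union> {real ?m * h..t}" using m h by (intro ivl_disj_un_two(7)[symmetric] mult_nonneg_nonneg) auto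
  have "(\<integral>s\<in>{0..t}. ?g s \<partial>lborel) = h * (\<Sum>k<?m. c k) + (\<integral>s\<in>{real ?m * h..t}. ?g s \<partial>lborel)"
    unfolding un by (subst set_integral_Un) (auto intro!: int simp: sum)
  moreover have "\<bar>\<integral>s\<in>{real ?m * h..t}. ?g s \<partial>lborel\<bar> \<le> h * B"
  proof -
    have B: "B \<ge> 0" using c[of 0] by simp
    have "\<bar>\<integral>s\<in>{real ?m * h..t}. ?g s \<partial>lborel\<bar> \<le> (\<integral>s\<in>{real ?m * h..t}. B \<partial>lborel)"
      unfolding set_lebesgue_integral_def
    proof (rule order_trans[OF integral_abs_bound], rule integral_mono)
      show "integrable lborel (\<lambda>s. \<bar>indicat_real {real ?m * h..t} s *\<^sub>R ?g s\<bar>)"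
        using int(2) by (intro integrable_abs) (simp add: set_integrable_def)
      show "integrable lborel (\<lambda>s. indicat_real {real ?m * h..t} s *\<^sub>R B)"
        by (auto simp: emeasure_lborel_Icc_eq)
    qed (use c in \<open>auto simp: indicator_def\<close>)
    also have "\<dots> = (t - real ?m * h) * B" using m by (simp add: set_lebesgue_integral_def)
    also have "\<dots> \<le> h * B" using m B by (intro mult_right_mono) (auto simp: algebra_simps)
    finally show ?thesis .
  qed
  ultimately show ?thesis by simp
qed

lemma continuous_AE_eq:
  fixes f g :: "'a::euclidean_space \<Rightarrow> real"
  assumes "continuous_on UNIV f" "continuous_on UNIV g" "AE x in lborel. f x = g x"
  shows "f = g"
proof (rule ccontr)
  assume "f \<noteq> g"
  let ?S = "{x. f x \<noteq> g x}"
  have S: "open ?S" using assms(1,2) by (intro open_Collect_neq)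
  hence "emeasure lborel ?S = 0"
    using assms(3) by (subst (asm) AE_iff_measurable[of ?S]) auto
  hence "?S \<in> null_sets lborel" using S by (intro null_setsI) auto
  hence "negligible ?S" by (simp add: negligible_iff_null_sets null_sets_completionI)
  thus False using open_not_negligible[OF S] \<open>f \<noteq> g\<close> by auto
qed

section \<open>Regularity of the walk in space and time\<close>

context euler_scheme
begin

lemma K_differentiable:
  assumes "\<And>x. g differentiable (at x)"
  shows "K h g differentiable (at x)"
proof -
  have "((\<lambda>x. x + h *\<^sub>R b x) has_derivative (\<lambda>e. e + h *\<^sub>R dd b e x)) (at x)"
    by (auto intro!: derivative_eq_intros dd_works b_diff)
  from has_derivative_compose[OF this dd_works[OF smear_differentiable[OF assms]]]
  show ?thesis unfolding K_eq_smear[abs_def] by (rule differentiableI)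
qed

lemma K_iter_differentiable:
  assumes "\<And>x. g differentiable (at x)"
  shows "(K h ^^ m) g differentiable (at x)"
  by (induction m arbitrary: x) (auto intro: K_differentiable assms)

lemma sqrt_q_bounds: "norm x \<le> sqrt (q x) / sqrt l\<^sub>1" "sqrt (q x) \<le> sqrt l\<^sub>2 * norm x"
proof -
  have "sqrt (l\<^sub>1 * (norm x)\<^sup>2) \<le> sqrt (q x)" "sqrt (q x) \<le> sqrt (l\<^sub>2 * (norm x)\<^sup>2)"
    using q_lower q_upper by (intro real_sqrt_le_mono; simp)+
  thus "norm x \<le> sqrt (q x) / sqrt l\<^sub>1" "sqrt (q x) \<le> sqrt l\<^sub>2 * norm x"
    using l1_pos by (simp_all add: real_sqrt_mult field_simps)
qed

lemma lipschitz_imp_q: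
  assumes "C-lipschitz_on UNIV g"
  shows "\<bar>g x - g y\<bar> \<le> (C / sqrt l\<^sub>1) * sqrt (q (x - y))"
  using lipschitz_norm_diff_le[OF assms, of x y] mult_left_mono[OF sqrt_q_bounds(1)[of "x - y"] lipschitz_on_nonneg[OF assms]]
  by simp

text \<open>The price of passing from the Euclidean norm to that of \<open>q\<close> and back. It is
  paid once, not at each step, so Lipschitz constants stay bounded along the walk.\<close>

definition lip_factor :: real where "lip_factor = sqrt l\<^sub>2 / sqrt l\<^sub>1"

lemma lip_factor_pos: "lip_factor > 0" using l1_pos l2_pos by (simp add: lip_factor_def)

lemma K_iter_lipschitz_decay:
  assumes h: "0 < h" "h \<le> h\<^sub>0" and g: "C-lipschitz_on UNIV g"
  shows "\<bar>(K h ^^ m) g x - (K h ^^ m) g y\<bar> \<le> C * lip_factor * sqrt (1 - \<kappa> * h) ^ m * norm (x - y)"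
proof -
  have C: "C \<ge> 0" using g lipschitz_on_nonneg by blast
  have r: "1 - \<kappa> * h \<ge> 0" using kappa_h[OF h] by simp
  have "\<bar>(K h ^^ m) g x - (K h ^^ m) g y\<bar> \<le> (C / sqrt l\<^sub>1) * sqrt (1 - \<kappa> * h) ^ m * sqrt (q (x - y))"
    using C l1_pos by (intro K_iter_lipschitz h lipschitz_imp_q g) auto
  also have "\<dots> \<le> (C / sqrt l\<^sub>1) * sqrt (1 - \<kappa> * h) ^ m * (sqrt l\<^sub>2 * norm (x - y))"
    using C r l1_pos by (intro mult_left_mono sqrt_q_bounds mult_nonneg_nonneg) auto
  finally show ?thesis by (simp add: lip_factor_def mult_ac)
qed

lemma K_iter_lipschitz_on:
  assumes h: "0 < h" "h \<le> h\<^sub>0" and g: "C-lipschitz_on UNIV g"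
  shows "(C * lip_factor)-lipschitz_on UNIV ((K h ^^ m) g)"
proof (rule lipschitz_onI)
  have C: "C \<ge> 0" using g lipschitz_on_nonneg by blast
  show "C * lip_factor \<ge> 0" using C lip_factor_pos by simp
  have r: "0 \<le> 1 - \<kappa> * h" "1 - \<kappa> * h \<le> 1" using kappa_h[OF h] h kappa_pos by auto
  hence p: "sqrt (1 - \<kappa> * h) ^ m \<le> 1" by (intro power_le_one) auto
  show "dist ((K h ^^ m) g x) ((K h ^^ m) g y) \<le> C * lip_factor * dist x y" for x y
    using order_trans[OF K_iter_lipschitz_decay[OF h g, of m x y]
      mult_right_mono[OF mult_left_mono[OF p, of "C * lip_factor"], of "norm (x - y)"]] C lip_factor_pos
    by (simp add: dist_norm)
qed

text \<open>The later time is read as \<open>k\<close> further steps started at \<open>x\<close> and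
  followed by the function \<open>K h ^^ m\<close> of \<open>g\<close>, which keeps its Lipschitz
  bound. By Jensen the mean displacement over \<open>k\<close> steps is of order
  \<open>sqrt (k * h)\<close>, so continuity in time is obtained without applying the generator to
  \<open>g\<close>.\<close>

lemma K_iter_time_increment:
  assumes h: "0 < h" "h \<le> h\<^sub>0" and g: "C-lipschitz_on UNIV g"
  shows "\<bar>(K h ^^ (m + k)) g x - (K h ^^ m) g x\<bar> \<le> C / sqrt l\<^sub>1 * sqrt (k * h * d\<^sub>m x)"
proof -
  let ?G = "(K h ^^ m) g" and ?c = "C / sqrt l\<^sub>1"
  have C: "?c \<ge> 0" using lipschitz_on_nonneg[OF g] l1_pos by simp
  have r: "0 \<le> 1 - \<kappa> * h" "1 - \<kappa> * h \<le> 1" using kappa_h[OF h] h kappa_pos by auto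
  have G: "\<bar>?G y - ?G x\<bar> \<le> ?c * sqrt (q (y - x))" for y
  proof -
    have "\<bar>?G y - ?G x\<bar> \<le> ?c * sqrt (1 - \<kappa> * h) ^ m * sqrt (q (y - x))"
      by (intro K_iter_lipschitz h lipschitz_imp_q g C)
    also have "\<dots> \<le> ?c * 1 * sqrt (q (y - x))"
      using r C q_nonneg by (intro mult_right_mono mult_left_mono power_le_one) auto
    finally show ?thesis by simp
  qed
  have up: "(K h ^^ k) ?G x \<le> (K h ^^ k) (\<lambda>y. ?G x + ?c * sqrt (q (y - x))) x"
    using G by (intro avg_iter_mono[OF J]) (smt (verit))
  have lo: "(K h ^^ k) (\<lambda>y. ?G x + (- ?c) * sqrt (q (y - x))) x \<le> (K h ^^ k) ?G x"
    using G by (intro avg_iter_mono[OF J]) (smt (verit) minus_mult_left)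
  let ?s = "(K h ^^ k) (\<lambda>y. sqrt (q (y - x))) x"
  have "?s\<^sup>2 \<le> (K h ^^ k) (\<lambda>y. (sqrt (q (y - x)))\<^sup>2) x" by (rule avg_iter_square_le[OF J])
  also have "\<dots> = (K h ^^ k) (\<lambda>y. q (y - x)) x" by (simp add: q_nonneg)
  also have "\<dots> \<le> q (x - x) + k * h * d\<^sub>m x" by (rule K_iter_moment_linear[OF h])
  also have "q (x - x) = 0" by (simp add: q_def)
  finally have "?s \<le> sqrt (k * h * d\<^sub>m x)" by (intro real_le_rsqrt) simp
  hence s: "?c * ?s \<le> ?c * sqrt (k * h * d\<^sub>m x)" by (rule mult_left_mono[OF _ C])
  have "(K h ^^ (m + k)) g x = (K h ^^ k) ?G x" by (simp add: funpow_add[of k m] add.commute[of m])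
  moreover have "(K h ^^ k) (\<lambda>y. ?G x + c * sqrt (q (y - x))) x = ?G x + c * ?s" for c
    by (simp only: avg_iter_add[OF J] avg_iter_cmult[OF J] avg_iter_const[OF J])
  ultimately show ?thesis using up lo s by (simp only: abs_le_iff) linarith
qed

text \<open>Constant in time on each step. For negative \<open>t\<close> the value is
  \<open>f x\<close>, as \<open>nat\<close> of a negative integer is 0; the compactness argument can
  thus run over the whole time line.\<close>

definition eflow :: "nat \<Rightarrow> (real ^ 'n \<Rightarrow> real) \<Rightarrow> real \<Rightarrow> real ^ 'n \<Rightarrow> real" where
  "eflow N f t x = (K (hs N) ^^ nat \<lfloor>t / hs N\<rfloor>) f x"

lemma eventually_hs: "\<exists>N\<^sub>1. \<forall>N\<ge>N\<^sub>1. hs N \<le> h\<^sub>0"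
proof -
  have "\<forall>\<^sub>F N in sequentially. hs N < h\<^sub>0" using order_tendstoD(2)[OF hs(3) h0_pos] .
  thus ?thesis unfolding eventually_sequentially by (meson less_imp_le)
qed

lemma eflow_bound: "(\<And>x. \<bar>f x\<bar> \<le> B) \<Longrightarrow> \<bar>eflow N f t x\<bar> \<le> B"
  unfolding eflow_def by (rule avg_iter_abs_le[OF J])

text \<open>The summand \<open>hs N\<close> accounts for the jumps: arbitrarily close times may fall
  into neighbouring steps.\<close>

lemma eflow_time:
  assumes h: "hs N \<le> h\<^sub>0" and g: "C-lipschitz_on UNIV g"
  shows "\<bar>eflow N g t x - eflow N g t' x\<bar> \<le> C / sqrt l\<^sub>1 * sqrt ((\<bar>t - t'\<bar> + hs N) * d\<^sub>m x)"
proof -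
  have C: "C / sqrt l\<^sub>1 \<ge> 0" using lipschitz_on_nonneg[OF g] l1_pos by simp
  have *: "\<bar>(K (hs N) ^^ n) g x - (K (hs N) ^^ m) g x\<bar> \<le> C / sqrt l\<^sub>1 * sqrt (z * d\<^sub>m x)"
    if "m \<le> n" "\<bar>real n - real m\<bar> * hs N \<le> z" for m n z
  proof -
    have "\<bar>(K (hs N) ^^ (m + (n - m))) g x - (K (hs N) ^^ m) g x\<bar> \<le> C / sqrt l\<^sub>1 * sqrt (real (n - m) * hs N * d\<^sub>m x)"
      by (rule K_iter_time_increment[OF hs(1) h g])
    also have "\<dots> \<le> C / sqrt l\<^sub>1 * sqrt (z * d\<^sub>m x)"
      using that dm_nonneg[of x] by (intro mult_left_mono[OF _ C] real_sqrt_le_mono mult_right_mono) (auto simp: of_nat_diff)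
    finally show ?thesis using that by simp
  qed
  note fl = floor_steps_diff[OF hs(1)[of N], of t t']
  show ?thesis
    unfolding eflow_def
    using *[OF _ fl] *[of "nat \<lfloor>t / hs N\<rfloor>" "nat \<lfloor>t' / hs N\<rfloor>", OF _ ] fl
    by (cases "nat \<lfloor>t / hs N\<rfloor> \<le> nat \<lfloor>t' / hs N\<rfloor>") (auto simp: abs_minus_commute)
qed

lemma eflow_equicontinuous:
  assumes g: "C-lipschitz_on UNIV g" and e: "e > 0"
  shows "\<exists>d>0. \<exists>N\<^sub>0. \<forall>N\<ge>N\<^sub>0. \<forall>z'. dist (t, x) z' < d \<longrightarrow> \<bar>eflow N g t x - eflow N g (fst z') (snd z')\<bar> \<le> e"
proof -
  have C: "C \<ge> 0" using g lipschitz_on_nonneg by blast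
  define c where "c = C / sqrt l\<^sub>1 * sqrt (d\<^sub>m x)"
  have c: "c \<ge> 0" unfolding c_def using C l1_pos dm_nonneg[of x] by auto
  \<comment> \<open>Half of \<open>e\<close> is for space and half for time. In time
    \<open>\<bar>t - t'\<bar> + hs N\<close> stays below \<open>2 * d\<close>, hence the final
    division by 2; the summands 1 prevent zero denominators.\<close>
  define d where "d = min (e / (2 * (C * lip_factor + 1))) ((e / (2 * (c + 1)))\<^sup>2 / 2)"
  have Cl: "C * lip_factor + 1 > 0" using C lip_factor_pos by (intro add_nonneg_pos mult_nonneg_nonneg) auto
  have d: "d > 0" using e Cl c by (simp add: d_def)
  obtain N1 where N1: "\<And>N. N \<ge> N1 \<Longrightarrow> hs N \<le> h\<^sub>0" using eventually_hs by blast
  have "\<forall>\<^sub>F N in sequentially. hs N < d" using order_tendstoD(2)[OF hs(3) d] .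
  then obtain N2 where N2: "\<And>N. N \<ge> N2 \<Longrightarrow> hs N < d" unfolding eventually_sequentially by blast
  show ?thesis
  proof (intro exI[of _ d] conjI d exI[of _ "max N1 N2"] allI impI)
    fix N z' assume N: "N \<ge> max N1 N2" and z: "dist (t, x) z' < d"
    obtain t' x' where z': "z' = (t', x')" by (cases z')
    have tt: "\<bar>t - t'\<bar> < d" "norm (x - x') < d"
      using order_le_less_trans[OF dist_fst_le z] order_le_less_trans[OF dist_snd_le z]
      by (auto simp: z' dist_norm)
    have hN: "hs N \<le> h\<^sub>0" "hs N < d" using N N1 N2 by auto
    have "\<bar>eflow N g t x - eflow N g t' x\<bar> \<le> c * sqrt (\<bar>t - t'\<bar> + hs N)"
      using eflow_time[OF hN(1) g, of t x t'] by (simp add: c_def real_sqrt_mult mult_ac)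
    also have "\<dots> \<le> c * sqrt ((e / (2 * (c + 1)))\<^sup>2)"
      using tt hN(2) c unfolding d_def by (intro mult_left_mono real_sqrt_le_mono) auto
    also have "\<dots> = c / (c + 1) * (e / 2)" using e c by simp
    also have "\<dots> \<le> 1 * (e / 2)" using e c by (intro mult_right_mono) auto
    finally have 1: "\<bar>eflow N g t x - eflow N g t' x\<bar> \<le> e / 2" by simp
    have "\<bar>eflow N g t' x - eflow N g t' x'\<bar> \<le> C * lip_factor * norm (x - x')"
      unfolding eflow_def
      using lipschitz_norm_diff_le[OF K_iter_lipschitz_on[OF hs(1) hN(1) g], where x = x and y = x'] by simp
    also have "\<dots> \<le> (C * lip_factor + 1) * (e / (2 * (C * lip_factor + 1)))"
      using tt C lip_factor_pos unfolding d_def by (intro mult_mono) auto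
    also have "\<dots> = e / 2"
    proof -
      have "z * (e / (2 * z)) = e / 2" if "z > 0" for z using that by simp
      thus ?thesis using Cl by blast
    qed
    finally have 2: "\<bar>eflow N g t' x - eflow N g t' x'\<bar> \<le> e / 2" .
    show "\<bar>eflow N g t x - eflow N g (fst z') (snd z')\<bar> \<le> e"
      unfolding z' fst_conv snd_conv using 1 2 by linarith
  qed
qed

text \<open>One-step consistency, telescoped. All iterates obey the bounds \<open>B\<close> and
  \<open>C * lip_factor\<close>, so the step errors add up to \<open>m * h \<le> t\<close> times a
  common rate; the summand 1 in \<open>1 + t\<close> covers the incomplete step of the Riemann
  sum.\<close>

lemma eflow_weak_equation:
  assumes \<phi>: "\<phi> \<in> test_functions UNIV"
    and fB: "\<And>x. \<bar>f x\<bar> \<le> B" and fC: "C-lipschitz_on UNIV f" and fd: "\<And>x. f differentiable (at x)"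
  obtains e where "e \<longlonglongrightarrow> 0" "\<And>N t. hs N \<le> h\<^sub>0 \<Longrightarrow> t \<ge> 0 \<Longrightarrow>
    \<bar>(\<integral>x. eflow N f t x * \<phi> x \<partial>lborel) - (\<integral>x. f x * \<phi> x \<partial>lborel)
      - (\<integral>s\<in>{0..t}. (\<integral>x. eflow N f s x * adjoint_gen \<phi> x \<partial>lborel) \<partial>lborel)\<bar> \<le> (1 + t) * e N"
proof -
  obtain e1 where e1: "e1 \<longlonglongrightarrow> 0" "\<And>N. e1 N \<ge> 0"
    "\<And>N g B C. (\<And>x. \<bar>g x\<bar> \<le> B) \<Longrightarrow> C-lipschitz_on UNIV g \<Longrightarrow> (\<And>x. g differentiable (at x)) \<Longrightarrow>
      \<bar>(\<integral>x. K (hs N) g x * \<phi> x \<partial>lborel) - (\<integral>x. g x * \<phi> x \<partial>lborel)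
        - hs N * (\<integral>x. g x * adjoint_gen \<phi> x \<partial>lborel)\<bar> \<le> hs N * ((B + C) * e1 N)"
    using K_adjoint_consistency[OF \<phi>] by blast
  have B: "B \<ge> 0" using fB[of 0] by simp
  have C: "C \<ge> 0" using fC lipschitz_on_nonneg by blast
  define I where "I = (\<integral>x. \<bar>adjoint_gen \<phi> x\<bar> \<partial>lborel)"
  have I: "I \<ge> 0" unfolding I_def by (intro Bochner_Integration.integral_nonneg) auto
  have ia: "integrable lborel (\<lambda>x. \<bar>adjoint_gen \<phi> x\<bar>)"
    using adjoint_gen_integrable(3)[OF \<phi>, of "\<lambda>_. 1" 1] by (simp add: integrable_abs)
  define D where "D = B + C * lip_factor"
  have D: "D \<ge> 0" using B C lip_factor_pos by (simp add: D_def)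
  define e where "e N = D * e1 N + hs N * (B * I)" for N
  show thesis
  proof (rule that[of e])
    have "e \<longlonglongrightarrow> D * 0 + 0 * (B * I)" unfolding e_def[abs_def] by (intro tendsto_intros e1 hs(3))
    thus "e \<longlonglongrightarrow> 0" by simp
    fix N t assume hN: "hs N \<le> h\<^sub>0" and t: "(t :: real) \<ge> 0"
    define h where "h = hs N"
    have h: "0 < h" "h \<le> h\<^sub>0" using hs hN by (auto simp: h_def)
    note G = avg_iter_abs_le[OF J fB, where F = "F h"] K_iter_lipschitz_on[OF h fC] K_iter_differentiable[OF fd, where h = h]
    define c where "c k = (\<integral>x. (K h ^^ k) f x * adjoint_gen \<phi> x \<partial>lborel)" for k
    have c: "\<bar>c k\<bar> \<le> B * I" for k
    proof -
      have "\<bar>c k\<bar> \<le> (\<integral>x. B * \<bar>adjoint_gen \<phi> x\<bar> \<partial>lborel)"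
        unfolding c_def
      proof (rule order_trans[OF integral_abs_bound], rule integral_mono)
        show "integrable lborel (\<lambda>x. \<bar>(K h ^^ k) f x * adjoint_gen \<phi> x\<bar>)"
          by (intro integrable_abs adjoint_gen_integrable(3)[OF \<phi> _ G(1)] differentiable_imp_measurable G(3))
        show "integrable lborel (\<lambda>x. B * \<bar>adjoint_gen \<phi> x\<bar>)" using ia by (rule integrable_mult_right)
        show "\<bar>(K h ^^ k) f x * adjoint_gen \<phi> x\<bar> \<le> B * \<bar>adjoint_gen \<phi> x\<bar>" for x
          using mult_right_mono[OF G(1)[where m = k and x = x], of "\<bar>adjoint_gen \<phi> x\<bar>"] by (simp add: abs_mult)
      qed
      thus ?thesis by (simp add: I_def)
    qed
    have tele: "\<bar>(\<integral>x. (K h ^^ m) f x * \<phi> x \<partial>lborel) - (\<integral>x. f x * \<phi> x \<partial>lborel) - h * (\<Sum>k<m. c k)\<bar>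
        \<le> m * (h * (D * e1 N))" for m
    proof (induction m)
      case (Suc m)
      have "\<bar>(\<integral>x. K h ((K h ^^ m) f) x * \<phi> x \<partial>lborel) - (\<integral>x. (K h ^^ m) f x * \<phi> x \<partial>lborel) - h * c m\<bar>
          \<le> h * ((B + C * lip_factor) * e1 N)"
        unfolding c_def h_def by (rule e1(3)) (use G in \<open>auto simp: h_def\<close>)
      hence 1: "\<bar>(\<integral>x. (K h ^^ Suc m) f x * \<phi> x \<partial>lborel) - (\<integral>x. (K h ^^ m) f x * \<phi> x \<partial>lborel) - h * c m\<bar>
          \<le> h * (D * e1 N)" by (simp add: D_def)
      have 2: "h * (\<Sum>k<Suc m. c k) = h * (\<Sum>k<m. c k) + h * c m"
        "real (Suc m) * (h * (D * e1 N)) = real m * (h * (D * e1 N)) + h * (D * e1 N)" by (simp_all add: algebra_simps)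
      show ?case unfolding 2 using Suc 1 by linarith
    qed simp
    let ?m = "nat \<lfloor>t / h\<rfloor>"
    have "real ?m * (h * (D * e1 N)) \<le> t * (D * e1 N)"
      using mult_right_mono[OF floor_steps_bounds(1)[OF h(1) t], of "D * e1 N"] D e1(2)[of N] by (simp add: mult.assoc)
    moreover have "\<bar>(\<integral>s\<in>{0..t}. c (nat \<lfloor>s / h\<rfloor>) \<partial>lborel) - h * (\<Sum>k<?m. c k)\<bar> \<le> h * (B * I)"
      by (rule step_function_integral[OF h(1) c t])
    ultimately have "\<bar>(\<integral>x. (K h ^^ ?m) f x * \<phi> x \<partial>lborel) - (\<integral>x. f x * \<phi> x \<partial>lborel)
        - (\<integral>s\<in>{0..t}. c (nat \<lfloor>s / h\<rfloor>) \<partial>lborel)\<bar> \<le> t * (D * e1 N) + h * (B * I)"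
      using tele[of ?m] by linarith
    also have "\<dots> \<le> (1 + t) * e N"
    proof -
      have "0 \<le> D * e1 N" "0 \<le> t * (h * (B * I))" using D e1(2)[of N] t h B I by auto
      thus ?thesis by (simp add: e_def h_def algebra_simps)
    qed
    finally show "\<bar>(\<integral>x. eflow N f t x * \<phi> x \<partial>lborel) - (\<integral>x. f x * \<phi> x \<partial>lborel)
      - (\<integral>s\<in>{0..t}. (\<integral>x. eflow N f s x * adjoint_gen \<phi> x \<partial>lborel) \<partial>lborel)\<bar> \<le> (1 + t) * e N"
      by (simp add: eflow_def c_def h_def)
  qed
qed

end

section \<open>Bounded Lipschitz differentiable functions\<close>

text \<open>The functions for which the walk is shown to converge. The class contains test functions
  and their squared gradients, is closed under products, and is rich enough to determine a
  probability measure.\<close>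

definition nice :: "('a::real_normed_vector \<Rightarrow> real) \<Rightarrow> bool" where
  "nice f \<longleftrightarrow> bounded (range f) \<and> (\<exists>C. C-lipschitz_on UNIV f) \<and> (\<forall>x. f differentiable (at x))"

lemma niceE:
  assumes "nice f"
  obtains B C where "\<And>x. \<bar>f x\<bar> \<le> B" "C-lipschitz_on UNIV f" "\<And>x. f differentiable (at x)"
  using assms unfolding nice_def bounded_iff by auto

lemma niceI:
  "(\<And>x. \<bar>f x\<bar> \<le> B) \<Longrightarrow> C-lipschitz_on UNIV f \<Longrightarrow> (\<And>x. f differentiable (at x)) \<Longrightarrow> nice f"
  unfolding nice_def bounded_iff by auto

lemma nice_measurable:
  fixes f :: "'a::euclidean_space \<Rightarrow> real"
  shows "nice f \<Longrightarrow> f \<in> borel_measurable borel"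
  by (auto simp: nice_def intro: differentiable_imp_measurable)

lemma nice_continuous:
  assumes "nice f" shows "continuous_on A f"
proof -
  have "f differentiable (at x)" for x using assms by (auto simp: nice_def)
  thus ?thesis by (intro continuous_at_imp_continuous_on ballI differentiable_imp_continuous_within)
qed

lemma nice_bounded_borel:
  fixes f :: "'a::euclidean_space \<Rightarrow> real"
  shows "nice f \<Longrightarrow> f \<in> bounded_borel"
  by (simp add: bounded_borel_def nice_measurable) (simp add: nice_def)

lemma nice_const: "nice (\<lambda>_. c)"
  by (rule niceI[where B = "\<bar>c\<bar>" and C = 0]) (auto intro: lipschitz_intros)

lemma nice_mult:
  assumes "nice f" "nice g"
  shows "nice (\<lambda>x. f x * g x)"
proof -
  obtain B C where f: "\<And>x. \<bar>f x\<bar> \<le> B" "C-lipschitz_on UNIV f" "\<And>x. f differentiable (at x)" using niceE[OF assms(1)] by blast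
  obtain B' C' where g: "\<And>x. \<bar>g x\<bar> \<le> B'" "C'-lipschitz_on UNIV g" "\<And>x. g differentiable (at x)" using niceE[OF assms(2)] by blast
  have nn: "B \<ge> 0" "B' \<ge> 0" "C \<ge> 0" "C' \<ge> 0"
    using f(1)[of 0] g(1)[of 0] lipschitz_on_nonneg[OF f(2)] lipschitz_on_nonneg[OF g(2)] by auto
  show ?thesis
  proof (rule niceI[where B = "B * B'" and C = "B * C' + C * B'"])
    show "\<bar>f x * g x\<bar> \<le> B * B'" for x unfolding abs_mult using f(1) g(1) nn by (intro mult_mono) auto
    show "(B * C' + C * B')-lipschitz_on UNIV (\<lambda>x. f x * g x)"
    proof (rule lipschitz_onI)
      fix x y
      have "f x * g x - f y * g y = f x * (g x - g y) + (f x - f y) * g y" by (simp add: algebra_simps)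
      hence "\<bar>f x * g x - f y * g y\<bar> \<le> \<bar>f x\<bar> * \<bar>g x - g y\<bar> + \<bar>f x - f y\<bar> * \<bar>g y\<bar>"
        using abs_triangle_ineq by (simp add: abs_mult[symmetric])
      also have "\<dots> \<le> B * (C' * norm (x - y)) + (C * norm (x - y)) * B'"
        using f(1)[of x] g(1)[of y] lipschitz_norm_diff_le[OF f(2), of x y] lipschitz_norm_diff_le[OF g(2), of x y] nn
        by (intro add_mono mult_mono) auto
      finally show "dist (f x * g x) (f y * g y) \<le> (B * C' + C * B') * dist x y" by (simp add: dist_norm algebra_simps)
    qed (use nn in simp)
    show "(\<lambda>x. f x * g x) differentiable (at x)" for x using f(3) g(3) by (intro differentiable_mult)
  qed
qed

lemma nice_add:
  assumes "nice f" "nice g"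
  shows "nice (\<lambda>x. f x + g x)"
proof -
  obtain B C where f: "\<And>x. \<bar>f x\<bar> \<le> B" "C-lipschitz_on UNIV f" "\<And>x. f differentiable (at x)" using niceE[OF assms(1)] by blast
  obtain B' C' where g: "\<And>x. \<bar>g x\<bar> \<le> B'" "C'-lipschitz_on UNIV g" "\<And>x. g differentiable (at x)" using niceE[OF assms(2)] by blast
  show ?thesis
    by (rule niceI[where B = "B + B'" and C = "C + C'"])
      (auto intro!: lipschitz_on_add f g order_trans[OF abs_triangle_ineq] add_mono differentiable_add)
qed

lemma nice_sum: "finite I \<Longrightarrow> (\<And>i. i \<in> I \<Longrightarrow> nice (f i)) \<Longrightarrow> nice (\<lambda>x. \<Sum>i\<in>I. f i x)"
  by (induction I rule: finite_induct) (auto intro: nice_const nice_add)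

lemma nice_prod: "finite I \<Longrightarrow> (\<And>i. i \<in> I \<Longrightarrow> nice (f i)) \<Longrightarrow> nice (\<lambda>x. \<Prod>i\<in>I. f i x)"
  by (induction I rule: finite_induct) (auto intro: nice_const nice_mult)

lemma test_function_nice:
  assumes "\<phi> \<in> test_functions UNIV" shows "nice \<phi>"
proof -
  obtain R where R: "bump R \<phi>" using test_functions_bump[OF assms] by blast
  obtain B where "\<And>x. \<bar>\<phi> x\<bar> \<le> B" using bump_bounded[OF R] by blast
  thus ?thesis using bumpD(1,2)[OF R] by (auto intro: niceI)
qed

lemma power2_eq_mult_fun: "(\<lambda>x. (f x)\<^sup>2) = (\<lambda>x. f x * f x :: real)" by (simp add: power2_eq_square)

lemma test_function_gradient_nice:
  fixes \<phi> :: "real ^ 'n::finite \<Rightarrow> real"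
  assumes "\<phi> \<in> test_functions UNIV"
  shows "nice (\<lambda>x. (norm (gradient \<phi> x))\<^sup>2)"
proof -
  have "(\<lambda>x. (norm (gradient \<phi> x))\<^sup>2) = (\<lambda>x. \<Sum>i\<in>UNIV. partial_deriv i \<phi> x * partial_deriv i \<phi> x)"
    by (simp add: gradient_def power2_norm_eq_inner inner_vec_def fun_eq_iff)
  thus ?thesis using test_function_nice[OF partial_deriv_test_function[OF assms]]
    by (auto intro!: nice_sum nice_mult)
qed

text \<open>A differentiable step that vanishes on the negative half-line and tends to 1 at
  infinity; squaring \<open>max 0 r\<close> removes the kink at 0. The functions
  \<open>1 - smooth_step (real k * r)\<close> converge to the indicator of
  \<open>r \<le> 0\<close>.\<close>

definition smooth_step :: "real \<Rightarrow> real" where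
  "smooth_step r = (max 0 r)\<^sup>2 / (1 + (max 0 r)\<^sup>2)"

lemma smooth_step_bounds: "0 \<le> smooth_step r" "smooth_step r \<le> 1"
proof -
  have "0 < 1 + (max 0 r)\<^sup>2" by (intro add_pos_nonneg) auto
  thus "0 \<le> smooth_step r" "smooth_step r \<le> 1" unfolding smooth_step_def by (auto simp: divide_le_eq)
qed

lemma DERIV_max_square: "((\<lambda>r :: real. (max 0 r)\<^sup>2) has_real_derivative 2 * max 0 r) (at r)"
proof -
  consider "r < 0" | "r > 0" | "r = 0" by linarith
  thus ?thesis
  proof cases
    case 1
    have "((\<lambda>r :: real. 0) has_real_derivative 0) (at r)" by simp
    thus ?thesis using 1
      by (rule_tac has_field_derivative_transform_within_open[where S = "{..<0}" and f = "\<lambda>_. 0"]) auto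
  next
    case 2
    have "((\<lambda>r :: real. r\<^sup>2) has_real_derivative 2 * r) (at r)" by (auto intro!: derivative_eq_intros)
    thus ?thesis using 2
      by (rule_tac has_field_derivative_transform_within_open[where S = "{0<..}" and f = "\<lambda>r. r\<^sup>2"]) auto
  next
    case 3
    have "((\<lambda>h. (max 0 h)\<^sup>2 / h) \<longlongrightarrow> 0) (at (0 :: real))"
    proof (rule Lim_null_comparison[where g = "\<lambda>h. \<bar>h\<bar>"])
      show "\<forall>\<^sub>F h in at 0. norm ((max 0 h)\<^sup>2 / h) \<le> \<bar>h :: real\<bar>"
        by (intro always_eventually) (auto simp: max_def power2_eq_square)
      show "((\<lambda>h. \<bar>h :: real\<bar>) \<longlongrightarrow> 0) (at 0)" by (intro tendsto_rabs_zero tendsto_ident_at)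
    qed
    thus ?thesis using 3 by (simp add: DERIV_def)
  qed
qed

lemma smooth_step_DERIV:
  "(smooth_step has_real_derivative 2 * max 0 r / (1 + (max 0 r)\<^sup>2)\<^sup>2) (at r)"
proof -
  have p: "1 + (max 0 r)\<^sup>2 \<noteq> 0" using add_pos_nonneg[of 1 "(max 0 r)\<^sup>2"] by simp
  have "((\<lambda>r. (max 0 r)\<^sup>2 / (1 + (max 0 r)\<^sup>2)) has_real_derivative
     ((2 * max 0 r) * (1 + (max 0 r)\<^sup>2) - (max 0 r)\<^sup>2 * (0 + 2 * max 0 r)) / ((1 + (max 0 r)\<^sup>2) * (1 + (max 0 r)\<^sup>2))) (at r)"
    by (intro DERIV_divide DERIV_add DERIV_const DERIV_max_square p)
  thus ?thesis unfolding smooth_step_def[abs_def] by (simp add: power2_eq_square algebra_simps)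
qed

lemma smooth_step_lipschitz: "1-lipschitz_on UNIV smooth_step"
proof (rule bounded_derivative_imp_lipschitz)
  show "(smooth_step has_derivative (*) (2 * max 0 r / (1 + (max 0 r)\<^sup>2)\<^sup>2)) (at r within UNIV)" for r
    using smooth_step_DERIV[of r] by (simp add: has_field_derivative_def)
  show "onorm ((*) (2 * max 0 r / (1 + (max 0 r)\<^sup>2)\<^sup>2)) \<le> 1" for r :: real
  proof -
    let ?m = "max 0 r"
    have m: "0 \<le> ?m" by simp
    have 1: "2 * ?m \<le> 1 + ?m\<^sup>2" using sum_squares_bound[of ?m 1] by simp
    have 2: "1 \<le> 1 + ?m\<^sup>2" by simp
    have "2 * ?m * 1 \<le> (1 + ?m\<^sup>2) * (1 + ?m\<^sup>2)" using 1 2 m by (intro mult_mono) auto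
    moreover have "(1 + ?m\<^sup>2)\<^sup>2 > 0" using 2 by (intro zero_less_power) linarith
    ultimately have "2 * ?m / (1 + ?m\<^sup>2)\<^sup>2 \<le> 1" by (simp add: divide_le_eq power2_eq_square)
    moreover have "0 \<le> 2 * ?m / (1 + ?m\<^sup>2)\<^sup>2" by simp
    ultimately show ?thesis
      by (intro onorm_le) (simp only: real_norm_def abs_mult mult_right_mono abs_of_nonneg abs_ge_zero)
  qed
qed auto

lemma nice_coordinate_step:
  fixes i :: "'n::finite"
  shows "nice (\<lambda>x :: real ^ 'n. 1 - smooth_step (real k * (x $ i - c)))"
proof (rule niceI[where B = 1 and C = "0 + 1 * (real k * 1)"])
  show "\<bar>1 - smooth_step (real k * (x $ i - c))\<bar> \<le> 1" for x :: "real ^ 'n" using smooth_step_bounds[of "real k * (x $ i - c)"] by simp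
  have l: "1-lipschitz_on UNIV (\<lambda>x :: real ^ 'n. x $ i)"
    by (rule lipschitz_onI) (auto simp: dist_vec_nth_le)
  have "(real k * 1)-lipschitz_on UNIV (\<lambda>x :: real ^ 'n. real k * (x $ i - c))"
  proof (rule lipschitz_onI)
    fix x y :: "real ^ 'n"
    have "dist (real k * (x $ i - c)) (real k * (y $ i - c)) = real k * dist (x $ i) (y $ i)"
      by (simp add: dist_real_def abs_mult right_diff_distrib[symmetric])
    thus "dist (real k * (x $ i - c)) (real k * (y $ i - c)) \<le> real k * 1 * dist x y"
      by (simp add: dist_vec_nth_le mult_left_mono)
  qed simp
  hence "(1 * (real k * 1))-lipschitz_on UNIV (\<lambda>x :: real ^ 'n. smooth_step (real k * (x $ i - c)))"
    by (rule lipschitz_on_compose2) (auto intro: lipschitz_on_subset[OF smooth_step_lipschitz])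
  thus "(0 + 1 * (real k * 1))-lipschitz_on UNIV (\<lambda>x :: real ^ 'n. 1 - smooth_step (real k * (x $ i - c)))"
    by (intro lipschitz_on_diff lipschitz_intros) auto
  show "(\<lambda>x :: real ^ 'n. 1 - smooth_step (real k * (x $ i - c))) differentiable (at x)" for x
  proof -
    have "smooth_step differentiable (at (real k * (x $ i - c)))"
      using smooth_step_DERIV real_differentiable_def by blast
    moreover have "(\<lambda>x :: real ^ 'n. real k * (x $ i - c)) differentiable (at x)"
      by (intro differentiable_mult differentiable_diff differentiable_const bounded_linear_imp_differentiable bounded_linear_vec_nth)
    ultimately have "(smooth_step \<circ> (\<lambda>x :: real ^ 'n. real k * (x $ i - c))) differentiable (at x)"
      by (intro differentiable_chain_at)
    thus ?thesis by (intro differentiable_diff differentiable_const) (simp add: o_def)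
  qed
qed

lemma smooth_step_limit: "(\<lambda>k. 1 - smooth_step (real k * r)) \<longlonglongrightarrow> (if r \<le> 0 then 1 else 0)"
proof (cases "r \<le> 0")
  case True
  have "1 - smooth_step (real k * r) = 1" for k
    using True mult_nonneg_nonpos[of "real k" r] by (simp add: smooth_step_def max_def)
  thus ?thesis using True by simp
next
  case False
  hence r: "r > 0" by simp
  have eq: "1 - smooth_step (real k * r) = inverse (1 + (real k * r)\<^sup>2)" for k
  proof -
    have "max 0 (real k * r) = real k * r" using r by simp
    moreover have "1 + (real k * r)\<^sup>2 \<noteq> 0" using add_pos_nonneg[of 1 "(real k * r)\<^sup>2"] by simp
    ultimately show ?thesis by (simp add: smooth_step_def field_simps)
  qed
  have "filterlim (\<lambda>k. real k * r) at_top sequentially"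
    by (rule filterlim_at_top_mult_tendsto_pos[OF tendsto_const r filterlim_real_sequentially])
  hence "filterlim (\<lambda>k. (real k * r)\<^sup>2) at_top sequentially" by (intro filterlim_pow_at_top) auto
  hence "filterlim (\<lambda>k. 1 + (real k * r)\<^sup>2) at_top sequentially"
    by (intro filterlim_tendsto_add_at_top[OF tendsto_const])
  hence "(\<lambda>k. inverse (1 + (real k * r)\<^sup>2)) \<longlonglongrightarrow> 0" by (rule tendsto_inverse_0_at_top)
  thus ?thesis using False by (simp add: eq)
qed

text \<open>Products of smoothed steps over the coordinates converge boundedly to the indicators of
  the orthants \<open>{..a}\<close>, which are stable under intersection and generate the Borel
  sets.\<close>

lemma prob_measure_eqI_nice:
  fixes N1 N2 :: "(real ^ 'n::finite) measure"
  assumes N: "N1 \<in> space (prob_algebra borel)" "N2 \<in> space (prob_algebra borel)"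
    and eq: "\<And>f. nice f \<Longrightarrow> (\<integral>x. f x \<partial>N1) = (\<integral>x. f x \<partial>N2)"
  shows "N1 = N2"
proof -
  define g where "g a k x = (\<Prod>i\<in>UNIV. 1 - smooth_step (real k * (x $ i - a $ i)))" for a :: "real ^ 'n" and k x
  have gn: "nice (g a k)" for a k
    unfolding g_def[abs_def] by (intro nice_prod nice_coordinate_step) auto
  have lim: "(\<lambda>k. \<integral>x. g a k x \<partial>N) \<longlonglongrightarrow> measure N {..a}" if N: "N \<in> space (prob_algebra borel)" for N a
  proof -
    interpret prob_space N using prob_algebraD[OF N] by simp
    have [measurable_cong]: "sets N = sets borel" using prob_algebraD[OF N] by simp
    have sp: "space N = UNIV" using prob_algebraD[OF N] by simp
    have "(\<lambda>k. \<integral>x. g a k x \<partial>N) \<longlonglongrightarrow> (\<integral>x. indicator {..a} x \<partial>N)"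
    proof (rule integral_dominated_convergence[where w = "\<lambda>_. 1"])
      show "g a k \<in> borel_measurable N" for k
        using nice_measurable[OF gn] by (simp add: measurable_cong_sets[OF prob_algebraD(2)[OF N] refl])
      show "AE x in N. (\<lambda>k. g a k x) \<longlonglongrightarrow> indicator {..a} x"
      proof (rule AE_I2)
        fix x
        have "(\<lambda>k. g a k x) \<longlonglongrightarrow> (\<Prod>i\<in>UNIV. if x $ i - a $ i \<le> 0 then 1 else 0)"
          unfolding g_def by (intro tendsto_prod smooth_step_limit)
        also have "(\<Prod>i\<in>UNIV. if x $ i - a $ i \<le> 0 then 1 else 0) = (indicator {..a} x :: real)"
          by (auto simp: indicator_def less_eq_vec_def intro!: prod.neutral prod_zero)
        finally show "(\<lambda>k. g a k x) \<longlonglongrightarrow> indicator {..a} x" .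
      qed
      show "AE x in N. norm (g a k x) \<le> 1" for k
        unfolding g_def real_norm_def abs_prod
        using smooth_step_bounds by (intro AE_I2 prod_le_1) (auto simp: abs_le_iff)
    qed (auto simp: sp)
    thus ?thesis by (simp add: sp)
  qed
  have m: "measure N1 {..a} = measure N2 {..a}" for a
    using LIMSEQ_unique[OF lim[OF N(1), of a]] lim[OF N(2), of a] eq[OF gn] by simp
  interpret p1: prob_space N1 using prob_algebraD[OF N(1)] by simp
  interpret p2: prob_space N2 using prob_algebraD[OF N(2)] by simp
  show ?thesis
  proof (rule measure_eqI_generator_eq[where E = "range (\<lambda>a. {..a})" and \<Omega> = UNIV and A = "\<lambda>n. {..\<chi> i. real n}"])
    have "{..a} \<inter> {..a'} = {..inf a a'}" for a a' :: "real ^ 'n" by auto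
    thus "Int_stable (range (\<lambda>a :: real ^ 'n. {..a}))" by (intro Int_stableI) auto
    show "sets N1 = sigma_sets UNIV (range (\<lambda>a. {..a}))" "sets N2 = sigma_sets UNIV (range (\<lambda>a. {..a}))"
      using prob_algebraD(2)[OF N(1)] prob_algebraD(2)[OF N(2)] by (simp_all add: borel_eq_atMost)
    show "(\<Union>n. {..\<chi> i. real n}) = (UNIV :: (real ^ 'n) set)"
    proof (intro equalityI subsetI UNIV_I UN_I)
      fix x :: "real ^ 'n"
      have "x $ i \<le> real (nat \<lceil>norm x\<rceil>)" for i using component_le_norm_cart[of x i] by linarith
      thus "x \<in> {..\<chi> i. real (nat \<lceil>norm x\<rceil>)}" by (simp add: less_eq_vec_def)
    qed
    show "emeasure N1 X = emeasure N2 X" if "X \<in> range (\<lambda>a. {..a})" for X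
      using that m by (auto simp: p1.emeasure_eq_measure p2.emeasure_eq_measure)
  qed (auto simp: p1.emeasure_eq_measure)
qed

section \<open>Limits of the walk solve the Cauchy problem\<close>

context euler_scheme
begin

text \<open>The distributional derivatives already act on \<open>\<phi>\<close>, so bounded Borel
  functions \<open>g\<close> are covered. The two signs of the second order part cancel, and
  expanding \<open>A\<close> gives one Hessian form for each \<open>v k\<close>.\<close>

lemma diffusion_op_dist_of_fun:
  assumes A: "\<And>i j. A $ i $ j = (\<Sum>k<M. v k $ i * v k $ j)"
    and \<phi>: "\<phi> \<in> test_functions UNIV" and g: "g \<in> borel_measurable borel" "\<And>x. \<bar>g x\<bar> \<le> B"
  shows "diffusion_op b A (dist_of_fun g) \<phi> = (\<integral>x. g x * adjoint_gen \<phi> x \<partial>lborel)"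
proof -
  obtain R where R: "bump R \<phi>" using test_functions_bump[OF \<phi>] by blast
  let ?p = "\<lambda>i j. \<integral>x. g x * partial_deriv j (partial_deriv i \<phi>) x \<partial>lborel"
  have ip: "integrable lborel (\<lambda>x. g x * partial_deriv j (partial_deriv i \<phi>) x)" for i j
  proof -
    obtain R' where R': "bump R' (partial_deriv j (partial_deriv i \<phi>))"
      using test_functions_bump[OF partial_deriv_test_function[OF partial_deriv_test_function[OF \<phi>]]] by blast
    show ?thesis by (rule bump_mult_integrable[OF R' g])
  qed
  have 1: "(\<Sum>i\<in>UNIV. dist_mult (\<lambda>x. b x $ i) (dist_partial i (dist_of_fun g)) \<phi>) = - (\<integral>x. g x * divergence_mult b \<phi> x \<partial>lborel)"
    using bump_divergence_mult(2)[OF b_lip b_diff R g]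
    by (simp add: dist_mult_def dist_partial_def dist_of_fun_def partial_deriv_def sum_negf)
  have 2: "(\<integral>x. g x * second_deriv \<phi> u x \<partial>lborel) = (\<Sum>i\<in>UNIV. \<Sum>j\<in>UNIV. u $ i * u $ j * ?p i j)" for u
  proof -
    have "(\<integral>x. g x * second_deriv \<phi> u x \<partial>lborel)
       = (\<integral>x. (\<Sum>i\<in>UNIV. \<Sum>j\<in>UNIV. u $ i * u $ j * (g x * partial_deriv j (partial_deriv i \<phi>) x)) \<partial>lborel)"
      by (simp add: second_deriv_def sum_distrib_left mult_ac)
    also have "\<dots> = (\<Sum>i\<in>UNIV. \<Sum>j\<in>UNIV. u $ i * u $ j * ?p i j)"
      by (simp add: Bochner_Integration.integral_sum Bochner_Integration.integrable_sum ip)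
    finally show ?thesis .
  qed
  have "(\<Sum>k<M. \<integral>x. g x * second_deriv \<phi> (v k) x \<partial>lborel) = (\<Sum>i\<in>UNIV. \<Sum>j\<in>UNIV. A $ i $ j * ?p i j)"
    unfolding 2 A sum_distrib_right
    by (subst sum.swap, rule sum.cong[OF refl], rule sum.swap)
  hence 3: "(\<Sum>i\<in>UNIV. \<Sum>j\<in>UNIV. A $ i $ j * dist_partial i (dist_partial j (dist_of_fun g)) \<phi>)
      = (\<Sum>k<M. \<integral>x. g x * second_deriv \<phi> (v k) x \<partial>lborel)"
    by (simp add: dist_partial_def dist_of_fun_def)
  show ?thesis unfolding diffusion_op_def 1 3 adjoint_gen_integrable(4)[OF \<phi> g] by simp
qed

text \<open>An arbitrary subsequence \<open>s\<close> is the starting point, since convergence of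
  the whole sequence will be deduced from the uniqueness of its limit points. The weak equation
  passes to the limit by dominated convergence, first in space and then in time.\<close>

lemma eflow_subsequence_solution:
  assumes A: "\<And>i j. A $ i $ j = (\<Sum>k<M. v k $ i * v k $ j)"
    and f: "nice f" and s: "strict_mono (s :: nat \<Rightarrow> nat)"
  obtains r U where "strict_mono (r :: nat \<Rightarrow> nat)" "\<And>t x. (\<lambda>N. eflow (s (r N)) f t x) \<longlonglongrightarrow> U t x"
    "\<And>t. continuous_on UNIV (U t)" "cauchy_solution (diffusion_op b A) f U"
proof -
  obtain B C where fB: "\<And>x. \<bar>f x\<bar> \<le> B" and fC: "C-lipschitz_on UNIV f" and fd: "\<And>x. f differentiable (at x)"
    using niceE[OF f] by blast
  have B: "B \<ge> 0" using fB[of 0] by simp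
  obtain r U' where r: "strict_mono (r :: nat \<Rightarrow> nat)"
    and U': "\<And>z. (\<lambda>N. eflow (s (r N)) f (fst z) (snd z)) \<longlonglongrightarrow> U' z" "continuous_on UNIV U'"
  proof (rule asymp_equicontinuous_subsequence[of "\<lambda>N z. eflow (s N) f (fst z) (snd z)" B])
    show "\<bar>eflow (s N) f (fst z) (snd z)\<bar> \<le> B" for N z by (rule eflow_bound[OF fB])
    fix z :: "real \<times> (real, 'n) vec" and e :: real assume "e > 0"
    from eflow_equicontinuous[OF fC this, of "fst z" "snd z"]
    obtain d N0 where d: "d > 0" "\<And>N z'. N \<ge> N0 \<Longrightarrow> dist z z' < d \<Longrightarrow>
      \<bar>eflow N f (fst z) (snd z) - eflow N f (fst z') (snd z')\<bar> \<le> e"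
      unfolding prod.collapse by blast
    have "N0 \<le> s N" if "N0 \<le> N" for N using seq_suble[OF s, of N] that by simp
    thus "\<exists>d>0. \<exists>N\<^sub>0. \<forall>N\<ge>N\<^sub>0. \<forall>z'. dist z z' < d \<longrightarrow>
      \<bar>eflow (s N) f (fst z) (snd z) - eflow (s N) f (fst z') (snd z')\<bar> \<le> e"
      using d by blast
  qed blast
  define U where "U t x = U' (t, x)" for t x
  define k where "k = s \<circ> r"
  have k: "strict_mono k" unfolding k_def using s r by (rule strict_mono_o)
  have lim: "(\<lambda>N. eflow (k N) f t x) \<longlonglongrightarrow> U t x" for t x
    using U'(1)[of "(t, x)"] by (simp add: U_def k_def)
  have Ub: "\<bar>U t x\<bar> \<le> B" for t x
    by (rule LIMSEQ_le_const2[OF tendsto_rabs[OF lim]]) (auto intro!: eflow_bound fB)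
  have Uc: "continuous_on UNIV (U t)" for t
    unfolding U_def[abs_def] by (rule continuous_on_compose2[OF U'(2)]) (auto intro!: continuous_intros)
  have em: "eflow N f t \<in> borel_measurable borel" for N t
    unfolding eflow_def[abs_def] by (intro differentiable_imp_measurable K_iter_differentiable fd)
  have Um: "U t \<in> borel_measurable borel" for t by (rule borel_measurable_continuous_onI[OF Uc])
  have sol: "cauchy_solution (diffusion_op b A) f U"
    unfolding cauchy_solution_def
  proof (intro conjI ballI allI impI)
    have "(\<lambda>(t, x). U t x) = U'" by (auto simp: U_def)
    thus "(\<lambda>(t, x). U t x) \<in> borel_measurable (restrict_space borel ({0..} \<times> UNIV))"
      using U'(2) by (auto intro!: measurable_restrict_space1 borel_measurable_continuous_onI)
    show "bounded ((\<lambda>(t, x). U t x) ` ({0..} \<times> UNIV))"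
      using Ub by (auto intro!: boundedI[of _ B])
    fix \<phi> :: "real ^ 'n \<Rightarrow> real" and t :: real assume \<phi>: "\<phi> \<in> test_functions UNIV" and t: "t \<ge> 0"
    let ?\<psi> = "adjoint_gen \<phi>"
    obtain R where R: "bump R \<phi>" using test_functions_bump[OF \<phi>] by blast
    note [measurable] = bumpD(4)[OF R]
    have i\<psi>: "integrable lborel ?\<psi>" using adjoint_gen_integrable(3)[OF \<phi>, of "\<lambda>_. 1" 1] by simp
    have [measurable]: "?\<psi> \<in> borel_measurable lborel" using i\<psi> by (rule borel_measurable_integrable)
    have conv: "(\<lambda>N. \<integral>x. eflow (k N) f s x * g x \<partial>lborel) \<longlonglongrightarrow> (\<integral>x. U s x * g x \<partial>lborel)"
      if g: "integrable lborel g" for g s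
    proof (rule integral_dominated_convergence[where w = "\<lambda>x. B * \<bar>g x\<bar>"])
      have [measurable]: "g \<in> borel_measurable lborel" using g by (rule borel_measurable_integrable)
      note [measurable] = em Um
      show "(\<lambda>x. U s x * g x) \<in> borel_measurable lborel" "(\<lambda>x. eflow (k N) f s x * g x) \<in> borel_measurable lborel" for N
        by (simp_all add: measurable)
      show "integrable lborel (\<lambda>x. B * \<bar>g x\<bar>)" using g by (intro integrable_mult_right integrable_abs)
      show "AE x in lborel. (\<lambda>N. eflow (k N) f s x * g x) \<longlonglongrightarrow> U s x * g x" by (intro AE_I2 tendsto_intros lim)
      show "AE x in lborel. norm (eflow (k N) f s x * g x) \<le> B * \<bar>g x\<bar>" for N
        using eflow_bound[OF fB] by (auto simp: abs_mult intro!: mult_right_mono)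
    qed
    obtain e where e: "e \<longlonglongrightarrow> 0" "\<And>N t. hs N \<le> h\<^sub>0 \<Longrightarrow> t \<ge> 0 \<Longrightarrow>
      \<bar>(\<integral>x. eflow N f t x * \<phi> x \<partial>lborel) - (\<integral>x. f x * \<phi> x \<partial>lborel)
        - (\<integral>s\<in>{0..t}. (\<integral>x. eflow N f s x * ?\<psi> x \<partial>lborel) \<partial>lborel)\<bar> \<le> (1 + t) * e N"
      using eflow_weak_equation[OF \<phi> fB fC fd] by blast
    define I where "I = (\<integral>x. \<bar>?\<psi> x\<bar> \<partial>lborel)"
    define G where "G N s = (\<integral>x. eflow (k N) f s x * ?\<psi> x \<partial>lborel)" for N s
    define G0 where "G0 s = (\<integral>x. U s x * ?\<psi> x \<partial>lborel)" for s
    have Glim: "(\<lambda>N. G N s) \<longlonglongrightarrow> G0 s" for s unfolding G_def G0_def by (rule conv[OF i\<psi>])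
    \<comment> \<open>In time \<open>G N\<close> depends only on the number of completed steps, so
      any function of that number will do.\<close>
    have Gm [measurable]: "G N \<in> borel_measurable borel" for N
    proof -
      define c where "c m = (\<integral>x. (K (hs (k N)) ^^ m) f x * ?\<psi> x \<partial>lborel)" for m
      have "G N = (\<lambda>s. c (nat \<lfloor>s / hs (k N)\<rfloor>))" by (simp add: G_def c_def eflow_def fun_eq_iff)
      thus ?thesis by simp
    qed
    have G0m [measurable]: "G0 \<in> borel_measurable borel"
      by (rule borel_measurable_LIMSEQ_real[OF Glim]) (use Gm in auto)
    have Gb: "\<bar>G N s\<bar> \<le> B * I" for N s
    proof -
      have "\<bar>G N s\<bar> \<le> (\<integral>x. B * \<bar>?\<psi> x\<bar> \<partial>lborel)"
        unfolding G_def
      proof (rule order_trans[OF integral_abs_bound], rule integral_mono)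
        show "integrable lborel (\<lambda>x. \<bar>eflow (k N) f s x * ?\<psi> x\<bar>)"
          by (intro integrable_abs adjoint_gen_integrable(3)[OF \<phi> em eflow_bound[OF fB]])
        show "integrable lborel (\<lambda>x. B * \<bar>?\<psi> x\<bar>)" using i\<psi> by (intro integrable_mult_right integrable_abs)
        show "\<bar>eflow (k N) f s x * ?\<psi> x\<bar> \<le> B * \<bar>?\<psi> x\<bar>" for x
          using eflow_bound[OF fB] by (auto simp: abs_mult intro!: mult_right_mono)
      qed
      thus ?thesis by (simp add: I_def)
    qed
    have Y: "(\<lambda>N. \<integral>s\<in>{0..t}. G N s \<partial>lborel) \<longlonglongrightarrow> (\<integral>s\<in>{0..t}. G0 s \<partial>lborel)"
      unfolding set_lebesgue_integral_def
    proof (rule integral_dominated_convergence[where w = "\<lambda>s. B * I * indicator {0..t} s"])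
      show "integrable lborel (\<lambda>s. B * I * indicator {0..t} s :: real)"
        by (intro integrable_mult_right integrable_real_indicator) (auto simp: emeasure_lborel_Icc_eq)
      show "AE s in lborel. (\<lambda>N. indicat_real {0..t} s *\<^sub>R G N s) \<longlonglongrightarrow> indicat_real {0..t} s *\<^sub>R G0 s"
        by (intro AE_I2 tendsto_intros Glim)
      show "AE s in lborel. norm (indicat_real {0..t} s *\<^sub>R G N s) \<le> B * I * indicator {0..t} s" for N
        using Gb by (auto simp: indicator_def)
    qed measurable
    have X: "(\<lambda>N. \<integral>x. eflow (k N) f t x * \<phi> x \<partial>lborel) \<longlonglongrightarrow> (\<integral>x. U t x * \<phi> x \<partial>lborel)"
      by (rule conv[OF bump_integrable[OF R]])
    obtain N1 where N1: "\<And>N. N \<ge> N1 \<Longrightarrow> hs N \<le> h\<^sub>0" using eventually_hs by blast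
    have "\<bar>(\<integral>x. U t x * \<phi> x \<partial>lborel) - (\<integral>x. f x * \<phi> x \<partial>lborel) - (\<integral>s\<in>{0..t}. G0 s \<partial>lborel)\<bar> \<le> (1 + t) * 0"
    proof (rule LIMSEQ_le)
      show "(\<lambda>N. \<bar>(\<integral>x. eflow (k N) f t x * \<phi> x \<partial>lborel) - (\<integral>x. f x * \<phi> x \<partial>lborel) - (\<integral>s\<in>{0..t}. G N s \<partial>lborel)\<bar>)
        \<longlonglongrightarrow> \<bar>(\<integral>x. U t x * \<phi> x \<partial>lborel) - (\<integral>x. f x * \<phi> x \<partial>lborel) - (\<integral>s\<in>{0..t}. G0 s \<partial>lborel)\<bar>"
        by (intro tendsto_intros X Y)
      show "(\<lambda>N. (1 + t) * e (k N)) \<longlonglongrightarrow> (1 + t) * 0"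
        using LIMSEQ_subseq_LIMSEQ[OF e(1) k] by (intro tendsto_intros) (simp add: o_def)
      have "N1 \<le> k N" if "N1 \<le> N" for N using seq_suble[OF k, of N] that by simp
      thus "\<exists>N0. \<forall>N\<ge>N0. \<bar>(\<integral>x. eflow (k N) f t x * \<phi> x \<partial>lborel) - (\<integral>x. f x * \<phi> x \<partial>lborel) - (\<integral>s\<in>{0..t}. G N s \<partial>lborel)\<bar>
          \<le> (1 + t) * e (k N)"
        unfolding G_def using e(2)[OF N1 t] by blast
    qed
    hence "(\<integral>x. U t x * \<phi> x \<partial>lborel) = (\<integral>x. f x * \<phi> x \<partial>lborel) + (\<integral>s\<in>{0..t}. G0 s \<partial>lborel)" by simp
    moreover have "diffusion_op b A (dist_of_fun (U s)) \<phi> = G0 s" for s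
      unfolding G0_def by (rule diffusion_op_dist_of_fun[OF A \<phi> Um Ub])
    ultimately show "dist_of_fun (U t) \<phi> = dist_of_fun f \<phi> + (\<integral>s\<in>{0..t}. diffusion_op b A (dist_of_fun (U s)) \<phi> \<partial>lborel)"
      by (simp add: dist_of_fun_def)
  qed
  show thesis by (rule that[OF r lim[unfolded k_def o_apply] Uc sol])
qed

end

lemma tendsto_subsequence_principle:
  fixes x :: "nat \<Rightarrow> real"
  assumes "\<And>s :: nat \<Rightarrow> nat. strict_mono s \<Longrightarrow> \<exists>r :: nat \<Rightarrow> nat. strict_mono r \<and> (\<lambda>n. x (s (r n))) \<longlonglongrightarrow> l"
  shows "x \<longlonglongrightarrow> l"
proof (rule ccontr)
  assume "\<not> x \<longlonglongrightarrow> l"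
  then obtain e where e: "e > 0" "\<And>n0. \<exists>n\<ge>n0. norm (x n - l) \<ge> e"
    unfolding LIMSEQ_iff by (metis not_le)
  have "infinite {n. norm (x n - l) \<ge> e}"
    unfolding infinite_nat_iff_unbounded_le using e(2) by blast
  from infinite_enumerate[OF this] obtain s :: "nat \<Rightarrow> nat" where s: "strict_mono s" "\<And>n. norm (x (s n) - l) \<ge> e" by blast
  from assms[OF s(1)] obtain r :: "nat \<Rightarrow> nat" where "(\<lambda>n. x (s (r n))) \<longlonglongrightarrow> l" by blast
  then obtain n where "norm (x (s (r n)) - l) < e" using e(1) unfolding LIMSEQ_iff by blast
  thus False using s(2)[of "r n"] by simp
qed

section \<open>Identification of the limit with the given semigroup\<close>

locale euler_semigroup = euler_scheme b S v M a L l\<^sub>1 l\<^sub>2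
  for b :: "real ^ 'n::finite \<Rightarrow> real ^ 'n" and S v M a L l\<^sub>1 l\<^sub>2 +
  fixes A :: "real ^ 'n ^ 'n" and P :: "real \<Rightarrow> (real ^ 'n \<Rightarrow> real) \<Rightarrow> real ^ 'n \<Rightarrow> real"
  assumes A_sum: "A $ i $ j = (\<Sum>k<M. v k $ i * v k $ j)"
    and gen: "generates_semigroup (diffusion_op b A) P"
begin

lemma markov: "markov_semigroup P" and feller: "feller P"
  using gen by (auto simp: generates_semigroup_def)

lemma P_continuous: "t \<ge> 0 \<Longrightarrow> continuous_on UNIV f \<Longrightarrow> bounded (range f) \<Longrightarrow> continuous_on UNIV (P t f)"
  using feller by (simp add: feller_def)

text \<open>Uniqueness for the Cauchy problem determines a limit point only up to null sets. Both
  candidates are continuous, so they agree at every point, as integration against singular initial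
  laws demands.\<close>

theorem eflow_tendsto_P:
  assumes f: "nice f" and t: "t \<ge> 0"
  shows "(\<lambda>N. eflow N f t x) \<longlonglongrightarrow> P t f x"
proof (rule tendsto_subsequence_principle)
  fix s :: "nat \<Rightarrow> nat" assume s: "strict_mono s"
  obtain r U where r: "strict_mono (r :: nat \<Rightarrow> nat)" and U: "\<And>t x. (\<lambda>N. eflow (s (r N)) f t x) \<longlonglongrightarrow> U t x"
    "\<And>t. continuous_on UNIV (U t)" "cauchy_solution (diffusion_op b A) f U"
    using eflow_subsequence_solution[OF A_sum f s] by blast
  have "AE x in lborel. U t x = P t f x"
    using gen nice_bounded_borel[OF f] U(3) t by (auto simp: generates_semigroup_def)
  moreover have "continuous_on UNIV (P t f)"
    using nice_continuous[OF f] f by (intro P_continuous t) (auto simp: nice_def)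
  ultimately have "U t = P t f" by (intro continuous_AE_eq U(2))
  thus "\<exists>r :: nat \<Rightarrow> nat. strict_mono r \<and> (\<lambda>n. eflow (s (r n)) f t x) \<longlonglongrightarrow> P t f x"
    using r U(1)[of t x] by auto
qed

lemma P_abs_le:
  assumes "nice f" "t \<ge> 0" "\<And>x. \<bar>f x\<bar> \<le> B"
  shows "\<bar>P t f x\<bar> \<le> B"
  by (rule LIMSEQ_le_const2[OF tendsto_rabs[OF eflow_tendsto_P[OF assms(1,2)]]])
    (auto intro!: eflow_bound assms(3))

text \<open>From 1 - x \<le> exp (- x). The floor loses at most one step of time, hence
  \<open>t - hs N\<close> in the exponent.\<close>

lemma decay_factor:
  assumes "hs N \<le> h\<^sub>0" "t \<ge> 0"
  shows "(1 - \<kappa> * hs N) ^ nat \<lfloor>t / hs N\<rfloor> \<le> exp (- \<kappa> * (t - hs N))"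
proof -
  let ?h = "hs N" and ?m = "nat \<lfloor>t / hs N\<rfloor>"
  have "1 - \<kappa> * ?h \<le> exp (- (\<kappa> * ?h))" using exp_ge_add_one_self[of "- (\<kappa> * ?h)"] by simp
  hence "(1 - \<kappa> * ?h) ^ ?m \<le> exp (- (\<kappa> * ?h)) ^ ?m"
    using kappa_h[OF hs(1) assms(1)] by (intro power_mono) auto
  also have "\<dots> = exp (- \<kappa> * (real ?m * ?h))" by (simp add: exp_of_nat_mult[symmetric] mult_ac)
  also have "\<dots> \<le> exp (- \<kappa> * (t - ?h))"
    using mult_left_mono[of "t - ?h" "real ?m * ?h" \<kappa>] floor_steps_bounds(2)[OF hs(1) assms(2), of N] kappa_pos
    by (simp add: distrib_right)
  finally show ?thesis .
qed

lemma P_lipschitz: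
  assumes f: "nice f" "C-lipschitz_on UNIV f" and t: "t \<ge> 0"
  shows "\<bar>P t f x - P t f y\<bar> \<le> C * lip_factor * exp (- \<kappa> * t / 2) * norm (x - y)"
proof (rule LIMSEQ_le)
  show "(\<lambda>N. \<bar>eflow N f t x - eflow N f t y\<bar>) \<longlonglongrightarrow> \<bar>P t f x - P t f y\<bar>"
    by (intro tendsto_intros eflow_tendsto_P f t)
  have C: "C \<ge> 0" using f(2) lipschitz_on_nonneg by blast
  have "(\<lambda>N. C * lip_factor * sqrt (exp (- \<kappa> * (t - hs N))) * norm (x - y)) \<longlonglongrightarrow>
      C * lip_factor * sqrt (exp (- \<kappa> * (t - 0))) * norm (x - y)"
    by (intro tendsto_intros hs(3))
  also have "sqrt (exp (- \<kappa> * (t - 0))) = exp (- \<kappa> * t / 2)"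
    by (rule real_sqrt_unique) (simp_all add: power2_eq_square exp_add[symmetric])
  finally show "(\<lambda>N. C * lip_factor * sqrt (exp (- \<kappa> * (t - hs N))) * norm (x - y)) \<longlonglongrightarrow>
      C * lip_factor * exp (- \<kappa> * t / 2) * norm (x - y)" .
  obtain N1 where N1: "\<And>N. N \<ge> N1 \<Longrightarrow> hs N \<le> h\<^sub>0" using eventually_hs by blast
  show "\<exists>N0. \<forall>N\<ge>N0. \<bar>eflow N f t x - eflow N f t y\<bar> \<le> C * lip_factor * sqrt (exp (- \<kappa> * (t - hs N))) * norm (x - y)"
  proof (intro exI[of _ N1] allI impI)
    fix N assume "N \<ge> N1"
    hence h: "hs N \<le> h\<^sub>0" by (rule N1)
    have "\<bar>eflow N f t x - eflow N f t y\<bar> \<le> C * lip_factor * sqrt (1 - \<kappa> * hs N) ^ nat \<lfloor>t / hs N\<rfloor> * norm (x - y)"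
      unfolding eflow_def by (rule K_iter_lipschitz_decay[OF hs(1) h f(2)])
    also have "sqrt (1 - \<kappa> * hs N) ^ nat \<lfloor>t / hs N\<rfloor> = sqrt ((1 - \<kappa> * hs N) ^ nat \<lfloor>t / hs N\<rfloor>)" by (simp add: real_sqrt_power)
    also have "C * lip_factor * sqrt ((1 - \<kappa> * hs N) ^ nat \<lfloor>t / hs N\<rfloor>) * norm (x - y)
       \<le> C * lip_factor * sqrt (exp (- \<kappa> * (t - hs N))) * norm (x - y)"
      using C lip_factor_pos decay_factor[OF h t] by (intro mult_right_mono mult_left_mono real_sqrt_le_mono) auto
    finally show "\<bar>eflow N f t x - eflow N f t y\<bar> \<le> C * lip_factor * sqrt (exp (- \<kappa> * (t - hs N))) * norm (x - y)" .
  qed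
qed

end

text \<open>The shape demanded by \<open>K_iter_variance\<close>: the gradient is taken at
  \<open>x\<close> alone, and the summed Lipschitz constants of the partial derivatives pay for
  moving it along the segment.\<close>

lemma test_function_taylor:
  fixes \<phi> :: "real ^ 'n::finite \<Rightarrow> real"
  assumes \<phi>: "\<phi> \<in> test_functions UNIV"
  obtains D where "D \<ge> 0" "\<And>x y. \<bar>\<phi> x - \<phi> y\<bar> \<le> norm (gradient \<phi> x) * norm (x - y) + D * (norm (x - y))\<^sup>2"
proof -
  have "\<exists>C. C-lipschitz_on UNIV (partial_deriv i \<phi>)" for i
    using niceE[OF test_function_nice[OF partial_deriv_test_function[OF \<phi>]]] by metis
  then obtain C where C: "\<And>i. (C i)-lipschitz_on UNIV (partial_deriv i \<phi>)" by metis
  have Cn: "C i \<ge> 0" for i using C lipschitz_on_nonneg by blast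
  have dd: "dd \<phi> e x = gradient \<phi> x \<bullet> e" for e x
    using dd_linear_sum[OF test_functionsD(1)[OF \<phi>], where e = e and x = x]
    by (simp add: gradient_def inner_vec_def partial_deriv_def mult.commute)
  show thesis
  proof (rule that[of "\<Sum>i\<in>UNIV. C i"])
    show "(\<Sum>i\<in>UNIV. C i) \<ge> 0" by (intro sum_nonneg Cn)
    fix x y :: "real ^ 'n"
    define e where "e = y - x"
    have "((\<lambda>t. \<phi> (x + t *\<^sub>R e)) has_real_derivative dd \<phi> e (x + t *\<^sub>R e)) (at t)" for t
      using dd_vector_derivative[OF test_functionsD(1)[OF \<phi>], where x = x and t = t and e = e] by (simp add: has_real_derivative_iff_has_vector_derivative)
    from MVT2[of 0 1 "\<lambda>t. \<phi> (x + t *\<^sub>R e)", OF _ this]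
    obtain z where z: "0 < z" "z < 1" "\<phi> y - \<phi> x = gradient \<phi> (x + z *\<^sub>R e) \<bullet> e"
      by (auto simp: e_def dd)
    have "\<bar>(gradient \<phi> (x + z *\<^sub>R e) - gradient \<phi> x) \<bullet> e\<bar> \<le> (\<Sum>i\<in>UNIV. \<bar>(partial_deriv i \<phi> (x + z *\<^sub>R e) - partial_deriv i \<phi> x) * e $ i\<bar>)"
      by (simp add: inner_vec_def gradient_def sum_abs)
    also have "\<dots> \<le> (\<Sum>i\<in>UNIV. (C i * norm e) * norm e)"
    proof (rule sum_mono)
      fix i
      have "\<bar>partial_deriv i \<phi> (x + z *\<^sub>R e) - partial_deriv i \<phi> x\<bar> \<le> C i * norm (z *\<^sub>R e)"
        using lipschitz_norm_diff_le[OF C[of i], of "x + z *\<^sub>R e" x] by simp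
      also have "\<dots> \<le> C i * norm e" using z by (intro mult_left_mono Cn) (simp add: mult_left_le_one_le)
      finally show "\<bar>(partial_deriv i \<phi> (x + z *\<^sub>R e) - partial_deriv i \<phi> x) * e $ i\<bar> \<le> (C i * norm e) * norm e"
        unfolding abs_mult using component_le_norm_cart[of e i] Cn[of i] by (intro mult_mono) auto
    qed
    also have "\<dots> = (\<Sum>i\<in>UNIV. C i) * (norm e)\<^sup>2" by (simp add: sum_distrib_right power2_eq_square mult.assoc)
    finally have 1: "\<bar>(gradient \<phi> (x + z *\<^sub>R e) - gradient \<phi> x) \<bullet> e\<bar> \<le> (\<Sum>i\<in>UNIV. C i) * (norm e)\<^sup>2" .
    have 2: "\<bar>gradient \<phi> x \<bullet> e\<bar> \<le> norm (gradient \<phi> x) * norm e" by (rule Cauchy_Schwarz_ineq2)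
    have "\<phi> y - \<phi> x = gradient \<phi> x \<bullet> e + (gradient \<phi> (x + z *\<^sub>R e) - gradient \<phi> x) \<bullet> e"
      using z(3) by (simp add: inner_diff_left)
    moreover have "norm e = norm (x - y)" by (simp add: e_def norm_minus_commute)
    ultimately show "\<bar>\<phi> x - \<phi> y\<bar> \<le> norm (gradient \<phi> x) * norm (x - y) + (\<Sum>i\<in>UNIV. C i) * (norm (x - y))\<^sup>2"
      using 1 2 by (simp only:)
  qed
qed

context euler_semigroup
begin

text \<open>The variance bound of the walk as the step size vanishes, which removes the remainder.
  \<open>G\<close> and \<open>C\<close> absorb the passage from the Euclidean norm to
  \<open>q\<close>. The constant is independent of \<open>t\<close>, so the inequality is fit for
  the limit of large times.\<close>

lemma P_local_poincare:
  assumes \<phi>: "\<phi> \<in> test_functions UNIV" and t: "t \<ge> 0"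
  shows "P t (\<lambda>x. (\<phi> x)\<^sup>2) x - (P t \<phi> x)\<^sup>2 \<le> (2 * c\<^sub>w / (\<kappa> * l\<^sub>1)) * P t (\<lambda>x. (norm (gradient \<phi> x))\<^sup>2) x"
proof -
  obtain D where D: "D \<ge> 0" "\<And>x y. \<bar>\<phi> x - \<phi> y\<bar> \<le> norm (gradient \<phi> x) * norm (x - y) + D * (norm (x - y))\<^sup>2"
    using test_function_taylor[OF \<phi>] by blast
  have nn: "nice \<phi>" "nice (\<lambda>x. (\<phi> x)\<^sup>2)" "nice (\<lambda>x. (norm (gradient \<phi> x))\<^sup>2)"
    using test_function_nice[OF \<phi>] test_function_gradient_nice[OF \<phi>] nice_mult[of \<phi> \<phi>]
    by (simp_all add: power2_eq_mult_fun)
  define G where "G x = norm (gradient \<phi> x) / sqrt l\<^sub>1" for x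
  define C where "C = D / l\<^sub>1"
  have C: "C \<ge> 0" using D l1_pos by (simp add: C_def)
  have G: "G x \<ge> 0" for x using l1_pos by (simp add: G_def)
  have loc: "\<bar>\<phi> x - \<phi> y\<bar> \<le> G x * sqrt (q (x - y)) + C * q (x - y)" for x y
  proof -
    have "norm (gradient \<phi> x) * norm (x - y) \<le> norm (gradient \<phi> x) * (sqrt (q (x - y)) / sqrt l\<^sub>1)"
      by (intro mult_left_mono sqrt_q_bounds) auto
    moreover have "D * (norm (x - y))\<^sup>2 \<le> D * (q (x - y) / l\<^sub>1)"
      using q_lower[of "x - y"] l1_pos D(1) by (intro mult_left_mono) (auto simp: pos_le_divide_eq mult.commute)
    ultimately show ?thesis using D(2)[of x y] by (simp add: G_def C_def)
  qed
  have G2: "(\<lambda>x. (G x)\<^sup>2) = (\<lambda>x. (1 / l\<^sub>1) * (norm (gradient \<phi> x))\<^sup>2)"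
    using l1_pos by (simp add: G_def power_divide fun_eq_iff)
  define c where "c = 2 * C\<^sup>2 * c\<^sub>w\<^sup>2 / \<kappa>"
  have "P t (\<lambda>x. (\<phi> x)\<^sup>2) x - (P t \<phi> x)\<^sup>2 \<le> (2 * c\<^sub>w / (\<kappa> * l\<^sub>1)) * P t (\<lambda>x. (norm (gradient \<phi> x))\<^sup>2) x + c * 0"
  proof (rule LIMSEQ_le)
    show "(\<lambda>N. eflow N (\<lambda>x. (\<phi> x)\<^sup>2) t x - (eflow N \<phi> t x)\<^sup>2) \<longlonglongrightarrow> P t (\<lambda>x. (\<phi> x)\<^sup>2) x - (P t \<phi> x)\<^sup>2"
      by (intro tendsto_intros eflow_tendsto_P nn t)
    show "(\<lambda>N. (2 * c\<^sub>w / (\<kappa> * l\<^sub>1)) * eflow N (\<lambda>x. (norm (gradient \<phi> x))\<^sup>2) t x + c * hs N)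
      \<longlonglongrightarrow> (2 * c\<^sub>w / (\<kappa> * l\<^sub>1)) * P t (\<lambda>x. (norm (gradient \<phi> x))\<^sup>2) x + c * 0"
      by (intro tendsto_intros eflow_tendsto_P nn t hs(3))
    obtain N1 where N1: "\<And>N. N \<ge> N1 \<Longrightarrow> hs N \<le> h\<^sub>0" using eventually_hs by blast
    show "\<exists>N0. \<forall>N\<ge>N0. eflow N (\<lambda>x. (\<phi> x)\<^sup>2) t x - (eflow N \<phi> t x)\<^sup>2
        \<le> (2 * c\<^sub>w / (\<kappa> * l\<^sub>1)) * eflow N (\<lambda>x. (norm (gradient \<phi> x))\<^sup>2) t x + c * hs N"
    proof (intro exI[of _ N1] allI impI)
      fix N assume "N \<ge> N1"
      from K_iter_variance[OF hs(1) N1[OF this] C G loc, of "nat \<lfloor>t / hs N\<rfloor>" x]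
      show "eflow N (\<lambda>x. (\<phi> x)\<^sup>2) t x - (eflow N \<phi> t x)\<^sup>2
        \<le> (2 * c\<^sub>w / (\<kappa> * l\<^sub>1)) * eflow N (\<lambda>x. (norm (gradient \<phi> x))\<^sup>2) t x + c * hs N"
        unfolding G2 avg_iter_cmult[OF J] by (simp add: eflow_def c_def)
    qed
  qed
  thus ?thesis by simp
qed

end

section \<open>Couplings of two walks\<close>

text \<open>A nice substitute for a tail indicator, so that the convergence of the walk applies to
  it: at least 1/2 where the squared norm exceeds \<open>R\<close>, and at most the squared norm
  divided by \<open>R\<close>, which second moments control.\<close>

definition cutoff :: "real \<Rightarrow> 'a::euclidean_space \<Rightarrow> real" where
  "cutoff R x = (x \<bullet> x) / (R + x \<bullet> x)"

lemma cutoff_bounds: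
  assumes "R \<ge> 1"
  shows "0 \<le> cutoff R x" "cutoff R x \<le> 1" "cutoff R x \<le> (x \<bullet> x) / R"
proof -
  have "R + x \<bullet> x > 0" using assms inner_ge_zero[of x] by linarith
  thus "0 \<le> cutoff R x" "cutoff R x \<le> 1" using assms by (auto simp: cutoff_def divide_le_eq)
  show "cutoff R x \<le> (x \<bullet> x) / R"
    unfolding cutoff_def using assms by (intro divide_left_mono) (auto intro!: mult_pos_pos add_pos_nonneg)
qed

lemma cutoff_ge:
  assumes "r \<ge> 1" "r < norm x"
  shows "1 \<le> 2 * cutoff (r\<^sup>2) x"
proof -
  have "r\<^sup>2 \<le> x \<bullet> x" using assms by (simp add: power2_norm_eq_inner[symmetric] power_mono)
  moreover have "r\<^sup>2 \<ge> 0" "r\<^sup>2 > 0" using assms by auto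
  ultimately have "r\<^sup>2 + x \<bullet> x > 0" "r\<^sup>2 + x \<bullet> x \<le> 2 * (x \<bullet> x)" by linarith+
  thus ?thesis by (simp add: cutoff_def pos_le_divide_eq)
qed

lemma cutoff_nice:
  assumes R: "R \<ge> 1"
  shows "nice (cutoff R :: 'a::euclidean_space \<Rightarrow> real)"
proof (rule niceI[where B = 1 and C = 2])
  show "\<bar>cutoff R x\<bar> \<le> 1" for x :: 'a using cutoff_bounds[OF R, of x] by simp
  have pos: "R + x \<bullet> x > 0" for x :: 'a using R inner_ge_zero[of x] by linarith
  have der: "(cutoff R has_derivative (\<lambda>e. 2 * R * (x \<bullet> e) / (R + x \<bullet> x)\<^sup>2)) (at x)" for x :: 'a
    unfolding cutoff_def[abs_def]
    by (rule has_derivative_eq_rhs, (rule derivative_intros | (rule less_imp_neq[OF pos, symmetric]))+)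
      (use pos[of x] in \<open>auto simp: fun_eq_iff field_simps power2_eq_square inner_commute\<close>)
  show "cutoff R differentiable (at x)" for x :: 'a using der differentiableI by blast
  show "2-lipschitz_on UNIV (cutoff R :: 'a \<Rightarrow> real)"
  proof (rule bounded_derivative_imp_lipschitz)
    show "(cutoff R has_derivative (\<lambda>e. 2 * R * (x \<bullet> e) / (R + x \<bullet> x)\<^sup>2)) (at x within UNIV)" for x :: 'a
      using der by simp
    show "onorm (\<lambda>e. 2 * R * (x \<bullet> e) / (R + x \<bullet> x)\<^sup>2) \<le> 2" for x :: 'a
    proof (rule onorm_le)
      fix e :: 'a
      let ?s = "R + x \<bullet> x"
      have s: "?s > 0" by (rule pos)
      have n: "norm x \<le> ?s"
        using sum_squares_bound[of "norm x" 1] R by (simp add: power2_norm_eq_inner) (smt (verit) norm_ge_zero)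
      have "\<bar>2 * R * (x \<bullet> e)\<bar> \<le> 2 * R * (norm x * norm e)"
        using R Cauchy_Schwarz_ineq2[of x e] by (simp add: abs_mult)
      also have "\<dots> \<le> 2 * ?s * (?s * norm e)"
        using R n s by (intro mult_mono mult_right_mono mult_nonneg_nonneg) auto
      finally have "\<bar>2 * R * (x \<bullet> e)\<bar> \<le> (2 * norm e) * ?s\<^sup>2" by (simp add: power2_eq_square mult_ac)
      thus "norm (2 * R * (x \<bullet> e) / ?s\<^sup>2) \<le> 2 * norm e"
        using s by (simp add: abs_divide pos_divide_le_eq)
    qed
  qed auto
qed

lemma prob_algebra_measurable_iff:
  "M \<in> space (prob_algebra N) \<Longrightarrow> f \<in> M \<rightarrow>\<^sub>M K \<longleftrightarrow> f \<in> N \<rightarrow>\<^sub>M K"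
  using measurable_cong_sets[OF prob_algebraD(2)[of M N] refl, of K] by simp

lemma prob_algebra_tail_le:
  fixes f :: "'a::euclidean_space \<Rightarrow> real"
  assumes M: "M \<in> space (prob_algebra borel)" and f: "f \<in> borel_measurable borel" "\<And>x. 0 \<le> f x" "\<And>x. f x \<le> B"
    and le: "\<And>x. r < norm x \<Longrightarrow> 1 \<le> f x"
  shows "measure M {x. r < norm x} \<le> (\<integral>x. f x \<partial>M)"
proof -
  interpret prob_space M using prob_algebraD[OF M] by simp
  have sp: "space M = UNIV" and [measurable_cong]: "sets M = sets borel" using prob_algebraD[OF M] by auto
  have fm [measurable]: "f \<in> borel_measurable borel" by fact
  have "measure M {x. r < norm x} = (\<integral>x. indicator {x. r < norm x} x \<partial>M)" by (simp add: sp)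
  also have "\<dots> \<le> (\<integral>x. f x \<partial>M)"
  proof (rule integral_mono)
    show "integrable M (indicator {x. r < norm x} :: 'a \<Rightarrow> real)"
      by (intro integrable_const_bound[where B = 1]) auto
    show "integrable M f" by (intro integrable_const_bound[where B = B]) (use f in auto)
    show "indicator {x. r < norm x} x \<le> f x" for x using f(2) le by (auto simp: indicator_def)
  qed
  finally show ?thesis .
qed

lemma nn_integral_prob_bounded:
  assumes M: "M \<in> space (prob_algebra borel)" and f: "f \<in> borel_measurable borel" "\<And>x. 0 \<le> f x" "\<And>x. f x \<le> B"
  shows "(\<integral>\<^sup>+x. ennreal (f x) \<partial>M) = ennreal (\<integral>x. f x \<partial>M)"
proof -
  interpret prob_space M using prob_algebraD[OF M] by simp
  have [measurable_cong]: "sets M = sets borel" using prob_algebraD[OF M] by auto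
  show ?thesis
    by (intro nn_integral_eq_integral integrable_const_bound[where B = B]) (use f in auto)
qed

lemma fst_snd_measurable [measurable]:
  "(fst :: 'a::euclidean_space \<times> 'a \<Rightarrow> 'a) \<in> borel_measurable borel"
  "(snd :: 'a::euclidean_space \<times> 'a \<Rightarrow> 'a) \<in> borel_measurable borel"
  by (auto intro!: borel_measurable_continuous_onI continuous_intros)

section \<open>The synchronously coupled chain\<close>

context euler_scheme
begin

text \<open>A single index \<open>snd p\<close> drives both components: each of them performs the
  walk, and the noise cancels in their difference.\<close>

definition kstep :: "real \<Rightarrow> ((real ^ 'n) \<times> (real ^ 'n)) measure \<Rightarrow> ((real ^ 'n) \<times> (real ^ 'n)) measure" where
  "kstep h \<pi> = distr (\<pi> \<Otimes>\<^sub>M measure_pmf (pmf_of_set J)) borel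
     (\<lambda>p. (F h (snd p) (fst (fst p)), F h (snd p) (snd (fst p))))"

lemma b_measurable [measurable]: "b \<in> borel_measurable borel"
  by (rule differentiable_imp_measurable[OF b_diff])

lemma F_measurable [measurable]: "F h j \<in> borel_measurable borel"
  unfolding F_def[abs_def] drift_def by measurable

lemma K_measurable: "g \<in> borel_measurable borel \<Longrightarrow> K h g \<in> borel_measurable borel"
  unfolding avg_def[abs_def]
  by (intro borel_measurable_divide borel_measurable_sum borel_measurable_const measurable_compose[OF F_measurable])

lemma kstep_map_measurable:
  assumes "\<pi> \<in> space (prob_algebra borel)"
  shows "(\<lambda>p. (F h (snd p) (fst (fst p)), F h (snd p) (snd (fst p))))
    \<in> \<pi> \<Otimes>\<^sub>M measure_pmf (pmf_of_set J) \<rightarrow>\<^sub>M borel"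
proof -
  have [measurable_cong]: "sets \<pi> = sets borel" using prob_algebraD[OF assms] by simp
  show ?thesis
  proof (rule measurable_compose_countable[where g = snd and f = "\<lambda>j p. (F h j (fst (fst p)), F h j (snd (fst p)))"])
    fix j :: "nat \<times> bool"
    have "(\<lambda>z. (F h j (fst z), F h j (snd z))) \<in> borel \<rightarrow>\<^sub>M borel"
      by (intro borel_measurable_Pair measurable_compose[OF _ F_measurable]) (auto intro!: borel_measurable_continuous_onI continuous_intros)
    hence "(\<lambda>z. (F h j (fst z), F h j (snd z))) \<in> \<pi> \<rightarrow>\<^sub>M borel"
      by (simp add: prob_algebra_measurable_iff[OF assms])
    from measurable_compose[OF measurable_fst this]
    show "(\<lambda>p. (F h j (fst (fst p)), F h j (snd (fst p)))) \<in> \<pi> \<Otimes>\<^sub>M measure_pmf (pmf_of_set J) \<rightarrow>\<^sub>M borel" .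
    show "snd \<in> \<pi> \<Otimes>\<^sub>M measure_pmf (pmf_of_set J) \<rightarrow>\<^sub>M count_space UNIV"
      using measurable_snd[of \<pi> "measure_pmf (pmf_of_set J)"] by simp
  qed
qed

lemma kstep_prob:
  assumes "\<pi> \<in> space (prob_algebra borel)"
  shows "kstep h \<pi> \<in> space (prob_algebra borel)"
proof -
  interpret p: prob_space \<pi> using prob_algebraD[OF assms] by simp
  interpret pp: pair_prob_space \<pi> "measure_pmf (pmf_of_set J)" by unfold_locales
  have "prob_space (kstep h \<pi>)"
    unfolding kstep_def by (rule pp.prob_space_distr[OF kstep_map_measurable[OF assms]])
  thus ?thesis by (simp add: space_prob_algebra kstep_def)
qed

lemma kstep_nn_integral:
  assumes \<pi>: "\<pi> \<in> space (prob_algebra borel)" and f: "f \<in> borel_measurable borel"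
  shows "(\<integral>\<^sup>+z. f z \<partial>kstep h \<pi>) = (\<integral>\<^sup>+z. (\<Sum>j\<in>J. f (F h j (fst z), F h j (snd z))) / card J \<partial>\<pi>)"
proof -
  note T = kstep_map_measurable[OF \<pi>, of h]
  have "(\<integral>\<^sup>+z. f z \<partial>kstep h \<pi>) = (\<integral>\<^sup>+p. f (F h (snd p) (fst (fst p)), F h (snd p) (snd (fst p))) \<partial>(\<pi> \<Otimes>\<^sub>M measure_pmf (pmf_of_set J)))"
    unfolding kstep_def by (subst nn_integral_distr[OF T]) (use f in auto)
  also have "\<dots> = (\<integral>\<^sup>+z. \<integral>\<^sup>+j. f (F h j (fst z), F h j (snd z)) \<partial>measure_pmf (pmf_of_set J) \<partial>\<pi>)"
    using measure_pmf.nn_integral_fst[OF measurable_compose[OF T f]] by simp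
  also have "\<dots> = (\<integral>\<^sup>+z. (\<Sum>j\<in>J. f (F h j (fst z), F h j (snd z))) / card J \<partial>\<pi>)"
    using J by (simp add: nn_integral_pmf_of_set)
  finally show ?thesis .
qed

lemma kstep_integral:
  fixes f :: "(real ^ 'n) \<times> (real ^ 'n) \<Rightarrow> real"
  assumes \<pi>: "\<pi> \<in> space (prob_algebra borel)" and f: "f \<in> borel_measurable borel" "\<And>z. \<bar>f z\<bar> \<le> B"
  shows "(\<integral>z. f z \<partial>kstep h \<pi>) = (\<integral>z. (\<Sum>j\<in>J. f (F h j (fst z), F h j (snd z))) / card J \<partial>\<pi>)"
proof -
  interpret p: prob_space \<pi> using prob_algebraD[OF \<pi>] by simp
  interpret pp: pair_prob_space \<pi> "measure_pmf (pmf_of_set J)" by unfold_locales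
  note T = kstep_map_measurable[OF \<pi>, of h]
  have "(\<integral>z. f z \<partial>kstep h \<pi>) = (\<integral>p. f (F h (snd p) (fst (fst p)), F h (snd p) (snd (fst p))) \<partial>(\<pi> \<Otimes>\<^sub>M measure_pmf (pmf_of_set J)))"
    unfolding kstep_def by (rule integral_distr[OF T f(1)])
  also have "\<dots> = (\<integral>z. \<integral>j. f (F h j (fst z), F h j (snd z)) \<partial>measure_pmf (pmf_of_set J) \<partial>\<pi>)"
  proof -
    have "integrable (\<pi> \<Otimes>\<^sub>M measure_pmf (pmf_of_set J)) (\<lambda>p. f (F h (snd p) (fst (fst p)), F h (snd p) (snd (fst p))))"
      by (rule pp.P.integrable_const_bound[where B = B]) (use f measurable_compose[OF T f(1)] in auto)
    from pp.integral_fst'[OF this] show ?thesis by simp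
  qed
  also have "\<dots> = (\<integral>z. (\<Sum>j\<in>J. f (F h j (fst z), F h j (snd z))) / card J \<partial>\<pi>)"
    using J by (simp add: integral_pmf_of_set)
  finally show ?thesis .
qed

lemma kstep_iter_prob:
  "\<pi> \<in> space (prob_algebra borel) \<Longrightarrow> (kstep h ^^ m) \<pi> \<in> space (prob_algebra borel)"
  by (induction m) (auto intro: kstep_prob)

text \<open>Both marginals at once: \<open>pr\<close> stands for either projection, and the
  condition on it says that a coupled step projects to a step of the walk. The induction shifts one
  step at a time from the measure to the function.\<close>

lemma kstep_iter_integral:
  assumes \<pi>: "\<pi> \<in> space (prob_algebra borel)" and g: "g \<in> borel_measurable borel" "\<And>x. \<bar>g x\<bar> \<le> B"
    and pr: "pr \<in> borel_measurable borel" "\<And>j z. pr (F h j (fst z), F h j (snd z)) = F h j (pr z)"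
  shows "(\<integral>z. g (pr z) \<partial>(kstep h ^^ m) \<pi>) = (\<integral>z. (K h ^^ m) g (pr z) \<partial>\<pi>)"
  using g
proof (induction m arbitrary: g)
  case (Suc m)
  have Kg: "K h g \<in> borel_measurable borel" "\<And>x. \<bar>K h g x\<bar> \<le> B"
    using K_measurable[OF Suc.prems(1)] avg_iter_abs_le[OF J Suc.prems(2), where m = 1 and F = "F h"] by auto
  have "(\<integral>z. g (pr z) \<partial>(kstep h ^^ Suc m) \<pi>) = (\<integral>z. K h g (pr z) \<partial>(kstep h ^^ m) \<pi>)"
    using kstep_integral[OF kstep_iter_prob[OF \<pi>] measurable_compose[OF pr(1) Suc.prems(1)] Suc.prems(2)]
    by (simp add: avg_def pr(2))
  thus ?case using Suc.IH[OF Kg] by (simp add: funpow_swap1)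
qed auto

definition qcost :: "(real ^ 'n) \<times> (real ^ 'n) \<Rightarrow> real" where "qcost z = q (fst z - snd z)"

lemma qcost_continuous: "continuous_on A qcost"
  unfolding qcost_def q_def
  by (intro continuous_intros matrix_vector_mult_linear_continuous_on[THEN continuous_on_compose2]) auto

lemma qcost_measurable [measurable]: "qcost \<in> borel_measurable borel"
  by (rule borel_measurable_continuous_onI[OF qcost_continuous])

text \<open>The bound \<open>q_F\<close> holds for each index \<open>j\<close>, hence for the mean.
  The initial cost may be infinite, so the estimate is made with nonnegative integrals.\<close>

lemma kstep_iter_cost:
  assumes \<pi>: "\<pi> \<in> space (prob_algebra borel)" and h: "0 < h" "h \<le> h\<^sub>0"
  shows "(\<integral>\<^sup>+z. ennreal (qcost z) \<partial>(kstep h ^^ m) \<pi>) \<le> ennreal ((1 - \<kappa> * h) ^ m) * (\<integral>\<^sup>+z. ennreal (qcost z) \<partial>\<pi>)"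
proof (induction m)
  case (Suc m)
  note p = kstep_iter_prob[OF \<pi>, where h = h and m = m]
  have r: "1 - \<kappa> * h \<ge> 0" using kappa_h[OF h] by simp
  have [measurable_cong]: "sets ((kstep h ^^ m) \<pi>) = sets borel" using prob_algebraD[OF p] by simp
  have "(\<integral>\<^sup>+z. ennreal (qcost z) \<partial>(kstep h ^^ Suc m) \<pi>)
     = (\<integral>\<^sup>+z. (\<Sum>j\<in>J. ennreal (qcost (F h j (fst z), F h j (snd z)))) / card J \<partial>(kstep h ^^ m) \<pi>)"
    by (simp add: kstep_nn_integral[OF p])
  also have "\<dots> \<le> (\<integral>\<^sup>+z. ennreal (1 - \<kappa> * h) * ennreal (qcost z) \<partial>(kstep h ^^ m) \<pi>)"
  proof (rule nn_integral_mono)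
    fix z
    have "(\<Sum>j\<in>J. qcost (F h j (fst z), F h j (snd z))) \<le> (\<Sum>j\<in>J. (1 - \<kappa> * h) * qcost z)"
      using q_F[OF h] by (intro sum_mono) (auto simp: qcost_def)
    hence "(\<Sum>j\<in>J. qcost (F h j (fst z), F h j (snd z))) / card J \<le> (1 - \<kappa> * h) * qcost z"
      using card_J[OF J] by (simp add: divide_le_eq mult_ac)
    moreover have "(\<Sum>j\<in>J. ennreal (qcost (F h j (fst z), F h j (snd z)))) / card J
        = ennreal ((\<Sum>j\<in>J. qcost (F h j (fst z), F h j (snd z))) / card J)"
      using card_J[OF J] q_nonneg
      by (subst sum_ennreal) (auto simp: qcost_def divide_ennreal sum_nonneg ennreal_of_nat_eq_real_of_nat)
    ultimately show "(\<Sum>j\<in>J. ennreal (qcost (F h j (fst z), F h j (snd z)))) / card J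
        \<le> ennreal (1 - \<kappa> * h) * ennreal (qcost z)"
      using r by (simp add: ennreal_mult'[symmetric] ennreal_leI)
  qed
  also have "\<dots> = ennreal (1 - \<kappa> * h) * (\<integral>\<^sup>+z. ennreal (qcost z) \<partial>(kstep h ^^ m) \<pi>)"
    by (intro nn_integral_cmult) measurable
  also have "\<dots> \<le> ennreal (1 - \<kappa> * h) * (ennreal ((1 - \<kappa> * h) ^ m) * (\<integral>\<^sup>+z. ennreal (qcost z) \<partial>\<pi>))"
    by (intro mult_left_mono Suc) auto
  also have "\<dots> = ennreal ((1 - \<kappa> * h) ^ Suc m) * (\<integral>\<^sup>+z. ennreal (qcost z) \<partial>\<pi>)"
    using r by (simp add: ennreal_mult' mult.assoc)
  finally show ?case .
qed simp

text \<open>Truncated at 1, since an initial law may have infinite second moment; its integral still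
  tends to 0 with growing \<open>R\<close>, by dominated convergence.\<close>

definition tail_bound :: "real \<Rightarrow> real ^ 'n \<Rightarrow> real" where
  "tail_bound R x = min 1 ((q x + 2 * d\<^sub>m 0 / \<kappa>) / (R * l\<^sub>1))"

lemma q_measurable [measurable]: "q \<in> borel_measurable borel"
  unfolding q_def[abs_def]
  by (intro borel_measurable_continuous_onI continuous_intros matrix_vector_mult_linear_continuous_on[THEN continuous_on_compose2]) auto

lemma tail_bound_measurable [measurable]: "tail_bound R \<in> borel_measurable borel"
  unfolding tail_bound_def[abs_def] by measurable

text \<open>\<open>cutoff R\<close> is at most \<open>q\<close> divided by
  \<open>R * l\<^sub>1\<close>, and the moment bound about 0 is uniform in \<open>N\<close> and
  \<open>t\<close>; so is therefore the tail estimate.\<close>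

lemma eflow_cutoff:
  assumes h: "hs N \<le> h\<^sub>0" and R: "R \<ge> 1"
  shows "eflow N (cutoff R) t x \<le> tail_bound R x"
proof -
  have Rl: "R * l\<^sub>1 > 0" using R l1_pos by simp
  have "eflow N (cutoff R) t x \<le> (K (hs N) ^^ nat \<lfloor>t / hs N\<rfloor>) (\<lambda>y. (1 / (R * l\<^sub>1)) * q (y - 0)) x"
    unfolding eflow_def
  proof (rule avg_iter_mono[OF J])
    fix y :: "real ^ 'n"
    have "cutoff R y \<le> (y \<bullet> y) / R" by (rule cutoff_bounds[OF R])
    also have "\<dots> \<le> (q y / l\<^sub>1) / R"
      using q_lower[of y] l1_pos R by (intro divide_right_mono) (auto simp: power2_norm_eq_inner pos_le_divide_eq mult.commute)
    finally show "cutoff R y \<le> (1 / (R * l\<^sub>1)) * q (y - 0)" by (simp add: mult.commute)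
  qed
  also have "\<dots> = (1 / (R * l\<^sub>1)) * (K (hs N) ^^ nat \<lfloor>t / hs N\<rfloor>) (\<lambda>y. q (y - 0)) x"
    by (simp only: avg_iter_cmult[OF J])
  also have "\<dots> \<le> (1 / (R * l\<^sub>1)) * (q (x - 0) + 2 * d\<^sub>m 0 / \<kappa>)"
    using Rl by (intro mult_left_mono K_iter_moment_bounded hs h) auto
  finally have "eflow N (cutoff R) t x \<le> (q x + 2 * d\<^sub>m 0 / \<kappa>) / (R * l\<^sub>1)" by simp
  moreover have "\<bar>cutoff R y\<bar> \<le> 1" for y :: "real ^ 'n" using cutoff_bounds[OF R, of y] by simp
  hence "\<bar>eflow N (cutoff R) t x\<bar> \<le> 1" by (rule eflow_bound)
  ultimately show ?thesis by (simp add: tail_bound_def)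
qed

lemma tail_bound_bounds: "R \<ge> 1 \<Longrightarrow> 0 \<le> tail_bound R x" "tail_bound R x \<le> 1"
  using q_nonneg[of x] dm_nonneg[of 0] kappa_pos l1_pos by (auto simp: tail_bound_def)

lemma tail_bound_integral:
  assumes N: "N \<in> space (prob_algebra borel)" and e: "e > 0"
  obtains r where "r \<ge> 1" "(\<integral>x. tail_bound (r\<^sup>2) x \<partial>N) \<le> e"
proof -
  interpret prob_space N using prob_algebraD[OF N] by simp
  have [measurable_cong]: "sets N = sets borel" using prob_algebraD[OF N] by simp
  have "(\<lambda>k. \<integral>x. tail_bound ((real (Suc k))\<^sup>2) x \<partial>N) \<longlonglongrightarrow> (\<integral>x. 0 \<partial>N)"
  proof (rule integral_dominated_convergence[where w = "\<lambda>_. 1"])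
    show "AE x in N. (\<lambda>k. tail_bound ((real (Suc k))\<^sup>2) x) \<longlonglongrightarrow> 0"
    proof (rule AE_I2)
      fix x
      have lim: "(\<lambda>k. (q x + 2 * d\<^sub>m 0 / \<kappa>) / l\<^sub>1 * (inverse (real (Suc k)))\<^sup>2) \<longlonglongrightarrow> (q x + 2 * d\<^sub>m 0 / \<kappa>) / l\<^sub>1 * 0\<^sup>2"
        by (intro tendsto_intros LIMSEQ_inverse_real_of_nat)
      have eq: "(q x + 2 * d\<^sub>m 0 / \<kappa>) / l\<^sub>1 * (inverse (real (Suc k)))\<^sup>2 = (q x + 2 * d\<^sub>m 0 / \<kappa>) / ((real (Suc k))\<^sup>2 * l\<^sub>1)" for k
        by (simp add: divide_inverse power_inverse mult_ac del: of_nat_Suc)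
      show "(\<lambda>k. tail_bound ((real (Suc k))\<^sup>2) x) \<longlonglongrightarrow> 0"
      proof (rule tendsto_sandwich[OF _ _ tendsto_const])
        show "(\<lambda>k. (q x + 2 * d\<^sub>m 0 / \<kappa>) / ((real (Suc k))\<^sup>2 * l\<^sub>1)) \<longlonglongrightarrow> 0" using lim unfolding eq by simp
        show "\<forall>\<^sub>F k in sequentially. 0 \<le> tail_bound ((real (Suc k))\<^sup>2) x"
          by (intro always_eventually allI tail_bound_bounds one_le_power) simp
        show "\<forall>\<^sub>F k in sequentially. tail_bound ((real (Suc k))\<^sup>2) x \<le> (q x + 2 * d\<^sub>m 0 / \<kappa>) / ((real (Suc k))\<^sup>2 * l\<^sub>1)"
          by (intro always_eventually allI) (simp add: tail_bound_def del: of_nat_Suc)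
      qed
    qed
    show "AE x in N. norm (tail_bound ((real (Suc k))\<^sup>2) x) \<le> 1" for k
    proof (rule AE_I2)
      have "(real (Suc k))\<^sup>2 \<ge> 1" by (intro one_le_power) simp
      thus "norm (tail_bound ((real (Suc k))\<^sup>2) x) \<le> 1" for x
        using tail_bound_bounds[of "(real (Suc k))\<^sup>2" x] by simp
    qed
  qed auto
  hence "(\<lambda>k. \<integral>x. tail_bound ((real (Suc k))\<^sup>2) x \<partial>N) \<longlonglongrightarrow> 0" by simp
  hence "\<forall>\<^sub>F k in sequentially. (\<integral>x. tail_bound ((real (Suc k))\<^sup>2) x \<partial>N) < e" by (rule order_tendstoD(2)[OF _ e])
  then obtain k where "(\<integral>x. tail_bound ((real (Suc k))\<^sup>2) x \<partial>N) < e" unfolding eventually_sequentially by blast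
  thus thesis using that[of "real (Suc k)"] by simp
qed

end

section \<open>Wasserstein contraction and the invariant measure\<close>

lemma ennreal_sqrt_mono: "x \<le> y \<Longrightarrow> ennreal_sqrt x \<le> ennreal_sqrt y"
  by (auto simp: ennreal_sqrt_def top_unique less_top[symmetric] intro!: ennreal_leI real_sqrt_le_mono enn2real_mono)

lemma ennreal_sqrt_mult:
  assumes "c > 0"
  shows "ennreal_sqrt (ennreal c * x) = ennreal (sqrt c) * ennreal_sqrt x"
proof (cases x)
  case (real r)
  hence eq: "ennreal c * x = ennreal (c * r)" using assms by (simp add: ennreal_mult)
  show ?thesis unfolding eq using real assms by (simp add: ennreal_sqrt_def real_sqrt_mult ennreal_mult[symmetric])
next
  case top
  thus ?thesis using assms by (simp add: ennreal_sqrt_def ennreal_mult_top)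
qed

lemma W2_commute: "W2 \<nu>\<^sub>1 \<nu>\<^sub>2 = W2 \<nu>\<^sub>2 (\<nu>\<^sub>1 :: 'a::euclidean_space measure)"
proof -
  have le: "W2 \<nu>\<^sub>2 \<nu>\<^sub>1 \<le> W2 \<nu>\<^sub>1 \<nu>\<^sub>2" for \<nu>\<^sub>1 \<nu>\<^sub>2 :: "'a measure"
    unfolding W2_def
  proof (rule INF_greatest)
    fix \<pi> assume \<pi>: "\<pi> \<in> couplings \<nu>\<^sub>1 \<nu>\<^sub>2"
    hence p: "\<pi> \<in> space (prob_algebra borel)" by (simp add: couplings_def)
    interpret prob_space \<pi> using prob_algebraD[OF p] by simp
    have [measurable_cong]: "sets \<pi> = sets borel" using prob_algebraD[OF p] by simp
    have sw: "(\<lambda>z. (snd z, fst z)) \<in> borel \<rightarrow>\<^sub>M (borel :: ('a \<times> 'a) measure)"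
      by (intro borel_measurable_continuous_onI continuous_intros)
    hence sw\<pi>: "(\<lambda>z. (snd z, fst z)) \<in> \<pi> \<rightarrow>\<^sub>M borel" by simp
    let ?\<pi> = "distr \<pi> borel (\<lambda>z. (snd z, fst z))"
    have "?\<pi> \<in> space (prob_algebra borel)" using prob_space_distr[OF sw\<pi>] by (simp add: space_prob_algebra)
    moreover have "distr ?\<pi> borel fst = \<nu>\<^sub>2" "distr ?\<pi> borel snd = \<nu>\<^sub>1"
      using \<pi> sw\<pi> by (simp_all add: distr_distr o_def couplings_def fst_snd_measurable)
    ultimately have "?\<pi> \<in> couplings \<nu>\<^sub>2 \<nu>\<^sub>1" by (simp add: couplings_def)
    moreover have "(\<integral>\<^sup>+(x, y). ennreal ((norm (x - y))\<^sup>2) \<partial>?\<pi>) = (\<integral>\<^sup>+(x, y). ennreal ((norm (x - y))\<^sup>2) \<partial>\<pi>)"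
    proof -
      have "(\<lambda>(x, y). ennreal ((norm (x - y))\<^sup>2)) \<in> borel_measurable (borel :: ('a \<times> 'a) measure)"
        unfolding case_prod_beta
        by (intro measurable_compose[OF _ measurable_ennreal] borel_measurable_continuous_onI continuous_intros)
      thus ?thesis
        by (subst nn_integral_distr[OF sw\<pi>]) (simp_all add: case_prod_unfold norm_minus_commute)
    qed
    ultimately show "(INF \<pi>\<in>couplings \<nu>\<^sub>2 \<nu>\<^sub>1. ennreal_sqrt (\<integral>\<^sup>+(x, y). ennreal ((norm (x - y))\<^sup>2) \<partial>\<pi>))
        \<le> ennreal_sqrt (\<integral>\<^sup>+(x, y). ennreal ((norm (x - y))\<^sup>2) \<partial>\<pi>)"
      by (metis (no_types, lifting) INF_lower)
  qed
  show ?thesis by (intro antisym le)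
qed

section \<open>Weak limits of couplings\<close>

context euler_semigroup
begin

lemma eflow_measurable: "nice f \<Longrightarrow> eflow N f t \<in> borel_measurable borel"
  unfolding eflow_def[abs_def] by (auto simp: nice_def intro!: differentiable_imp_measurable K_iter_differentiable)

lemma nice_P_continuous: "nice f \<Longrightarrow> t \<ge> 0 \<Longrightarrow> continuous_on UNIV (P t f)"
  using nice_continuous[of f UNIV] by (intro P_continuous) (auto simp: nice_def)

lemma nice_P_measurable: "nice f \<Longrightarrow> t \<ge> 0 \<Longrightarrow> P t f \<in> borel_measurable borel"
  by (intro borel_measurable_continuous_onI nice_P_continuous)

lemma nice_P_bounded:
  assumes "nice f" "t \<ge> 0"
  shows "bounded (range (P t f))" "P t f \<in> bounded_borel"
proof -
  obtain B where "\<And>x. \<bar>f x\<bar> \<le> B" using niceE[OF assms(1)] by metis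
  from P_abs_le[OF assms this] show "bounded (range (P t f))" unfolding bounded_iff by auto
  thus "P t f \<in> bounded_borel" using nice_P_measurable[OF assms] by (simp add: bounded_borel_def)
qed

lemma eflow_integral_tendsto:
  assumes N: "\<nu> \<in> space (prob_algebra borel)" and f: "nice f" and t: "t \<ge> 0"
  shows "(\<lambda>N. \<integral>x. eflow N f t x \<partial>\<nu>) \<longlonglongrightarrow> (\<integral>x. P t f x \<partial>\<nu>)"
proof -
  interpret prob_space \<nu> using prob_algebraD[OF N] by simp
  obtain B where B: "\<And>x. \<bar>f x\<bar> \<le> B" using niceE[OF f] by metis
  show ?thesis
  proof (rule integral_dominated_convergence[where w = "\<lambda>_. B"])
    show "P t f \<in> borel_measurable \<nu>" "eflow N f t \<in> borel_measurable \<nu>" for N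
      using nice_P_measurable[OF f t] eflow_measurable[OF f] by (simp_all add: prob_algebra_measurable_iff[OF N])
    show "AE x in \<nu>. (\<lambda>N. eflow N f t x) \<longlonglongrightarrow> P t f x" by (intro AE_I2 eflow_tendsto_P f t)
    show "AE x in \<nu>. norm (eflow N f t x) \<le> B" for N using eflow_bound[OF B] by simp
  qed simp
qed

lemma cutoff_pair_le:
  fixes z :: "'a::euclidean_space \<times> 'a"
  assumes "r \<ge> 1" "2 * r < norm z"
  shows "1 \<le> 2 * cutoff (r\<^sup>2) (fst z) + 2 * cutoff (r\<^sup>2) (snd z)"
proof -
  have r2: "r\<^sup>2 \<ge> 1" using assms(1) by (simp add: one_le_power)
  have "norm z \<le> norm (fst z) + norm (snd z)" by (metis norm_Pair_le prod.collapse)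
  hence "r < norm (fst z) \<or> r < norm (snd z)" using assms(2) by linarith
  thus ?thesis
    using cutoff_ge[OF assms(1), of "fst z"] cutoff_ge[OF assms(1), of "snd z"]
      cutoff_bounds(1)[OF r2, of "fst z"] cutoff_bounds(1)[OF r2, of "snd z"] by auto
qed

text \<open>At a fixed step size the coupled chain couples the two laws of the walk at a contracted
  cost. A weak limit has the right marginals, which are identified through nice functions, and it
  does not increase the cost, because that is a supremum of integrals of bounded continuous
  functions.\<close>

theorem coupling_contraction:
  assumes \<nu>: "\<nu>\<^sub>1 \<in> space (prob_algebra borel)" "\<nu>\<^sub>2 \<in> space (prob_algebra borel)"
    and \<pi>: "\<pi> \<in> couplings \<nu>\<^sub>1 \<nu>\<^sub>2" and t: "t \<ge> 0"
  obtains \<pi>' where "\<pi>' \<in> couplings (dual_action (P t) \<nu>\<^sub>1) (dual_action (P t) \<nu>\<^sub>2)"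
    "(\<integral>\<^sup>+z. ennreal (qcost z) \<partial>\<pi>') \<le> ennreal (exp (- \<kappa> * t)) * (\<integral>\<^sup>+z. ennreal (qcost z) \<partial>\<pi>)"
proof -
  have \<pi>p: "\<pi> \<in> space (prob_algebra borel)" and marg: "distr \<pi> borel fst = \<nu>\<^sub>1" "distr \<pi> borel snd = \<nu>\<^sub>2"
    using \<pi> by (auto simp: couplings_def)
  obtain N1 where N1: "\<And>N. N \<ge> N1 \<Longrightarrow> hs N \<le> h\<^sub>0" using eventually_hs by blast
  define m where "m N = nat \<lfloor>t / hs N\<rfloor>" for N
  \<comment> \<open>The shift by \<open>N1\<close> makes every step size at most
    \<open>h\<^sub>0\<close>.\<close>
  define Q where "Q k = (kstep (hs (k + N1)) ^^ m (k + N1)) \<pi>" for k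
  have Q: "Q k \<in> space (prob_algebra borel)" for k unfolding Q_def by (rule kstep_iter_prob[OF \<pi>p])
  have im: "(\<integral>z. g (fst z) \<partial>\<pi>) = (\<integral>x. g x \<partial>\<nu>\<^sub>1)" "(\<integral>z. g (snd z) \<partial>\<pi>) = (\<integral>x. g x \<partial>\<nu>\<^sub>2)"
    if "g \<in> borel_measurable borel" for g :: "real ^ 'n \<Rightarrow> real"
    unfolding marg[symmetric]
    using that fst_snd_measurable by (simp_all add: integral_distr prob_algebra_measurable_iff[OF \<pi>p])
  have Qint: "(\<integral>z. g (fst z) \<partial>Q k) = (\<integral>x. eflow (k + N1) g t x \<partial>\<nu>\<^sub>1)"
    "(\<integral>z. g (snd z) \<partial>Q k) = (\<integral>x. eflow (k + N1) g t x \<partial>\<nu>\<^sub>2)" if g: "nice g" for g k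
  proof -
    obtain B where B: "\<And>x. \<bar>g x\<bar> \<le> B" using niceE[OF g] by metis
    note em = eflow_measurable[OF g, of "k + N1" t]
    have "(\<integral>z. g (fst z) \<partial>Q k) = (\<integral>z. eflow (k + N1) g t (fst z) \<partial>\<pi>)"
      unfolding Q_def eflow_def m_def
      by (rule kstep_iter_integral[OF \<pi>p nice_measurable[OF g] B]) (auto intro: fst_snd_measurable)
    thus "(\<integral>z. g (fst z) \<partial>Q k) = (\<integral>x. eflow (k + N1) g t x \<partial>\<nu>\<^sub>1)" using im(1)[OF em] by simp
    have "(\<integral>z. g (snd z) \<partial>Q k) = (\<integral>z. eflow (k + N1) g t (snd z) \<partial>\<pi>)"
      unfolding Q_def eflow_def m_def
      by (rule kstep_iter_integral[OF \<pi>p nice_measurable[OF g] B]) (auto intro: fst_snd_measurable)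
    thus "(\<integral>z. g (snd z) \<partial>Q k) = (\<integral>x. eflow (k + N1) g t x \<partial>\<nu>\<^sub>2)" using im(2)[OF em] by simp
  qed
  have tight: "\<exists>R. \<forall>k. measure (Q k) {z. R < norm z} \<le> e" if e: "e > 0" for e
  proof -
    \<comment> \<open>A quarter of \<open>e\<close> for each law, as \<open>cutoff_pair_le\<close>
      has one term per marginal, each with the factor 2.\<close>
    obtain r1 where r1: "r1 \<ge> 1" "(\<integral>x. tail_bound (r1\<^sup>2) x \<partial>\<nu>\<^sub>1) \<le> e / 4"
      using tail_bound_integral[OF \<nu>(1), of "e / 4"] e by auto
    obtain r2 where r2: "r2 \<ge> 1" "(\<integral>x. tail_bound (r2\<^sup>2) x \<partial>\<nu>\<^sub>2) \<le> e / 4"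
      using tail_bound_integral[OF \<nu>(2), of "e / 4"] e by auto
    define r where "r = max r1 r2"
    have r: "r \<ge> 1" "r\<^sup>2 \<ge> 1" "r1\<^sup>2 \<ge> 1" "r2\<^sup>2 \<ge> 1" "r1\<^sup>2 \<le> r\<^sup>2" "r2\<^sup>2 \<le> r\<^sup>2"
      using r1 r2 by (auto simp: r_def one_le_power intro!: power_mono)
    have anti: "tail_bound R' x \<le> tail_bound R x" if "1 \<le> R" "R \<le> R'" for R R' x
      unfolding tail_bound_def using that q_nonneg[of x] dm_nonneg[of 0] kappa_pos l1_pos
      by (intro min.mono order_refl divide_left_mono mult_right_mono) auto
    have bd: "(\<integral>x. eflow (k + N1) (cutoff (r\<^sup>2)) t x \<partial>\<nu>) \<le> e / 4"
      if \<nu>: "\<nu> \<in> space (prob_algebra borel)" and i: "(\<integral>x. tail_bound R x \<partial>\<nu>) \<le> e / 4" "1 \<le> R" "R \<le> r\<^sup>2" for \<nu> R k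
    proof -
      interpret prob_space \<nu> using prob_algebraD[OF \<nu>] by simp
      have "(\<integral>x. eflow (k + N1) (cutoff (r\<^sup>2)) t x \<partial>\<nu>) \<le> (\<integral>x. tail_bound R x \<partial>\<nu>)"
      proof (rule integral_mono)
        have "\<bar>cutoff (r\<^sup>2) y\<bar> \<le> 1" for y :: "real ^ 'n" using cutoff_bounds[OF r(2), of y] by simp
        hence "\<bar>eflow (k + N1) (cutoff (r\<^sup>2)) t x\<bar> \<le> 1" for x by (rule eflow_bound)
        thus "integrable \<nu> (eflow (k + N1) (cutoff (r\<^sup>2)) t)"
          using eflow_measurable[OF cutoff_nice[OF r(2)]]
          by (intro integrable_const_bound[where B = 1]) (auto simp: prob_algebra_measurable_iff[OF \<nu>])
        show "integrable \<nu> (tail_bound R)"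
          using tail_bound_bounds(1)[OF i(2)] tail_bound_bounds(2)
          by (intro integrable_const_bound[where B = 1]) (auto simp: prob_algebra_measurable_iff[OF \<nu>])
        show "eflow (k + N1) (cutoff (r\<^sup>2)) t x \<le> tail_bound R x" for x
          using order_trans[OF eflow_cutoff[OF N1 r(2)] anti[OF i(2,3)], of "k + N1"] by simp
      qed
      thus ?thesis using i(1) by linarith
    qed
    have "measure (Q k) {z. 2 * r < norm z} \<le> e" for k
    proof -
      interpret prob_space "Q k" using prob_algebraD[OF Q] by simp
      have cm: "cutoff (r\<^sup>2) \<in> borel_measurable (borel :: (real ^ 'n) measure)" by (rule nice_measurable[OF cutoff_nice[OF r(2)]])
      note cm' = measurable_compose[OF fst_snd_measurable(1) cm] measurable_compose[OF fst_snd_measurable(2) cm]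
      note cb = cutoff_bounds[OF r(2)]
      have ca: "\<bar>cutoff (r\<^sup>2) y\<bar> \<le> 1" for y :: "real ^ 'n" using cb(1,2)[of y] by simp
      have i: "integrable (Q k) (\<lambda>z. cutoff (r\<^sup>2) (fst z))" "integrable (Q k) (\<lambda>z. cutoff (r\<^sup>2) (snd z))"
        using ca cm' by (auto intro!: integrable_const_bound[where B = 1] simp: prob_algebra_measurable_iff[OF Q])
      have "measure (Q k) {z. 2 * r < norm z} \<le> (\<integral>z. 2 * cutoff (r\<^sup>2) (fst z) + 2 * cutoff (r\<^sup>2) (snd z) \<partial>Q k)"
      proof (rule prob_algebra_tail_le[OF Q])
        show "(\<lambda>z :: (real ^ 'n) \<times> (real ^ 'n). 2 * cutoff (r\<^sup>2) (fst z) + 2 * cutoff (r\<^sup>2) (snd z)) \<in> borel_measurable borel"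
          using cm' by (intro borel_measurable_add borel_measurable_times borel_measurable_const)
        show "0 \<le> 2 * cutoff (r\<^sup>2) (fst z) + 2 * cutoff (r\<^sup>2) (snd z)"
          "2 * cutoff (r\<^sup>2) (fst z) + 2 * cutoff (r\<^sup>2) (snd z) \<le> 4" for z :: "(real ^ 'n) \<times> (real ^ 'n)"
          using cb(1)[of "fst z"] cb(1)[of "snd z"] cb(2)[of "fst z"] cb(2)[of "snd z"] by linarith+
      qed (rule cutoff_pair_le[OF r(1)])
      also have "\<dots> = 2 * (\<integral>z. cutoff (r\<^sup>2) (fst z) \<partial>Q k) + 2 * (\<integral>z. cutoff (r\<^sup>2) (snd z) \<partial>Q k)"
        using i by simp
      also have "\<dots> \<le> 2 * (e / 4) + 2 * (e / 4)"
        unfolding Qint[OF cutoff_nice[OF r(2)]]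
        using bd[OF \<nu>(1) r1(2) r(3,5)] bd[OF \<nu>(2) r2(2) r(4,6)] by (intro add_mono mult_left_mono) auto
      finally show ?thesis by simp
    qed
    thus ?thesis by blast
  qed
  obtain r \<pi>' where r: "strict_mono (r :: nat \<Rightarrow> nat)" and \<pi>': "\<pi>' \<in> space (prob_algebra borel)"
    and lim: "\<And>f :: (real ^ 'n) \<times> (real ^ 'n) \<Rightarrow> real. continuous_on UNIV f \<Longrightarrow> bounded (range f) \<Longrightarrow>
       (\<lambda>k. \<integral>z. f z \<partial>Q (r k)) \<longlonglongrightarrow> (\<integral>z. f z \<partial>\<pi>')"
    using tight_weak_subsequence[OF Q tight] by blast
  interpret p': prob_space \<pi>' using prob_algebraD[OF \<pi>'] by simp
  define k where "k n = r n + N1" for n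
  have k: "strict_mono k" "\<And>n. k n \<ge> N1" using r by (auto simp: k_def strict_mono_def)
  have marg': "distr \<pi>' borel pr = dual_action (P t) \<nu>"
    if \<nu>: "\<nu> \<in> space (prob_algebra borel)" and prc: "continuous_on UNIV pr" and pr: "pr \<in> borel_measurable borel"
      and pq: "\<And>g n. nice g \<Longrightarrow> (\<integral>z. g (pr z) \<partial>Q n) = (\<integral>x. eflow (n + N1) g t x \<partial>\<nu>)"
    for \<nu> and pr :: "(real ^ 'n) \<times> (real ^ 'n) \<Rightarrow> real ^ 'n"
  proof (rule prob_measure_eqI_nice)
    have pr': "pr \<in> \<pi>' \<rightarrow>\<^sub>M borel" using pr by (simp add: prob_algebra_measurable_iff[OF \<pi>'])
    show "distr \<pi>' borel pr \<in> space (prob_algebra borel)"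
      using p'.prob_space_distr[OF pr'] by (simp add: space_prob_algebra)
    show "dual_action (P t) \<nu> \<in> space (prob_algebra borel)" by (rule dual_action_works(1)[OF markov t \<nu>])
    fix g :: "real ^ 'n \<Rightarrow> real" assume g: "nice g"
    have "(\<lambda>n. \<integral>z. g (pr z) \<partial>Q (r n)) \<longlonglongrightarrow> (\<integral>z. g (pr z) \<partial>\<pi>')"
    proof (rule lim)
      show "continuous_on UNIV (\<lambda>z. g (pr z))"
        by (rule continuous_on_compose2[OF nice_continuous[OF g] prc]) auto
      show "bounded (range (\<lambda>z. g (pr z)))" using g by (auto simp: nice_def elim!: bounded_subset)
    qed
    moreover have "(\<lambda>n. \<integral>z. g (pr z) \<partial>Q (r n)) \<longlonglongrightarrow> (\<integral>x. P t g x \<partial>\<nu>)"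
      using LIMSEQ_subseq_LIMSEQ[OF eflow_integral_tendsto[OF \<nu> g t] k(1)] by (simp add: pq[OF g] o_def k_def)
    ultimately have "(\<integral>z. g (pr z) \<partial>\<pi>') = (\<integral>x. P t g x \<partial>\<nu>)" by (rule LIMSEQ_unique)
    thus "(\<integral>x. g x \<partial>distr \<pi>' borel pr) = (\<integral>x. g x \<partial>dual_action (P t) \<nu>)"
      using dual_action_works(2)[OF markov t \<nu> nice_bounded_borel[OF g]]
      by (simp add: integral_distr[OF pr' nice_measurable[OF g]])
  qed
  have m1: "distr \<pi>' borel fst = dual_action (P t) \<nu>\<^sub>1"
    by (rule marg'[OF \<nu>(1)]) (auto intro!: continuous_intros fst_snd_measurable Qint)
  have m2: "distr \<pi>' borel snd = dual_action (P t) \<nu>\<^sub>2"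
    by (rule marg'[OF \<nu>(2)]) (auto intro!: continuous_intros fst_snd_measurable Qint)
  show thesis
  proof (rule that[of \<pi>'])
    show "\<pi>' \<in> couplings (dual_action (P t) \<nu>\<^sub>1) (dual_action (P t) \<nu>\<^sub>2)"
      using \<pi>' m1 m2 by (simp add: couplings_def)
    show "(\<integral>\<^sup>+z. ennreal (qcost z) \<partial>\<pi>') \<le> ennreal (exp (- \<kappa> * t)) * (\<integral>\<^sup>+z. ennreal (qcost z) \<partial>\<pi>)"
    proof (cases "(\<integral>\<^sup>+z. ennreal (qcost z) \<partial>\<pi>)")
      case top
      thus ?thesis by (simp add: ennreal_mult_top)
    next
      case (real c)
      \<comment> \<open>Weak convergence reaches bounded continuous functions only; the cost is
        truncated at \<open>i\<close> and recovered by monotone convergence after the limit.\<close>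
      define g where "g i z = min (qcost z) (real i)" for i :: nat and z
      have q0: "qcost z \<ge> 0" for z by (simp add: qcost_def q_nonneg)
      have gc: "continuous_on UNIV (g i)" for i unfolding g_def[abs_def] by (intro continuous_intros qcost_continuous)
      have gm [measurable]: "g i \<in> borel_measurable borel" for i by (rule borel_measurable_continuous_onI[OF gc])
      have g0: "0 \<le> g i z" "g i z \<le> real i" for i z using q0 by (auto simp: g_def)
      have "(\<integral>z. g i z \<partial>\<pi>') \<le> exp (- \<kappa> * (t - 0)) * c" for i
      proof (rule LIMSEQ_le)
        show "(\<lambda>n. \<integral>z. g i z \<partial>Q (r n)) \<longlonglongrightarrow> (\<integral>z. g i z \<partial>\<pi>')"
          by (rule lim[OF gc]) (use g0 in \<open>auto intro!: boundedI[of _ "real i"]\<close>)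
        show "(\<lambda>n. exp (- \<kappa> * (t - hs (k n))) * c) \<longlonglongrightarrow> exp (- \<kappa> * (t - 0)) * c"
          using LIMSEQ_subseq_LIMSEQ[OF hs(3) k(1)] by (intro tendsto_intros) (simp add: o_def)
        have "(\<integral>z. g i z \<partial>Q (r n)) \<le> exp (- \<kappa> * (t - hs (k n))) * c" for n
        proof -
          have hk: "hs (k n) \<le> h\<^sub>0" by (rule N1[OF k(2)])
          have "ennreal (\<integral>z. g i z \<partial>Q (r n)) = (\<integral>\<^sup>+z. ennreal (g i z) \<partial>Q (r n))"
            by (rule nn_integral_prob_bounded[OF Q gm g0, symmetric])
          also have "\<dots> \<le> (\<integral>\<^sup>+z. ennreal (qcost z) \<partial>Q (r n))"
            by (intro nn_integral_mono ennreal_leI) (simp add: g_def)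
          also have "\<dots> \<le> ennreal ((1 - \<kappa> * hs (k n)) ^ m (k n)) * (\<integral>\<^sup>+z. ennreal (qcost z) \<partial>\<pi>)"
            unfolding Q_def k_def[symmetric] by (rule kstep_iter_cost[OF \<pi>p hs(1) hk])
          also have "\<dots> \<le> ennreal (exp (- \<kappa> * (t - hs (k n)))) * ennreal c"
            unfolding real m_def by (intro mult_right_mono ennreal_leI decay_factor hk t) auto
          also have "\<dots> = ennreal (exp (- \<kappa> * (t - hs (k n))) * c)" using real by (simp add: ennreal_mult)
          finally show ?thesis using real by (subst (asm) ennreal_le_iff) auto
        qed
        thus "\<exists>N. \<forall>n\<ge>N. (\<integral>z. g i z \<partial>Q (r n)) \<le> exp (- \<kappa> * (t - hs (k n))) * c" by blast
      qed
      hence gi: "(\<integral>\<^sup>+z. ennreal (g i z) \<partial>\<pi>') \<le> ennreal (exp (- \<kappa> * t) * c)" for i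
        unfolding nn_integral_prob_bounded[OF \<pi>' gm g0] by (simp add: ennreal_leI)
      have sup: "ennreal (qcost z) = (SUP i. ennreal (g i z))" for z
      proof (rule antisym)
        obtain i :: nat where "qcost z \<le> real i" using real_arch_simple by blast
        hence "g i z = qcost z" by (simp add: g_def)
        thus "ennreal (qcost z) \<le> (SUP i. ennreal (g i z))" by (metis SUP_upper UNIV_I)
        show "(SUP i. ennreal (g i z)) \<le> ennreal (qcost z)" by (intro SUP_least ennreal_leI) (simp add: g_def)
      qed
      have "(\<integral>\<^sup>+z. ennreal (qcost z) \<partial>\<pi>') = (SUP i. \<integral>\<^sup>+z. ennreal (g i z) \<partial>\<pi>')"
        unfolding sup
      proof (rule nn_integral_monotone_convergence_SUP)
        show "incseq (\<lambda>i z. ennreal (g i z))" by (auto simp: incseq_def le_fun_def g_def intro!: ennreal_leI)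
        show "(\<lambda>z. ennreal (g i z)) \<in> borel_measurable \<pi>'" for i
          using gm[of i] by (simp add: prob_algebra_measurable_iff[OF \<pi>'])
      qed
      also have "\<dots> \<le> ennreal (exp (- \<kappa> * t) * c)" by (intro SUP_least gi)
      finally show ?thesis using real by (simp add: ennreal_mult)
    qed
  qed
qed

text \<open>Every coupling is transported to one at the later time; no optimal coupling has to
  exist. The Euclidean cost is exchanged for \<open>qcost\<close> and back, which costs
  \<open>l\<^sub>2 / l\<^sub>1\<close> under the square root. Dividing by \<open>c\<close>
  beforehand turns the claim into a lower bound for all couplings, hence for their infimum.\<close>

theorem W2_contraction:
  assumes \<nu>: "\<nu>\<^sub>1 \<in> space (prob_algebra borel)" "\<nu>\<^sub>2 \<in> space (prob_algebra borel)" and t: "t \<ge> 0"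
  shows "W2 (dual_action (P t) \<nu>\<^sub>1) (dual_action (P t) \<nu>\<^sub>2) \<le> ennreal (lip_factor * exp (- (\<kappa> / 2) * t)) * W2 \<nu>\<^sub>1 \<nu>\<^sub>2"
proof -
  define c where "c = lip_factor * exp (- (\<kappa> / 2) * t)"
  have c: "c > 0" using lip_factor_pos by (simp add: c_def)
  have c2: "c = sqrt (l\<^sub>2 / l\<^sub>1 * exp (- \<kappa> * t))"
  proof -
    have "sqrt (exp (- \<kappa> * t)) = exp (- (\<kappa> / 2) * t)"
      by (rule real_sqrt_unique) (simp_all add: power2_eq_square exp_add[symmetric])
    thus ?thesis by (simp add: c_def lip_factor_def real_sqrt_mult real_sqrt_divide)
  qed
  let ?W = "W2 (dual_action (P t) \<nu>\<^sub>1) (dual_action (P t) \<nu>\<^sub>2)"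
  let ?cost = "\<lambda>\<pi>. \<integral>\<^sup>+(x, y). ennreal ((norm (x - y))\<^sup>2) \<partial>(\<pi> :: ((real ^ 'n) \<times> (real ^ 'n)) measure)"
  have "ennreal (1 / c) * ?W \<le> W2 \<nu>\<^sub>1 \<nu>\<^sub>2"
    unfolding W2_def[of \<nu>\<^sub>1 \<nu>\<^sub>2]
  proof (rule INF_greatest)
    fix \<pi> assume \<pi>: "\<pi> \<in> couplings \<nu>\<^sub>1 \<nu>\<^sub>2"
    hence \<pi>p: "\<pi> \<in> space (prob_algebra borel)" by (simp add: couplings_def)
    obtain \<pi>' where \<pi>': "\<pi>' \<in> couplings (dual_action (P t) \<nu>\<^sub>1) (dual_action (P t) \<nu>\<^sub>2)"
      "(\<integral>\<^sup>+z. ennreal (qcost z) \<partial>\<pi>') \<le> ennreal (exp (- \<kappa> * t)) * (\<integral>\<^sup>+z. ennreal (qcost z) \<partial>\<pi>)"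
      using coupling_contraction[OF \<nu> \<pi> t] by blast
    have \<pi>p': "\<pi>' \<in> space (prob_algebra borel)" using \<pi>'(1) by (simp add: couplings_def)
    have nm: "(\<lambda>z. ennreal ((norm (fst z - snd z))\<^sup>2)) \<in> borel_measurable (borel :: ((real ^ 'n) \<times> (real ^ 'n)) measure)"
      by (intro measurable_compose[OF _ measurable_ennreal] borel_measurable_continuous_onI continuous_intros)
    have qm: "(\<lambda>z. ennreal (qcost z)) \<in> borel_measurable borel" by measurable
    have "?cost \<pi>' \<le> (\<integral>\<^sup>+z. ennreal (1 / l\<^sub>1) * ennreal (qcost z) \<partial>\<pi>')"
      unfolding case_prod_beta
    proof (rule nn_integral_mono)
      fix z :: "(real ^ 'n) \<times> (real ^ 'n)"
      have "(norm (fst z - snd z))\<^sup>2 \<le> 1 / l\<^sub>1 * qcost z"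
        using q_lower[of "fst z - snd z"] l1_pos by (simp add: qcost_def pos_le_divide_eq mult.commute)
      thus "ennreal ((norm (fst z - snd z))\<^sup>2) \<le> ennreal (1 / l\<^sub>1) * ennreal (qcost z)"
        using l1_pos by (simp add: ennreal_mult'[symmetric] ennreal_leI)
    qed
    also have "\<dots> = ennreal (1 / l\<^sub>1) * (\<integral>\<^sup>+z. ennreal (qcost z) \<partial>\<pi>')"
      using qm by (intro nn_integral_cmult) (simp add: prob_algebra_measurable_iff[OF \<pi>p'])
    also have "\<dots> \<le> ennreal (1 / l\<^sub>1) * (ennreal (exp (- \<kappa> * t)) * (\<integral>\<^sup>+z. ennreal (qcost z) \<partial>\<pi>))"
      by (intro mult_left_mono \<pi>'(2)) auto
    also have "\<dots> \<le> ennreal (1 / l\<^sub>1) * (ennreal (exp (- \<kappa> * t)) * (ennreal l\<^sub>2 * ?cost \<pi>))"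
    proof (intro mult_left_mono)
      have "(\<integral>\<^sup>+z. ennreal (qcost z) \<partial>\<pi>) \<le> (\<integral>\<^sup>+z. ennreal l\<^sub>2 * ennreal ((norm (fst z - snd z))\<^sup>2) \<partial>\<pi>)"
        using q_upper l2_pos by (intro nn_integral_mono) (simp add: qcost_def ennreal_mult'[symmetric] ennreal_leI)
      also have "\<dots> = ennreal l\<^sub>2 * ?cost \<pi>"
        unfolding case_prod_beta using nm by (intro nn_integral_cmult) (simp add: prob_algebra_measurable_iff[OF \<pi>p])
      finally show "(\<integral>\<^sup>+z. ennreal (qcost z) \<partial>\<pi>) \<le> ennreal l\<^sub>2 * ?cost \<pi>" .
    qed auto
    also have "\<dots> = ennreal (l\<^sub>2 / l\<^sub>1 * exp (- \<kappa> * t)) * ?cost \<pi>"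
    proof -
      have "ennreal (l\<^sub>2 / l\<^sub>1 * exp (- \<kappa> * t)) = ennreal (1 / l\<^sub>1) * (ennreal (exp (- \<kappa> * t)) * ennreal l\<^sub>2)"
        using l1_pos l2_pos by (simp add: ennreal_mult'[symmetric] mult_ac)
      thus ?thesis by (simp only: mult.assoc)
    qed
    finally have cost: "?cost \<pi>' \<le> ennreal (l\<^sub>2 / l\<^sub>1 * exp (- \<kappa> * t)) * ?cost \<pi>" .
    have "?W \<le> ennreal_sqrt (?cost \<pi>')" unfolding W2_def by (rule INF_lower[OF \<pi>'(1)])
    also have "\<dots> \<le> ennreal_sqrt (ennreal (l\<^sub>2 / l\<^sub>1 * exp (- \<kappa> * t)) * ?cost \<pi>)" by (rule ennreal_sqrt_mono[OF cost])
    also have "\<dots> = ennreal c * ennreal_sqrt (?cost \<pi>)"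
      unfolding c2 using l1_pos l2_pos by (intro ennreal_sqrt_mult) simp
    finally have "ennreal (1 / c) * ?W \<le> ennreal (1 / c) * (ennreal c * ennreal_sqrt (?cost \<pi>))" by (rule mult_left_mono) simp
    also have "\<dots> = ennreal_sqrt (?cost \<pi>)"
      using c by (simp add: mult.assoc[symmetric] ennreal_mult'[symmetric])
    finally show "ennreal (1 / c) * ?W \<le> ennreal_sqrt (?cost \<pi>)" .
  qed
  hence "ennreal c * (ennreal (1 / c) * ?W) \<le> ennreal c * W2 \<nu>\<^sub>1 \<nu>\<^sub>2" by (rule mult_left_mono) simp
  moreover have "ennreal c * (ennreal (1 / c) * ?W) = ?W"
    using c by (simp add: mult.assoc[symmetric] ennreal_mult'[symmetric])
  ultimately show ?thesis by (simp add: c_def)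
qed

text \<open>The Lipschitz constant of \<open>P (T k) f\<close> tends to 0, so its values at any two
  points merge. The merging is not uniform in the distance, but \<open>2 * B\<close> dominates the
  differences whatever the moments of \<open>\<nu>\<close>.\<close>

lemma P_forgets_initial_law:
  assumes f: "nice f" and N: "\<nu> \<in> space (prob_algebra borel)" and T: "\<And>k. T k \<ge> 0" "filterlim T at_top sequentially"
  shows "(\<lambda>k. (\<integral>y. P (T k) f y \<partial>\<nu>) - P (T k) f x) \<longlonglongrightarrow> 0"
proof -
  interpret prob_space \<nu> using prob_algebraD[OF N] by simp
  obtain B C where B: "\<And>x. \<bar>f x\<bar> \<le> B" and C: "C-lipschitz_on UNIV f" using niceE[OF f] by metis
  have Pm: "P (T k) f \<in> borel_measurable \<nu>" for k
    using nice_P_measurable[OF f T(1)] by (simp add: prob_algebra_measurable_iff[OF N])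
  have Pi: "integrable \<nu> (P (T k) f)" for k
    using P_abs_le[OF f T(1) B] Pm by (intro integrable_const_bound[where B = B]) auto
  have "(\<lambda>k. \<integral>y. P (T k) f y - P (T k) f x \<partial>\<nu>) \<longlonglongrightarrow> (\<integral>y. 0 \<partial>\<nu>)"
  proof (rule integral_dominated_convergence[where w = "\<lambda>_. 2 * B"])
    show "(\<lambda>y. P (T k) f y - P (T k) f x) \<in> borel_measurable \<nu>" for k using Pm by measurable
    show "AE y in \<nu>. norm (P (T k) f y - P (T k) f x) \<le> 2 * B" for k
    proof (rule AE_I2)
      fix y
      show "norm (P (T k) f y - P (T k) f x) \<le> 2 * B"
        using P_abs_le[OF f T(1)[of k] B, of x] P_abs_le[OF f T(1)[of k] B, of y] by simp
    qed
    show "AE y in \<nu>. (\<lambda>k. P (T k) f y - P (T k) f x) \<longlonglongrightarrow> 0"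
    proof (rule AE_I2)
      fix y
      have "filterlim (\<lambda>k. \<kappa> / 2 * T k) at_top sequentially"
        using kappa_pos by (intro filterlim_tendsto_pos_mult_at_top[OF tendsto_const _ T(2)]) simp
      hence "filterlim (\<lambda>k. - (\<kappa> / 2 * T k)) at_bot sequentially" by (simp add: filterlim_uminus_at_bot)
      hence e: "(\<lambda>k. exp (- (\<kappa> / 2 * T k))) \<longlonglongrightarrow> 0" by (rule filterlim_compose[OF exp_at_bot])
      have "(\<lambda>k. C * lip_factor * exp (- (\<kappa> / 2 * T k)) * norm (y - x)) \<longlonglongrightarrow> C * lip_factor * 0 * norm (y - x)"
        by (intro tendsto_intros e)
      hence lim: "(\<lambda>k. C * lip_factor * exp (- (\<kappa> / 2 * T k)) * norm (y - x)) \<longlonglongrightarrow> 0" by simp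
      show "(\<lambda>k. P (T k) f y - P (T k) f x) \<longlonglongrightarrow> 0"
        by (rule Lim_null_comparison[OF _ lim])
          (use P_lipschitz[OF f C T(1), of _ y x] in \<open>auto intro!: always_eventually\<close>)
    qed
  qed auto
  moreover have "(\<integral>y. P (T k) f y - P (T k) f x \<partial>\<nu>) = (\<integral>y. P (T k) f y \<partial>\<nu>) - P (T k) f x" for k
    using Pi by (simp add: prob_space)
  ultimately show ?thesis by simp
qed

section \<open>The invariant measure\<close>

lemma return_prob: "return borel x \<in> space (prob_algebra borel)"
  by (simp add: space_prob_algebra prob_space_return)

lemma return_integral: "f \<in> borel_measurable borel \<Longrightarrow> (\<integral>y. f y \<partial>return borel x) = (f x :: real)"
  by (simp add: integral_return)

lemma dual_return_integral:
  assumes "t \<ge> 0" "f \<in> bounded_borel" "P t f \<in> borel_measurable borel"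
  shows "(\<integral>y. f y \<partial>dual_action (P t) (return borel x)) = P t f x"
  using dual_action_works(2)[OF markov assms(1) return_prob assms(2)] return_integral[OF assms(3)] by simp

text \<open>\<open>\<mu>\<close> is a weak limit of the laws started at 0, taken along integer
  times. Invariance rests on merging instead of time averages: prolonging the time by
  \<open>t\<close> amounts to starting from the law \<open>\<sigma>\<close> reached at time
  \<open>t\<close>, and in the limit the starting law is forgotten.\<close>

theorem invariant_measure_exists:
  obtains \<mu> where "\<mu> \<in> space (prob_algebra borel)" "\<And>t. t \<ge> 0 \<Longrightarrow> dual_action (P t) \<mu> = \<mu>"
proof -
  define p where "p k = dual_action (P (real k)) (return borel (0 :: real ^ 'n))" for k
  have p: "p k \<in> space (prob_algebra borel)" for k
    unfolding p_def by (intro dual_action_works(1)[OF markov _ return_prob]) simp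
  have tight: "\<exists>R. \<forall>k. measure (p k) {x. R < norm x} \<le> e" if e: "e > 0" for e
  proof -
    obtain r where r: "r \<ge> 1" "(\<integral>x. tail_bound (r\<^sup>2) x \<partial>return borel 0) \<le> e / 2"
      using tail_bound_integral[OF return_prob, of "e / 2" 0] e by auto
    have r2: "r\<^sup>2 \<ge> 1" using r(1) by (simp add: one_le_power)
    note cn = cutoff_nice[OF r2] and cb = cutoff_bounds[OF r2]
    have tb: "tail_bound (r\<^sup>2) 0 \<le> e / 2" using r(2) by (simp add: return_integral)
    obtain N1 where N1: "\<And>N. N \<ge> N1 \<Longrightarrow> hs N \<le> h\<^sub>0" using eventually_hs by blast
    have "measure (p k) {x. r < norm x} \<le> e" for k
    proof -
      have "measure (p k) {x. r < norm x} \<le> (\<integral>x. 2 * cutoff (r\<^sup>2) x \<partial>p k)"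
        by (rule prob_algebra_tail_le[OF p, where B = 2])
          (use cb cutoff_ge[OF r(1)] in \<open>auto intro!: borel_measurable_times borel_measurable_const nice_measurable[OF cn]\<close>)
      also have "\<dots> = 2 * P (real k) (cutoff (r\<^sup>2)) 0"
        unfolding p_def using dual_return_integral[OF _ nice_bounded_borel[OF cn] nice_P_measurable[OF cn]] by simp
      also have "P (real k) (cutoff (r\<^sup>2)) 0 \<le> tail_bound (r\<^sup>2) 0"
        by (rule LIMSEQ_le_const2[OF eflow_tendsto_P[OF cn]]) (use eflow_cutoff[OF N1 r2] in auto)
      finally show ?thesis using tb by simp
    qed
    thus ?thesis by blast
  qed
  obtain r \<mu> where r: "strict_mono (r :: nat \<Rightarrow> nat)" and \<mu>: "\<mu> \<in> space (prob_algebra borel)"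
    and lim: "\<And>f :: real ^ 'n \<Rightarrow> real. continuous_on UNIV f \<Longrightarrow> bounded (range f) \<Longrightarrow>
       (\<lambda>k. \<integral>x. f x \<partial>p (r k)) \<longlonglongrightarrow> (\<integral>x. f x \<partial>\<mu>)"
    using tight_weak_subsequence[OF p tight] by blast
  have "dual_action (P t) \<mu> = \<mu>" if t: "t \<ge> 0" for t
  proof (rule prob_measure_eqI_nice[OF dual_action_works(1)[OF markov t \<mu>] \<mu>])
    fix f :: "real ^ 'n \<Rightarrow> real" assume f: "nice f"
    have T: "real (r k) \<ge> 0" "filterlim (\<lambda>k. real (r k)) at_top sequentially" for k
      using filterlim_compose[OF filterlim_real_sequentially filterlim_subseq[OF r]] by auto
    note fb = nice_bounded_borel[OF f]
    have "(\<lambda>k. \<integral>x. f x \<partial>p (r k)) \<longlonglongrightarrow> (\<integral>x. f x \<partial>\<mu>)"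
      using lim[OF nice_continuous[OF f]] f by (simp add: nice_def)
    hence 1: "(\<lambda>k. P (real (r k)) f 0) \<longlonglongrightarrow> (\<integral>x. f x \<partial>\<mu>)"
      unfolding p_def using dual_return_integral[OF T(1) fb nice_P_measurable[OF f T(1)]] by simp
    have 2: "(\<lambda>k. \<integral>x. P t f x \<partial>p (r k)) \<longlonglongrightarrow> (\<integral>x. P t f x \<partial>\<mu>)"
      by (intro lim nice_P_continuous nice_P_bounded f t)
    define \<sigma> where "\<sigma> = dual_action (P t) (return borel (0 :: real ^ 'n))"
    have \<sigma>: "\<sigma> \<in> space (prob_algebra borel)" unfolding \<sigma>_def by (rule dual_action_works(1)[OF markov t return_prob])
    have 3: "(\<integral>x. P t f x \<partial>p (r k)) = (\<integral>y. P (real (r k)) f y \<partial>\<sigma>)" for k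
    proof -
      have sg: "P (real (r k)) (P t f) = P t (P (real (r k)) f)"
        using markov t fb T(1)[of k] unfolding markov_semigroup_def by (metis add.commute)
      have c: "continuous_on UNIV (P (real (r k)) (P t f))"
        by (intro P_continuous T(1) nice_P_continuous nice_P_bounded f t)
      have cm: "P (real (r k)) (P t f) \<in> borel_measurable borel" by (rule borel_measurable_continuous_onI[OF c])
      have "(\<integral>x. P t f x \<partial>p (r k)) = P (real (r k)) (P t f) 0"
        unfolding p_def by (rule dual_return_integral[OF T(1) nice_P_bounded(2)[OF f t] cm])
      also have "\<dots> = P t (P (real (r k)) f) 0" by (simp only: sg)
      also have "\<dots> = (\<integral>y. P (real (r k)) f y \<partial>\<sigma>)"
        unfolding \<sigma>_def
        by (rule dual_return_integral[OF t nice_P_bounded(2)[OF f T(1)], symmetric]) (use cm sg in simp)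
      finally show ?thesis .
    qed
    \<comment> \<open>Weak convergence and the commutation in \<open>3\<close> give this limit,
      while \<open>P_forgets_initial_law\<close> gives 0 for the same sequence.\<close>
    have "(\<lambda>k. (\<integral>y. P (real (r k)) f y \<partial>\<sigma>) - P (real (r k)) f 0) \<longlonglongrightarrow> (\<integral>x. P t f x \<partial>\<mu>) - (\<integral>x. f x \<partial>\<mu>)"
      using 2 unfolding 3 by (intro tendsto_diff 1)
    hence "(\<integral>x. P t f x \<partial>\<mu>) - (\<integral>x. f x \<partial>\<mu>) = 0"
      using LIMSEQ_unique P_forgets_initial_law[OF f \<sigma> T] by blast
    thus "(\<integral>x. f x \<partial>dual_action (P t) \<mu>) = (\<integral>x. f x \<partial>\<mu>)"
      using dual_action_works(2)[OF markov t \<mu> fb] by simp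
  qed
  thus thesis using that[OF \<mu>] by blast
qed

text \<open>Under an invariant law the mean of \<open>P (real k) f\<close> is constant in
  \<open>k\<close>, while its dependence on the starting point dies out. The sequence itself does
  not involve \<open>\<mu>\<close>, which is why uniqueness follows.\<close>

lemma P_tendsto_invariant:
  assumes \<mu>: "\<mu> \<in> space (prob_algebra borel)" "\<And>t. t \<ge> 0 \<Longrightarrow> dual_action (P t) \<mu> = \<mu>" and f: "nice f"
  shows "(\<lambda>k. P (real k) f x) \<longlonglongrightarrow> (\<integral>y. f y \<partial>\<mu>)"
proof -
  have "(\<integral>y. P (real k) f y \<partial>\<mu>) = (\<integral>y. f y \<partial>\<mu>)" for k
    using dual_action_works(2)[OF markov _ \<mu>(1) nice_bounded_borel[OF f], of "real k"] \<mu>(2)[of "real k"] by simp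
  hence "(\<lambda>k. (\<integral>y. f y \<partial>\<mu>) - P (real k) f x) \<longlonglongrightarrow> 0"
    using P_forgets_initial_law[OF f \<mu>(1), of real x] filterlim_real_sequentially by simp
  from tendsto_diff[OF tendsto_const[of "\<integral>y. f y \<partial>\<mu>"] this] show ?thesis by simp
qed

theorem invariant_measure_unique:
  assumes "\<mu> \<in> space (prob_algebra borel)" "\<And>t. t \<ge> 0 \<Longrightarrow> dual_action (P t) \<mu> = \<mu>"
    and "\<mu>' \<in> space (prob_algebra borel)" "\<And>t. t \<ge> 0 \<Longrightarrow> dual_action (P t) \<mu>' = \<mu>'"
  shows "\<mu>' = \<mu>"
  by (rule prob_measure_eqI_nice[OF assms(3,1)])
    (rule LIMSEQ_unique[OF P_tendsto_invariant[OF assms(3,4), where x = 0] P_tendsto_invariant[OF assms(1,2), where x = 0]]; assumption)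

text \<open>The local inequality at time \<open>k\<close> is integrated over \<open>\<mu>\<close>.
  Invariance removes the semigroup wherever it occurs linearly, and the remaining square of
  \<open>P (real k) \<phi>\<close> converges to the square of the mean.\<close>

theorem invariant_measure_poincare:
  assumes \<mu>: "\<mu> \<in> space (prob_algebra borel)" "\<And>t. t \<ge> 0 \<Longrightarrow> dual_action (P t) \<mu> = \<mu>"
    and \<phi>: "\<phi> \<in> test_functions UNIV"
  shows "(\<integral>x. (\<phi> x)\<^sup>2 \<partial>\<mu>) - (\<integral>x. \<phi> x \<partial>\<mu>)\<^sup>2 \<le> (2 * c\<^sub>w / (\<kappa> * l\<^sub>1)) * (\<integral>x. (norm (gradient \<phi> x))\<^sup>2 \<partial>\<mu>)"
proof -
  interpret prob_space \<mu> using prob_algebraD[OF \<mu>(1)] by simp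
  have nn: "nice \<phi>" "nice (\<lambda>x. (\<phi> x)\<^sup>2)" "nice (\<lambda>x. (norm (gradient \<phi> x))\<^sup>2)"
    using test_function_nice[OF \<phi>] test_function_gradient_nice[OF \<phi>] nice_mult[of \<phi> \<phi>]
    by (simp_all add: power2_eq_mult_fun)
  obtain B where B: "\<And>x. \<bar>\<phi> x\<bar> \<le> B" using niceE[OF nn(1)] by metis
  have B0: "B \<ge> 0" using B[of 0] by simp
  have inv: "(\<integral>x. P (real k) f x \<partial>\<mu>) = (\<integral>x. f x \<partial>\<mu>)" if "nice f" for f k
    using dual_action_works(2)[OF markov _ \<mu>(1) nice_bounded_borel[OF that], of "real k"] \<mu>(2)[of "real k"] by simp
  have Pm: "P (real k) f \<in> borel_measurable \<mu>" if "nice f" for f k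
    using nice_P_measurable[OF that, of "real k"] by (simp add: prob_algebra_measurable_iff[OF \<mu>(1)])
  have Pi: "integrable \<mu> (P (real k) f)" if f: "nice f" for f k
  proof -
    obtain B where "\<And>x. \<bar>f x\<bar> \<le> B" using niceE[OF f] by metis
    thus ?thesis using P_abs_le[OF f, of "real k"] Pm[OF f] by (intro integrable_const_bound[where B = B]) auto
  qed
  have sq: "(P (real k) \<phi> x)\<^sup>2 \<le> B\<^sup>2" for k x
    using P_abs_le[OF nn(1) _ B, of "real k" x] by (metis abs_ge_zero of_nat_0_le_iff power2_abs power_mono)
  have Psq: "integrable \<mu> (\<lambda>x. (P (real k) \<phi> x)\<^sup>2)" for k
    using sq Pm[OF nn(1)] by (intro integrable_const_bound[where B = "B\<^sup>2"]) auto
  have "(\<lambda>k. \<integral>x. (P (real k) \<phi> x)\<^sup>2 \<partial>\<mu>) \<longlonglongrightarrow> (\<integral>x. (\<integral>y. \<phi> y \<partial>\<mu>)\<^sup>2 \<partial>\<mu>)"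
  proof (rule integral_dominated_convergence[where w = "\<lambda>_. B\<^sup>2"])
    show "AE x in \<mu>. (\<lambda>k. (P (real k) \<phi> x)\<^sup>2) \<longlonglongrightarrow> (\<integral>y. \<phi> y \<partial>\<mu>)\<^sup>2"
      by (intro AE_I2 tendsto_power P_tendsto_invariant \<mu> nn)
    show "(\<lambda>x. (P (real k) \<phi> x)\<^sup>2) \<in> borel_measurable \<mu>" for k using Pm[OF nn(1)] by measurable
    show "AE x in \<mu>. norm ((P (real k) \<phi> x)\<^sup>2) \<le> B\<^sup>2" for k using sq by simp
  qed auto
  hence lim: "(\<lambda>k. \<integral>x. (P (real k) \<phi> x)\<^sup>2 \<partial>\<mu>) \<longlonglongrightarrow> (\<integral>y. \<phi> y \<partial>\<mu>)\<^sup>2" by (simp add: prob_space)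
  let ?C = "2 * c\<^sub>w / (\<kappa> * l\<^sub>1)"
  have "(\<integral>x. (\<phi> x)\<^sup>2 \<partial>\<mu>) - (\<integral>x. (P (real k) \<phi> x)\<^sup>2 \<partial>\<mu>) \<le> ?C * (\<integral>x. (norm (gradient \<phi> x))\<^sup>2 \<partial>\<mu>)" for k
  proof -
    have "(\<integral>x. (\<phi> x)\<^sup>2 \<partial>\<mu>) - (\<integral>x. (P (real k) \<phi> x)\<^sup>2 \<partial>\<mu>)
        = (\<integral>x. P (real k) (\<lambda>x. (\<phi> x)\<^sup>2) x - (P (real k) \<phi> x)\<^sup>2 \<partial>\<mu>)"
      using inv[OF nn(2)] by (simp add: Pi[OF nn(2)] Psq)
    also have "\<dots> \<le> (\<integral>x. ?C * P (real k) (\<lambda>x. (norm (gradient \<phi> x))\<^sup>2) x \<partial>\<mu>)"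
      using Pi[OF nn(2)] Psq Pi[OF nn(3)]
      by (intro integral_mono P_local_poincare[OF \<phi>] integrable_mult_right Bochner_Integration.integrable_diff) auto
    also have "\<dots> = ?C * (\<integral>x. (norm (gradient \<phi> x))\<^sup>2 \<partial>\<mu>)" using inv[OF nn(3)] by simp
    finally show ?thesis .
  qed
  moreover have "(\<lambda>k. (\<integral>x. (\<phi> x)\<^sup>2 \<partial>\<mu>) - (\<integral>x. (P (real k) \<phi> x)\<^sup>2 \<partial>\<mu>)) \<longlonglongrightarrow> (\<integral>x. (\<phi> x)\<^sup>2 \<partial>\<mu>) - (\<integral>x. \<phi> x \<partial>\<mu>)\<^sup>2"
    by (intro tendsto_intros lim)
  ultimately show ?thesis using LIMSEQ_le_const2 by blast
qed

end

section \<open>Symmetric matrices and the drift\<close>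

lemma quadratic_form_sum:
  fixes A :: "real ^ 'n::finite ^ 'n"
  shows "(A *v x) \<bullet> x = (\<Sum>i\<in>UNIV. \<Sum>j\<in>UNIV. A $ i $ j * x $ i * x $ j)"
  by (simp add: inner_vec_def matrix_vector_mult_def sum_distrib_right sum_distrib_left mult_ac)

text \<open>With zero diagonal, the form at the sum and at the difference of two basis vectors is
  plus and minus twice the off-diagonal entry, so both signs must be nonnegative.\<close>

lemma psd_zero_diagonal:
  fixes A :: "real ^ 'n::finite ^ 'n"
  assumes sym: "transpose A = A" and psd: "\<And>x. (A *v x) \<bullet> x \<ge> 0" and diag: "\<And>i. A $ i $ i = 0"
  shows "A $ i $ j = 0"
proof (cases "i = j")
  case False
  have sym': "A $ j $ i = A $ i $ j" using sym by (metis transpose_def vec_lambda_beta)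
  have ax: "(A *v axis k 1) \<bullet> axis l 1 = A $ l $ k" for k l
    by (simp add: matrix_vector_mul_component inner_axis matrix_vector_mult_basis column_def)
  have "(A *v (axis i 1 + s *\<^sub>R axis j 1)) \<bullet> (axis i 1 + s *\<^sub>R axis j 1) = 2 * s * A $ i $ j" for s
    by (simp add: matrix_vector_right_distrib matrix_vector_mult_scaleR inner_add_left inner_add_right ax diag sym')
  from psd[of "axis i 1 + 1 *\<^sub>R axis j 1"] psd[of "axis i 1 + (-1) *\<^sub>R axis j 1"] this[of 1] this[of "-1"]
  show ?thesis by (simp only:)
qed (simp add: diag)

text \<open>Cholesky elimination for a semidefinite matrix: the Schur complement at a nonzero
  diagonal entry is again nonnegative and has fewer nonzero diagonal entries. If none is left, the
  matrix vanishes by \<open>psd_zero_diagonal\<close>.\<close>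

lemma psd_sum_of_squares:
  fixes A :: "real ^ 'n::finite ^ 'n"
  assumes "transpose A = A" "\<And>x. (A *v x) \<bullet> x \<ge> 0"
  shows "\<exists>(M :: nat) v. \<forall>i j. A $ i $ j = (\<Sum>k<M. v k $ i * v k $ j :: real)"
  using assms
proof (induction "card {i. A $ i $ i \<noteq> 0}" arbitrary: A rule: less_induct)
  case less
  note sym = less.prems(1) and psd = less.prems(2)
  have symc: "A $ i $ j = A $ j $ i" for i j using sym by (metis transpose_def vec_lambda_beta)
  have ax: "(A *v x) \<bullet> axis l 1 = (A *v x) $ l" for x l by (simp add: inner_axis)
  show ?case
  proof (cases "\<forall>i. A $ i $ i = 0")
    case True
    have "A $ i $ j = 0" for i j using psd_zero_diagonal[OF sym psd] True by blast
    thus ?thesis by (intro exI[of _ 0]) simp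
  next
    case False
    then obtain p where p: "A $ p $ p \<noteq> 0" by blast
    define u where "u = A *v axis p 1"
    have u: "u $ j = A $ j $ p" for j by (simp add: u_def matrix_vector_mult_basis column_def)
    define c where "c = A $ p $ p"
    have "c \<ge> 0" using psd[of "axis p 1"] by (simp add: c_def ax u[unfolded u_def])
    hence c: "c > 0" using p by (simp add: c_def)
    define A' where "A' = (\<chi> i j. A $ i $ j - u $ i * u $ j / c)"
    have A': "A' $ i $ j = A $ i $ j - u $ i * u $ j / c" for i j by (simp add: A'_def)
    have "transpose A' = A'" by (simp add: vec_eq_iff transpose_def A' symc mult.commute)
    moreover have psd': "(A' *v y) \<bullet> y \<ge> 0" for y
    proof -
      \<comment> \<open>Completing the square: \<open>s\<close> minimises the form of
        \<open>A\<close> over the shifts of \<open>y\<close> along \<open>axis p 1\<close>, and the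
        minimum is the form of \<open>A'\<close> at \<open>y\<close>.\<close>
      define s where "s = (u \<bullet> y) / c"
      have Ay: "(A *v y) $ p = u \<bullet> y"
        by (simp add: matrix_vector_mult_def inner_vec_def u symc[of p])
      have up: "u $ p = c" by (simp add: u c_def)
      have "(A *v (y - s *\<^sub>R axis p 1)) \<bullet> (y - s *\<^sub>R axis p 1)
          = (A *v y) \<bullet> y - s * (A *v y) $ p - s * (u \<bullet> y) + s\<^sup>2 * u $ p"
        by (simp add: matrix_vector_mult_diff_distrib matrix_vector_mult_scaleR u_def[symmetric] inner_diff_left
          inner_diff_right ax inner_axis power2_eq_square algebra_simps)
      also have "\<dots> = (A *v y) \<bullet> y - (u \<bullet> y)\<^sup>2 / c"
        using c by (simp add: Ay up s_def power2_eq_square field_simps)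
      also have "\<dots> = (A' *v y) \<bullet> y"
      proof -
        have "(u \<bullet> y)\<^sup>2 / c = (\<Sum>i\<in>UNIV. \<Sum>j\<in>UNIV. u $ i * u $ j / c * y $ i * y $ j)"
          by (simp add: power2_eq_square inner_vec_def sum_product sum_divide_distrib mult_ac)
        thus ?thesis by (simp add: quadratic_form_sum A' left_diff_distrib sum_subtractf)
      qed
      finally show ?thesis using psd[of "y - s *\<^sub>R axis p 1"] by simp
    qed
    moreover have "card {i. A' $ i $ i \<noteq> 0} < card {i. A $ i $ i \<noteq> 0}"
    proof (rule psubset_card_mono)
      \<comment> \<open>The diagonal of \<open>A'\<close> lies between 0 and that of
        \<open>A\<close>, so no zero entry is lost, and the entry at \<open>p\<close> becomes
        zero.\<close>
      have "A' $ i $ i \<ge> 0" for i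
        using psd'[of "axis i 1"] by (simp add: inner_axis matrix_vector_mult_basis column_def)
      moreover have "A' $ i $ i \<le> A $ i $ i" for i using c by (simp add: A')
      ultimately have "A' $ i $ i = 0" if "A $ i $ i = 0" for i using that by (metis order_antisym)
      moreover have "A' $ p $ p = 0" using c by (simp add: A' u c_def)
      ultimately show "{i. A' $ i $ i \<noteq> 0} \<subset> {i. A $ i $ i \<noteq> 0}" using p by blast
    qed simp
    ultimately obtain M :: nat and v where v: "\<And>i j. A' $ i $ j = (\<Sum>k<M. v k $ i * v k $ j :: real)"
      using less.hyps[of A'] by blast
    have "A $ i $ j = (\<Sum>k<Suc M. (v(M := (1 / sqrt c) *\<^sub>R u)) k $ i * (v(M := (1 / sqrt c) *\<^sub>R u)) k $ j)" for i j
    proof -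
      have "A $ i $ j = A' $ i $ j + u $ i * u $ j / c" by (simp add: A')
      also have "u $ i * u $ j / c = ((1 / sqrt c) *\<^sub>R u) $ i * ((1 / sqrt c) *\<^sub>R u) $ j" using c by simp
      finally show ?thesis by (simp add: v)
    qed
    thus ?thesis by blast
  qed
qed

text \<open>The minimum and maximum of the form on the unit sphere, which is compact, extended by
  homogeneity.\<close>

lemma positive_definite_bounds:
  fixes S :: "real ^ 'n::finite ^ 'n"
  assumes "\<And>x. x \<noteq> 0 \<Longrightarrow> (S *v x) \<bullet> x > 0"
  obtains l u where "l > 0" "\<And>x. l * (norm x)\<^sup>2 \<le> (S *v x) \<bullet> x" "\<And>x. (S *v x) \<bullet> x \<le> u * (norm x)\<^sup>2"
proof -
  have c: "continuous_on (sphere 0 1) (\<lambda>x. (S *v x) \<bullet> x)"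
    by (intro continuous_intros matrix_vector_mult_linear_continuous_on)
  have ne: "sphere 0 1 \<noteq> ({} :: (real ^ 'n) set)"
    by (metis (no_types, lifting) empty_iff mem_sphere_0 norm_axis_1)
  obtain x0 where x0: "x0 \<in> sphere 0 1" "\<And>y. y \<in> sphere 0 1 \<Longrightarrow> (S *v x0) \<bullet> x0 \<le> (S *v y) \<bullet> y"
    using continuous_attains_inf[OF compact_sphere ne c] by blast
  obtain x1 where x1: "\<And>y. y \<in> sphere 0 1 \<Longrightarrow> (S *v y) \<bullet> y \<le> (S *v x1) \<bullet> x1"
    using continuous_attains_sup[OF compact_sphere ne c] by blast
  have scale: "(S *v x) \<bullet> x = (norm x)\<^sup>2 * ((S *v sgn x) \<bullet> sgn x)" for x
  proof -
    have "x = norm x *\<^sub>R sgn x" by (cases "x = 0") (simp_all add: sgn_div_norm)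
    hence "(S *v x) \<bullet> x = (S *v (norm x *\<^sub>R sgn x)) \<bullet> (norm x *\<^sub>R sgn x)" by simp
    thus ?thesis by (simp only: matrix_vector_mult_scaleR) (simp add: power2_eq_square)
  qed
  show thesis
  proof (rule that[of "(S *v x0) \<bullet> x0" "(S *v x1) \<bullet> x1"])
    show "(S *v x0) \<bullet> x0 > 0" using assms[of x0] x0(1) by (cases "x0 = 0") auto
    fix x :: "real ^ 'n"
    show "(S *v x0) \<bullet> x0 * (norm x)\<^sup>2 \<le> (S *v x) \<bullet> x" "(S *v x) \<bullet> x \<le> (S *v x1) \<bullet> x1 * (norm x)\<^sup>2"
    proof -
      have "sgn x \<in> sphere 0 1" if "x \<noteq> 0" using that by (simp add: norm_sgn)
      thus "(S *v x0) \<bullet> x0 * (norm x)\<^sup>2 \<le> (S *v x) \<bullet> x" "(S *v x) \<bullet> x \<le> (S *v x1) \<bullet> x1 * (norm x)\<^sup>2"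
        using x0(2)[of "sgn x"] x1[of "sgn x"] scale[of x]
        by (cases "x = 0"; simp add: mult.commute mult_right_mono)+
    qed
  qed
qed

text \<open>The mean value theorem on the segment from \<open>y\<close> to \<open>x\<close>. The
  walk sees the condition on the Jacobian only in this increment form.\<close>

lemma dissipative_increment:
  fixes b :: "real ^ 'n::finite \<Rightarrow> real ^ 'n"
  assumes d: "\<And>x. b differentiable (at x)"
    and diss: "\<And>x y. - ((S *v (jacobian b (at y) *v x)) \<bullet> x) \<ge> a * (norm x)\<^sup>2"
  shows "(S *v (b x - b y)) \<bullet> (x - y) \<le> - a * (norm (x - y))\<^sup>2"
proof -
  define e where "e = x - y"
  define f where "f t = (S *v b (y + t *\<^sub>R e)) \<bullet> e" for t
  have der: "(f has_real_derivative (S *v (jacobian b (at (y + t *\<^sub>R e)) *v e)) \<bullet> e) (at t)" for t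
  proof -
    have J: "(b has_derivative (\<lambda>h. jacobian b (at (y + t *\<^sub>R e)) *v h)) (at (y + t *\<^sub>R e))"
      using d jacobian_works by blast
    have "((\<lambda>t. y + t *\<^sub>R e) has_derivative (\<lambda>s. s *\<^sub>R e)) (at t)" by (auto intro!: derivative_eq_intros)
    from has_derivative_compose[OF this J]
    have "((\<lambda>t. b (y + t *\<^sub>R e)) has_derivative (\<lambda>s. jacobian b (at (y + t *\<^sub>R e)) *v (s *\<^sub>R e))) (at t)" .
    from bounded_linear.has_derivative[OF matrix_vector_mul_bounded_linear[of S] this]
    have "((\<lambda>t. S *v b (y + t *\<^sub>R e)) has_derivative (\<lambda>s. S *v (jacobian b (at (y + t *\<^sub>R e)) *v (s *\<^sub>R e)))) (at t)" .
    from has_derivative_inner_left[OF this, of e]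
    have "(f has_derivative (\<lambda>s. (S *v (jacobian b (at (y + t *\<^sub>R e)) *v (s *\<^sub>R e))) \<bullet> e)) (at t)"
      by (simp add: f_def[abs_def])
    moreover have "(\<lambda>s. s * c) = (*) c" for c :: real by auto
    ultimately show ?thesis
      by (simp add: has_field_derivative_def matrix_vector_mult_scaleR)
  qed
  from MVT2[of 0 1 f, OF _ der] obtain z where
    "f 1 - f 0 = (S *v (jacobian b (at (y + z *\<^sub>R e)) *v e)) \<bullet> e" by auto
  also have "\<dots> \<le> - a * (norm e)\<^sup>2" using diss[of e "y + z *\<^sub>R e"] by simp
  finally show ?thesis by (simp add: f_def e_def matrix_vector_mult_diff_distrib inner_diff_left)
qed

lemma smooth_components_differentiable:
  fixes b :: "real ^ 'n::finite \<Rightarrow> real ^ 'n"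
  assumes "\<And>i. smooth_on UNIV (\<lambda>x. b x $ i)"
  shows "b differentiable (at x)"
proof -
  have "(\<lambda>x. b x $ i) differentiable (at x)" for i
    using assms[of i] by (auto simp: smooth_on_def iter_partial_def dest: spec[of _ "[]"])
  thus ?thesis
    by (subst differentiable_componentwise_within) (auto simp: Basis_vec_def inner_axis)
qed

theorem theorem2p5:
  fixes b :: "real ^ 'n::finite \<Rightarrow> real ^ 'n"
    and A :: "real ^ 'n ^ 'n"
    and S :: "real ^ 'n ^ 'n"
    and a :: real
    and P :: "real \<Rightarrow> (real ^ 'n \<Rightarrow> real) \<Rightarrow> real ^ 'n \<Rightarrow> real"
  assumes b_smooth: "\<And>i. smooth_on UNIV (\<lambda>x. b x $ i)"
    and b_lipschitz: "\<exists>K. K-lipschitz_on UNIV b"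
    and A_symmetric: "transpose A = A"
    and A_nonneg: "\<And>x. (A *v x) \<bullet> x \<ge> 0"
    and L_hypoelliptic: "hypoelliptic (diffusion_op b A)"
    and L_generates: "generates_semigroup (diffusion_op b A) P"
    and S_symmetric: "transpose S = S"
    and S_positive: "\<And>x. x \<noteq> 0 \<Longrightarrow> (S *v x) \<bullet> x > 0"
    and a_pos: "a > 0"
    and dissipative: "\<And>x y. - ((S *v (jacobian b (at y) *v x)) \<bullet> x) \<ge> a * (norm x)\<^sup>2"
  shows "\<exists>\<mu>\<in>space (prob_algebra borel).
     (\<forall>t\<ge>0. dual_action (P t) \<mu> = \<mu>) \<and>
     (\<forall>\<mu>'\<in>space (prob_algebra borel). (\<forall>t\<ge>0. dual_action (P t) \<mu>' = \<mu>') \<longrightarrow> \<mu>' = \<mu>) \<and>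
     (\<exists>C\<^sub>1>0. \<exists>C\<^sub>2>0. \<forall>\<nu>\<in>space (prob_algebra borel). \<forall>t\<ge>0.
        W2 (dual_action (P t) \<nu>) \<mu> \<le> ennreal (C\<^sub>1 * exp (- C\<^sub>2 * t)) * W2 \<mu> \<nu>) \<and>
     (\<exists>C\<^sub>3>0. \<forall>f\<in>test_functions UNIV.
        (\<integral>x. (f x)\<^sup>2 \<partial>\<mu>) - (\<integral>x. f x \<partial>\<mu>)\<^sup>2 \<le> C\<^sub>3 * (\<integral>x. (norm (gradient f x))\<^sup>2 \<partial>\<mu>))"
proof -
  obtain L where L: "L-lipschitz_on UNIV b" using b_lipschitz by blast
  obtain l u where lu: "l > 0" "\<And>x. l * (norm x)\<^sup>2 \<le> (S *v x) \<bullet> x" "\<And>x. (S *v x) \<bullet> x \<le> u * (norm x)\<^sup>2"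
    using positive_definite_bounds[OF S_positive] by blast
  obtain M0 :: nat and v0 where v0: "\<And>i j. A $ i $ j = (\<Sum>k<M0. v0 k $ i * v0 k $ j :: real)"
    using psd_sum_of_squares[OF A_symmetric A_nonneg] by metis
  \<comment> \<open>A zero vector is appended so that the family is nonempty even for \<open>A = 0\<close>.\<close>
  define v where "v = v0(M0 := 0)"
  have v: "A $ i $ j = (\<Sum>k<Suc M0. v k $ i * v k $ j)" for i j by (simp add: v_def v0)
  note b_diff = smooth_components_differentiable[OF b_smooth]
  interpret euler_semigroup b S v "Suc M0" a L l u A P
    by unfold_locales
      (use L lu v a_pos S_symmetric L_generates b_diff dissipative_increment[OF b_diff dissipative] in auto)
  obtain \<mu> where \<mu>: "\<mu> \<in> space (prob_algebra borel)" "\<And>t. t \<ge> 0 \<Longrightarrow> dual_action (P t) \<mu> = \<mu>"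
    using invariant_measure_exists by blast
  \<comment> \<open>The contraction is applied to \<open>\<nu>\<close> and \<open>\<mu>\<close>;
    invariance fixes the second law, and symmetry of the distance puts the right-hand side in the
    required order.\<close>
  have contr: "W2 (dual_action (P t) \<nu>) \<mu> \<le> ennreal (lip_factor * exp (- (\<kappa> / 2) * t)) * W2 \<mu> \<nu>"
    if "\<nu> \<in> space (prob_algebra borel)" "t \<ge> 0" for \<nu> t
    using W2_contraction[OF that(1) \<mu>(1) that(2)] by (simp add: \<mu>(2)[OF that(2)] W2_commute[of \<mu>])
  \<comment> \<open>The summand 1 keeps the constant positive when \<open>c\<^sub>w = 0\<close>, as
    for \<open>A = 0\<close>.\<close>
  define C where "C = 2 * c\<^sub>w / (\<kappa> * l) + 1"
  have C: "C > 0" unfolding C_def using cw_nonneg kappa_pos l1_pos by (intro add_nonneg_pos) auto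
  have poinc: "(\<integral>x. (f x)\<^sup>2 \<partial>\<mu>) - (\<integral>x. f x \<partial>\<mu>)\<^sup>2 \<le> C * (\<integral>x. (norm (gradient f x))\<^sup>2 \<partial>\<mu>)"
    if "f \<in> test_functions UNIV" for f
  proof -
    let ?I = "\<integral>x. (norm (gradient f x))\<^sup>2 \<partial>\<mu>"
    have "0 \<le> ?I" by simp
    moreover have "C * ?I = 2 * c\<^sub>w / (\<kappa> * l) * ?I + ?I" by (simp only: C_def distrib_right mult_1)
    moreover have "(\<integral>x. (f x)\<^sup>2 \<partial>\<mu>) - (\<integral>x. f x \<partial>\<mu>)\<^sup>2 \<le> 2 * c\<^sub>w / (\<kappa> * l) * ?I"
      by (rule invariant_measure_poincare[OF \<mu> that])
    ultimately show ?thesis by linarith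
  qed
  show ?thesis
  proof (intro bexI[OF _ \<mu>(1)] conjI allI impI ballI)
    show "dual_action (P t) \<mu> = \<mu>" if "t \<ge> 0" for t by (rule \<mu>(2)[OF that])
    show "\<mu>' = \<mu>" if "\<mu>' \<in> space (prob_algebra borel)" "\<forall>t\<ge>0. dual_action (P t) \<mu>' = \<mu>'" for \<mu>'
      using invariant_measure_unique[OF \<mu> that(1)] that(2) by blast
    have "\<kappa> / 2 > 0" using kappa_pos by simp
    thus "\<exists>C\<^sub>1>0. \<exists>C\<^sub>2>0. \<forall>\<nu>\<in>space (prob_algebra borel). \<forall>t\<ge>0.
        W2 (dual_action (P t) \<nu>) \<mu> \<le> ennreal (C\<^sub>1 * exp (- C\<^sub>2 * t)) * W2 \<mu> \<nu>"
      using lip_factor_pos contr by blast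
    show "\<exists>C\<^sub>3>0. \<forall>f\<in>test_functions UNIV.
        (\<integral>x. (f x)\<^sup>2 \<partial>\<mu>) - (\<integral>x. f x \<partial>\<mu>)\<^sup>2 \<le> C\<^sub>3 * (\<integral>x. (norm (gradient f x))\<^sup>2 \<partial>\<mu>)"
      using C poinc by blast
  qed
qed

end
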